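(* The Banach space $(\tilde{\mathfrak u}_{\mathrm{res}})_*=(\mathfrak u_{\mathrm{res}})_*\oplus\mathbb R$ is a Banach Lie-Poisson space for the Poisson bracket $$\{f,g\}_d(\mu,\gamma)=\langle\mu,[D_\mu f,D_\mu g]\rangle-\gamma\,s(D_\mu f,D_\mu g),$$ where $f,g\in C^\infty((\tilde{\mathfrak u}_{\mathrm{res}})_* )$, $(\mu,\gamma)\in(\tilde{\mathfrak u}_{\mathrm{res}})_*$ is arbitrary, and $D_\mu f,D_\mu g\in\mathfrak u_{\mathrm{res}}$ denote the partial Fréchet derivatives with respect to $\mu\in(\mathfrak u_{\mathrm{res}})_*$ evaluated at $(\mu,\gamma)$.
   Context: $\mathcal H=\mathcal H_+\oplus\mathcal H_-$ is a separable complex Hilbert space written as an orthogonal sum of two closed infinite-dimensional subspaces, $p_\pm$ are the orthogonal projections onto $\mathcal H_\pm$, $d=i(p_+-p_-)$. $\mathfrak S_1,\mathfrak S_2$ denote trace class and Hilbert-Schmidt operators. $\mathfrak u_{\mathrm{res}}=\{a\in\mathcal B(\mathcal H)\mid a^*=-a,\ [d,a]\in\mathfrak S_2(\mathcal H)\}$ with norm $\|a\|+\|[d,a]\|_2$. $(\mathfrak u_{\mathrm{res}})_*=\{\rho\in\mathfrak u_{\mathrm{res}}\mid p_\pm\rho|_{\mathcal H_\pm}\in\mathfrak S_1(\mathcal H_\pm)\}$, a Banach space with trace norms on the diagonal blocks and Hilbert-Schmidt norms on the off-diagonal blocks; it is a predual of $\mathfrak u_{\mathrm{res}}$ under $\langle\mu,A\rangle=\mathrm{Tr}(\mu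 A)$. Here $\mathrm{Tr}$ of a product means the sum of the traces of its two (trace class) diagonal blocks with respect to $\mathcal H_+\oplus\mathcal H_-$. For $A,B\in\mathfrak u_{\mathrm{res}}$, $s(A,B)=\mathrm{Tr}(A[d,B])$, a continuous 2-cocycle. $\tilde{\mathfrak u}_{\mathrm{res}}=\mathfrak u_{\mathrm{res}}\oplus\mathbb R$ has bracket $[(A,a),(B,b)]_d=([A,B],-s(A,B))$. The space $(\tilde{\mathfrak u}_{\mathrm{res}})_*$ is paired with $\tilde{\mathfrak u}_{\mathrm{res}}$ by $\langle(\mu,\gamma),(A,a)\rangle_d=\langle\mu,A\rangle+\gamma a$, which identifies $\tilde{\mathfrak u}_{\mathrm{res}}$ with the dual of $(\tilde{\mathfrak u}_{\mathrm{res}})_*$. A Banach Lie-Poisson space is a real Banach space $\mathfrak b$ with a Poisson bracket on $C^\infty(\mathfrak b)$ (a Lie bracket satisfying the Leibniz rule) such that every $h\in C^\infty(\mathfrak b)$ has a Hamiltonian vector field $X_h$ on $\mathfrak b$ (with values in $\mathfrak b$, not merely in $\mathfrak b^{**}$) with $Df(X_h)=\{f,h\}$ for all $f$, and such that the dual $\mathfrak b^*\subset C^\infty(\mathfrak b)$ is closed under the bracket and is a Banach Lie algebra with it. *)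

theory Defs
  imports "HOL-Analysis.Analysis"
begin

section \<open>Complex Hilbert spaces\<close>

class complex_hilbert_space = banach + real_inner +
  fixes scaleC :: "complex \<Rightarrow> 'a \<Rightarrow> 'a" (infixr \<open>*\<^sub>C\<close> 75)
    and cinner :: "'a \<Rightarrow> 'a \<Rightarrow> complex"
  assumes scaleC_add_right: "c *\<^sub>C (x + y) = c *\<^sub>C x + c *\<^sub>C y"
    and scaleC_add_left: "(b + c) *\<^sub>C x = b *\<^sub>C x + c *\<^sub>C x"
    and scaleC_scaleC: "b *\<^sub>C (c *\<^sub>C x) = (b * c) *\<^sub>C x"
    and scaleC_of_real: "complex_of_real r *\<^sub>C x = r *\<^sub>R x"
    and cinner_commute: "cinner x y = cnj (cinner y x)"
    and cinner_add_left: "cinner (x + y) z = cinner x z + cinner y z"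
    and cinner_scaleC_left: "cinner (c *\<^sub>C x) y = c * cinner x y"
    and Re_cinner: "Re (cinner x y) = inner x y"

global_interpretation complex_vector:
  vector_space "scaleC :: complex \<Rightarrow> 'a \<Rightarrow> 'a::complex_hilbert_space"
  defines csubspace = complex_vector.subspace
    and cspan = complex_vector.span
proof
  show "1 *\<^sub>C x = x" for x :: 'a
    using scaleC_of_real[of 1 x] by simp
qed (simp_all add: scaleC_add_right scaleC_add_left scaleC_scaleC)

lemma cinner_add_right: "cinner x (y + z) = cinner x y + cinner x z"
  for x :: "'a::complex_hilbert_space"
  by (metis cinner_add_left cinner_commute complex_cnj_add)

lemma cinner_scaleC_right: "cinner x (c *\<^sub>C y) = cnj c * cinner x y"
  for x :: "'a::complex_hilbert_space"
  by (metis cinner_scaleC_left cinner_commute complex_cnj_mult)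

lemma cinner_zero_left [simp]: "cinner 0 x = 0"
  and cinner_zero_right [simp]: "cinner x 0 = 0" for x :: "'a::complex_hilbert_space"
  using cinner_add_left[of 0 0 x] cinner_add_right[of x 0 0] by simp_all

lemma cinner_minus_left: "cinner (- x) y = - cinner x y" for x :: "'a::complex_hilbert_space"
  using cinner_add_left[of x "- x" y] by (simp add: eq_neg_iff_add_eq_0 add.commute)

lemma cinner_minus_right: "cinner x (- y) = - cinner x y" for x :: "'a::complex_hilbert_space"
  using cinner_add_right[of x y "- y"] by (simp add: eq_neg_iff_add_eq_0 add.commute)

lemma cinner_diff_left: "cinner (x - y) z = cinner x z - cinner y z" for x :: "'a::complex_hilbert_space"
  using cinner_add_left[of x "- y" z] by (simp add: cinner_minus_left)

lemma cinner_diff_right: "cinner x (y - z) = cinner x y - cinner x z" for x :: "'a::complex_hilbert_space"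
  using cinner_add_right[of x y "- z"] by (simp add: cinner_minus_right)

lemma cinner_scaleR_left: "cinner (r *\<^sub>R x) y = of_real r * cinner x y" for x :: "'a::complex_hilbert_space"
  by (metis cinner_scaleC_left scaleC_of_real)

lemma cinner_scaleR_right: "cinner x (r *\<^sub>R y) = of_real r * cinner x y" for x :: "'a::complex_hilbert_space"
  by (metis cinner_scaleC_right scaleC_of_real complex_cnj_complex_of_real)

lemma cinner_sum_left: "cinner (\<Sum>i\<in>F. f i) y = (\<Sum>i\<in>F. cinner (f i) y)" for y :: "'a::complex_hilbert_space"
  by (induction F rule: infinite_finite_induct) (auto simp: cinner_add_left)

lemma cinner_sum_right: "cinner y (\<Sum>i\<in>F. f i) = (\<Sum>i\<in>F. cinner y (f i))" for y :: "'a::complex_hilbert_space"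
  by (induction F rule: infinite_finite_induct) (auto simp: cinner_add_right)

lemma cinner_self: "cinner x x = complex_of_real ((norm x)\<^sup>2)" for x :: "'a::complex_hilbert_space"
proof -
  have "Im (cinner x x) = 0"
    using cinner_commute[of x x] by (metis complex_cnj_cancel_iff cnj.simps(2) neg_equal_zero)
  moreover have "Re (cinner x x) = (norm x)\<^sup>2"
    by (simp add: Re_cinner power2_norm_eq_inner)
  ultimately show ?thesis by (simp add: complex_eq_iff)
qed

lemma norm_scaleC: "norm (c *\<^sub>C x) = cmod c * norm x" for x :: "'a::complex_hilbert_space"
proof -
  have "complex_of_real ((norm (c *\<^sub>C x))\<^sup>2) = complex_of_real ((cmod c * norm x)\<^sup>2)"
  proof -
    have "complex_of_real ((norm (c *\<^sub>C x))\<^sup>2) = c * cnj c * cinner x x"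
      by (simp only: cinner_self[symmetric] cinner_scaleC_left cinner_scaleC_right mult_ac)
    also have "\<dots> = complex_of_real ((cmod c * norm x)\<^sup>2)"
      by (simp only: cinner_self power_mult_distrib complex_norm_square[symmetric] of_real_mult)
    finally show ?thesis .
  qed
  then have "(norm (c *\<^sub>C x))\<^sup>2 = (cmod c * norm x)\<^sup>2"
    using of_real_eq_iff by blast
  then show ?thesis by simp
qed

lemma cmod_cinner_le: "cmod (cinner x y) \<le> norm x * norm y" for x :: "'a::complex_hilbert_space"
proof (cases "cinner x y = 0")
  case False
  define c where "c = cnj (cinner x y) / cmod (cinner x y)"
  have c: "cmod c = 1" using False by (simp add: c_def norm_divide)
  have "cinner (c *\<^sub>C x) y = complex_of_real (cmod (cinner x y))"
    using False complex_norm_square[of "cinner x y"]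
    by (simp add: cinner_scaleC_left c_def field_simps power2_eq_square)
  then have "cmod (cinner x y) = inner (c *\<^sub>C x) y"
    by (metis Re_cinner Re_complex_of_real)
  also have "\<dots> \<le> norm (c *\<^sub>C x) * norm y" by (rule norm_cauchy_schwarz)
  finally show ?thesis by (simp add: norm_scaleC c)
qed simp

lemma bounded_linear_cinner_left: "bounded_linear (\<lambda>x. cinner x (y::'a::complex_hilbert_space))"
  by (rule bounded_linear_intro[where K="norm y"])
    (auto simp: cinner_add_left cinner_scaleR_left cmod_cinner_le scaleR_conv_of_real)

lemma bounded_linear_cinner_right: "bounded_linear (\<lambda>x. cinner (y::'a::complex_hilbert_space) x)"
  using cmod_cinner_le[of y]
  by (intro bounded_linear_intro[where K="norm y"])
    (auto simp: cinner_add_right cinner_scaleR_right scaleR_conv_of_real mult.commute[of _ "norm y"])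

lemma cinner_eqI: "(\<And>z. cinner x z = cinner y z) \<Longrightarrow> x = y" for x :: "'a::complex_hilbert_space"
  by (metis Re_cinner cinner_diff_left eq_iff_diff_eq_0 inner_eq_zero_iff zero_complex.sel(1))

lemma cinner_eqI': "(\<And>z. cinner z x = cinner z y) \<Longrightarrow> x = y" for x :: "'a::complex_hilbert_space"
  by (metis cinner_commute cinner_eqI)

lemma scaleC_minus_right: "c *\<^sub>C (- x) = - (c *\<^sub>C x)" for x :: "'a::complex_hilbert_space"
  by (rule complex_vector.scale_minus_right)

subsection \<open>Orthogonal projection and Riesz representation\<close>

lemma closed_csubspace_projection:
  fixes M :: "'a::complex_hilbert_space set"
  assumes M: "csubspace M" "closed M"
  obtains y where "y \<in> M" "\<And>z. z \<in> M \<Longrightarrow> cinner (x - y) z = 0"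
proof -
  have M0: "0 \<in> M" and Madd: "\<And>u v. u \<in> M \<Longrightarrow> v \<in> M \<Longrightarrow> u + v \<in> M"
    and MC: "\<And>c u. u \<in> M \<Longrightarrow> c *\<^sub>C u \<in> M"
    using M(1) by (auto simp: complex_vector.subspace_def)
  have MR: "\<And>r u. u \<in> M \<Longrightarrow> r *\<^sub>R u \<in> M" using MC by (metis scaleC_of_real)
  define d where "d = (INF m\<in>M. (norm (x - m))\<^sup>2)"
  have bdd: "bdd_below ((\<lambda>m. (norm (x - m))\<^sup>2) ` M)" by (auto intro!: bdd_belowI[of _ 0])
  have dle: "d \<le> (norm (x - m))\<^sup>2" if "m \<in> M" for m
    unfolding d_def by (rule cINF_lower[OF bdd that])
  have "\<exists>m\<in>M. (norm (x - m))\<^sup>2 < d + inverse (real (Suc n))" for n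
  proof -
    have "d < d + inverse (real (Suc n))" by simp
    then show ?thesis
      unfolding d_def using M0 bdd by (subst (asm) (1) cINF_less_iff) auto
  qed
  then obtain m where mM: "\<And>n. m n \<in> M"
    and mlt: "\<And>n. (norm (x - m n))\<^sup>2 < d + inverse (real (Suc n))" by metis
  have par: "(norm (m k - m l))\<^sup>2 \<le> 2 * inverse (real (Suc k)) + 2 * inverse (real (Suc l))" for k l
  proof -
    have "(1/2) *\<^sub>R (m k + m l) \<in> M" using mM Madd MR by blast
    from dle[OF this] have "4 * d \<le> (norm (2 *\<^sub>R (x - (1/2) *\<^sub>R (m k + m l))))\<^sup>2"
      by (simp add: power_mult_distrib)
    also have "2 *\<^sub>R (x - (1/2) *\<^sub>R (m k + m l)) = (x - m k) + (x - m l)"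
      by (simp add: algebra_simps scaleR_2)
    finally have 1: "4 * d \<le> (norm ((x - m k) + (x - m l)))\<^sup>2" .
    have "(norm ((x - m k) + (x - m l)))\<^sup>2 + (norm ((x - m k) - (x - m l)))\<^sup>2
      = 2 * (norm (x - m k))\<^sup>2 + 2 * (norm (x - m l))\<^sup>2"
      by (simp only: power2_norm_eq_inner) (simp add: inner_diff inner_add algebra_simps inner_commute)
    moreover have "norm ((x - m k) - (x - m l)) = norm (m k - m l)"
      by (simp add: norm_minus_commute)
    ultimately show ?thesis using 1 mlt[of k] mlt[of l] by simp
  qed
  have "Cauchy m"
  proof (rule metric_CauchyI)
    fix e :: real assume e: "0 < e"
    obtain N where N: "inverse (real (Suc N)) < e\<^sup>2 / 4"
      using e reals_Archimedean[of "e\<^sup>2/4"] by auto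
    have "dist (m k) (m l) < e" if "k \<ge> N" "l \<ge> N" for k l
    proof -
      have "inverse (real (Suc k)) \<le> inverse (real (Suc N))" "inverse (real (Suc l)) \<le> inverse (real (Suc N))"
        using that by (auto intro!: le_imp_inverse_le)
      then have "(norm (m k - m l))\<^sup>2 < e\<^sup>2"
        using par[of k l] N by linarith
      then show ?thesis using e by (metis dist_norm less_eq_real_def power2_less_imp_less)
    qed
    then show "\<exists>N. \<forall>k\<ge>N. \<forall>l\<ge>N. dist (m k) (m l) < e" by blast
  qed
  then obtain y where y: "m \<longlonglongrightarrow> y" using Cauchy_convergent convergent_def by blast
  have yM: "y \<in> M" using closed_sequentially[OF M(2)] mM y by blast
  have "(\<lambda>n. (norm (x - m n))\<^sup>2) \<longlonglongrightarrow> (norm (x - y))\<^sup>2" by (intro tendsto_intros y)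
  moreover have "(\<lambda>n. d + inverse (real (Suc n))) \<longlonglongrightarrow> d + 0"
    by (intro tendsto_intros LIMSEQ_inverse_real_of_nat)
  ultimately have "(norm (x - y))\<^sup>2 \<le> d + 0"
    by (rule LIMSEQ_le) (use mlt less_imp_le in blast)
  then have yd: "(norm (x - y))\<^sup>2 \<le> d" by simp
  have orth: "inner (x - y) z = 0" if z: "z \<in> M" for z
  proof (rule ccontr)
    assume nz: "inner (x - y) z \<noteq> 0"
    then have z0: "inner z z > 0" by auto
    define t where "t = inner (x - y) z / inner z z"
    have "y + t *\<^sub>R z \<in> M" using yM z Madd MR by blast
    from dle[OF this] yd have "(norm (x - y))\<^sup>2 \<le> (norm ((x - y) - t *\<^sub>R z))\<^sup>2"
      unfolding diff_diff_add by linarith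
    also have "\<dots> = (norm (x - y))\<^sup>2 - 2 * t * inner (x - y) z + t\<^sup>2 * inner z z"
      unfolding power2_norm_eq_inner
      by (simp add: inner_diff inner_commute power2_eq_square algebra_simps)
    also have "\<dots> = (norm (x - y))\<^sup>2 - (inner (x - y) z)\<^sup>2 / inner z z"
      using z0 by (simp add: t_def field_simps power2_eq_square)
    finally have "(inner (x - y) z)\<^sup>2 / inner z z \<le> 0" by simp
    moreover have "(inner (x - y) z)\<^sup>2 / inner z z > 0" using z0 nz by simp
    ultimately show False by linarith
  qed
  have "cinner (x - y) z = 0" if z: "z \<in> M" for z
  proof -
    have "Re (cinner (x - y) z) = 0" by (simp add: Re_cinner orth z)
    moreover have "Re (cinner (x - y) (\<i> *\<^sub>C z)) = 0" by (simp add: Re_cinner orth MC z)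
    ultimately show ?thesis by (simp add: cinner_scaleC_right complex_eq_iff)
  qed
  then show ?thesis using that yM by blast
qed

lemma riesz:
  fixes \<phi> :: "'a::complex_hilbert_space \<Rightarrow> complex"
  assumes bl: "bounded_linear \<phi>" and cl: "\<And>c x. \<phi> (c *\<^sub>C x) = c * \<phi> x"
  shows "\<exists>y. \<forall>x. \<phi> x = cinner x y"
proof (cases "\<forall>x. \<phi> x = 0")
  case True
  then show ?thesis by (intro exI[of _ 0]) simp
next
  case False
  then obtain x0 where x0: "\<phi> x0 \<noteq> 0" by blast
  interpret \<phi>: bounded_linear \<phi> by (fact bl)
  let ?M = "{x. \<phi> x = 0}"
  have "csubspace ?M" by (auto simp: complex_vector.subspace_def \<phi>.add cl \<phi>.zero)
  moreover have "closed ?M"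
    by (intro closed_Collect_eq continuous_intros \<phi>.continuous_on)
  ultimately obtain p where p: "p \<in> ?M" "\<And>z. z \<in> ?M \<Longrightarrow> cinner (x0 - p) z = 0"
    using closed_csubspace_projection by blast
  define u where "u = x0 - p"
  have pu: "\<phi> u \<noteq> 0" using p(1) x0 by (simp add: u_def \<phi>.diff)
  then have nu: "norm u \<noteq> 0" using \<phi>.zero by auto
  have "\<phi> x = cinner x ((cnj (\<phi> u) / (norm u)\<^sup>2) *\<^sub>C u)" for x
  proof -
    have "x - (\<phi> x / \<phi> u) *\<^sub>C u \<in> ?M" using pu by (simp add: \<phi>.diff cl)
    from p(2)[OF this] have "cinner (x - (\<phi> x / \<phi> u) *\<^sub>C u) u = 0"
      using cinner_commute u_def by (metis complex_cnj_zero)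
    then have "cinner x u = \<phi> x / \<phi> u * (norm u)\<^sup>2"
      by (simp add: cinner_diff_left cinner_scaleC_left cinner_self)
    then show ?thesis using pu nu by (simp add: cinner_scaleC_right)
  qed
  then show ?thesis by blast
qed

section \<open>Bounded operators\<close>

text \<open>The bounded operators on \<open>'a\<close> are the real-linear bounded maps \<^typ>\<open>'a \<Rightarrow>\<^sub>L 'a\<close> that
  commute with complex scalars; the norm of \<^typ>\<open>'a \<Rightarrow>\<^sub>L 'a\<close> is the operator norm.\<close>

definition clinear_op :: "('a::complex_hilbert_space \<Rightarrow>\<^sub>L 'a) \<Rightarrow> bool" where
  "clinear_op T \<longleftrightarrow> (\<forall>c x. T (c *\<^sub>C x) = c *\<^sub>C T x)"

definition cadjoint :: "('a::complex_hilbert_space \<Rightarrow>\<^sub>L 'a) \<Rightarrow> ('a \<Rightarrow>\<^sub>L 'a)" where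
  "cadjoint T = (THE S :: 'a \<Rightarrow>\<^sub>L 'a. \<forall>x y. cinner (T x) y = cinner x (S y))"

lemma cadjoint_exists:
  fixes T :: "'a::complex_hilbert_space \<Rightarrow>\<^sub>L 'a"
  assumes "clinear_op T"
  shows "\<exists>S::'a \<Rightarrow>\<^sub>L 'a. \<forall>x y. cinner (T x) y = cinner x (S y)"
proof -
  have "\<exists>z. \<forall>x. cinner (T x) y = cinner x z" for y
    using assms
    by (intro riesz bounded_linear_compose[OF bounded_linear_cinner_left] blinfun.bounded_linear_right)
      (auto simp: clinear_op_def cinner_scaleC_left)
  then obtain s where s: "\<And>x y. cinner (T x) y = cinner x (s y)" by metis
  have "bounded_linear s"
  proof (rule bounded_linear_intro[where K="norm T"])
    show "s (x + y) = s x + s y" for x y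
      by (rule cinner_eqI') (simp add: cinner_add_right flip: s)
    show "s (r *\<^sub>R x) = r *\<^sub>R s x" for r x
      by (rule cinner_eqI') (simp add: cinner_scaleR_right flip: s)
    show "norm (s y) \<le> norm y * norm T" for y
    proof (cases "s y = 0")
      case False
      have "(norm (s y))\<^sup>2 = cmod (cinner (s y) (s y))" by (simp add: cinner_self norm_power)
      also have "\<dots> = cmod (cinner (T (s y)) y)" by (simp add: s)
      also have "\<dots> \<le> norm (T (s y)) * norm y" by (rule cmod_cinner_le)
      also have "\<dots> \<le> (norm T * norm (s y)) * norm y"
        by (intro mult_right_mono norm_blinfun) auto
      finally show ?thesis using False by (simp add: power2_eq_square mult.commute)
    qed simp
  qed
  then show ?thesis
    using s by (intro exI[of _ "Blinfun s"]) (simp add: bounded_linear_Blinfun_apply)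
qed

lemma cadjoint_eqI:
  fixes T S :: "'a::complex_hilbert_space \<Rightarrow>\<^sub>L 'a"
  assumes "\<And>x y. cinner (T x) y = cinner x (S y)"
  shows "cadjoint T = S"
  unfolding cadjoint_def
proof (rule the_equality)
  show "\<forall>x y. cinner (T x) y = cinner x (S y)" using assms by blast
  show "S' = S" if "\<forall>x y. cinner (T x) y = cinner x (S' y)" for S' :: "'a \<Rightarrow>\<^sub>L 'a"
    using that assms by (intro blinfun_eqI cinner_eqI') metis
qed

lemma cadjoint: "clinear_op T \<Longrightarrow> cinner (T x) y = cinner x (cadjoint T y)"
  using cadjoint_exists cadjoint_eqI by metis

lemma cadjoint': "clinear_op T \<Longrightarrow> cinner (cadjoint T x) y = cinner x (T y)"
  using cadjoint cinner_commute by metis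

lemma clinear_op_cadjoint: "clinear_op T \<Longrightarrow> clinear_op (cadjoint T)"
  unfolding clinear_op_def[of "cadjoint T"]
  by (intro allI cinner_eqI) (simp add: cadjoint' cinner_scaleC_left)

lemma cadjoint_eq_iff:
  "clinear_op T \<Longrightarrow> cadjoint T = S \<longleftrightarrow> (\<forall>x y. cinner (T x) y = cinner x (S y))"
  using cadjoint cadjoint_eqI by metis

definition positive_op :: "('a::complex_hilbert_space \<Rightarrow>\<^sub>L 'a) \<Rightarrow> bool" where
  "positive_op R \<longleftrightarrow> clinear_op R \<and> cadjoint R = R \<and> (\<forall>x. 0 \<le> Re (cinner (R x) x))"

definition abs_op :: "('a::complex_hilbert_space \<Rightarrow>\<^sub>L 'a) \<Rightarrow> ('a \<Rightarrow>\<^sub>L 'a)" where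
  "abs_op T = (THE R. positive_op R \<and> R o\<^sub>L R = cadjoint T o\<^sub>L T)"

definition is_onb :: "'a::complex_hilbert_space set \<Rightarrow> bool" where
  "is_onb E \<longleftrightarrow> (\<forall>e\<in>E. norm e = 1) \<and> (\<forall>e\<in>E. \<forall>f\<in>E. e \<noteq> f \<longrightarrow> cinner e f = 0)
    \<and> closure (cspan E) = UNIV"

definition some_onb :: "'a::complex_hilbert_space set" where
  "some_onb = (SOME E. is_onb E)"

definition trace :: "('a::complex_hilbert_space \<Rightarrow>\<^sub>L 'a) \<Rightarrow> complex" where
  "trace T = (\<Sum>\<^sub>\<infinity>e\<in>some_onb. cinner (T e) e)"

text \<open>For the positive operator \<^term>\<open>abs_op T\<close> the numbers \<^term>\<open>cinner (abs_op T e) e\<close> are real.\<close>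

definition trace_class :: "('a::complex_hilbert_space \<Rightarrow>\<^sub>L 'a) \<Rightarrow> bool" where
  "trace_class T \<longleftrightarrow> clinear_op T \<and>
    (\<exists>E. is_onb E \<and> (\<lambda>e. Re (cinner (abs_op T e) e)) summable_on E)"

definition trace_norm :: "('a::complex_hilbert_space \<Rightarrow>\<^sub>L 'a) \<Rightarrow> real" where
  "trace_norm T = (\<Sum>\<^sub>\<infinity>e\<in>some_onb. Re (cinner (abs_op T e) e))"

definition hilbert_schmidt :: "('a::complex_hilbert_space \<Rightarrow>\<^sub>L 'a) \<Rightarrow> bool" where
  "hilbert_schmidt T \<longleftrightarrow> clinear_op T \<and>
    (\<exists>E. is_onb E \<and> (\<lambda>e. (norm (T e))\<^sup>2) summable_on E)"

definition hs_norm :: "('a::complex_hilbert_space \<Rightarrow>\<^sub>L 'a) \<Rightarrow> real" where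
  "hs_norm T = sqrt (\<Sum>\<^sub>\<infinity>e\<in>some_onb. (norm (T e))\<^sup>2)"


subsection \<open>Orthonormal bases\<close>

definition bessel :: "'i set \<Rightarrow> ('i \<Rightarrow> 'a::complex_hilbert_space) \<Rightarrow> bool" where
  "bessel F x \<longleftrightarrow> finite F \<and> (\<forall>v. (\<Sum>i\<in>F. (cmod (cinner v (x i)))\<^sup>2) \<le> (norm v)\<^sup>2)"

lemma norm_diff_onb_sum:
  fixes v :: "'a::complex_hilbert_space"
  assumes "finite G" "\<And>e. e \<in> G \<Longrightarrow> norm e = 1"
    and "\<And>e f. e \<in> G \<Longrightarrow> f \<in> G \<Longrightarrow> e \<noteq> f \<Longrightarrow> cinner e f = 0"
  shows "(norm (v - (\<Sum>e\<in>G. c e *\<^sub>C e)))\<^sup>2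
    = (norm v)\<^sup>2 - (\<Sum>e\<in>G. (cmod (cinner v e))\<^sup>2) + (\<Sum>e\<in>G. (cmod (cinner v e - c e))\<^sup>2)"
proof -
  define w where "w = (\<Sum>e\<in>G. c e *\<^sub>C e)"
  have we: "cinner w e = c e" if "e \<in> G" for e
  proof -
    have "cinner w e = (\<Sum>f\<in>G. if f = e then c e else 0)"
      unfolding w_def cinner_sum_left
      using assms(2,3) that by (intro sum.cong) (auto simp: cinner_scaleC_left cinner_self)
    then show ?thesis using that assms(1) by simp
  qed
  have ww: "cinner w w = (\<Sum>e\<in>G. c e * cnj (c e))"
    by (subst (2) w_def) (auto simp: cinner_sum_right cinner_scaleC_right we mult.commute intro!: sum.cong)
  have vw: "cinner v w = (\<Sum>e\<in>G. cnj (c e) * cinner v e)"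
    by (simp add: w_def cinner_sum_right cinner_scaleC_right)
  have wv: "cinner w v = (\<Sum>e\<in>G. c e * cnj (cinner v e))"
    by (subst cinner_commute) (simp add: vw)
  have "complex_of_real ((norm (v - w))\<^sup>2) = cinner v v - cinner v w - cinner w v + cinner w w"
    unfolding cinner_self[symmetric] by (simp add: cinner_diff_left cinner_diff_right)
  also have "\<dots> = cinner v v - (\<Sum>e\<in>G. cinner v e * cnj (cinner v e))
      + (\<Sum>e\<in>G. (cinner v e - c e) * cnj (cinner v e - c e))"
    unfolding vw wv ww
    by (simp add: algebra_simps sum.distrib sum_subtractf)
  also have "\<dots> = complex_of_real ((norm v)\<^sup>2 - (\<Sum>e\<in>G. (cmod (cinner v e))\<^sup>2)
      + (\<Sum>e\<in>G. (cmod (cinner v e - c e))\<^sup>2))"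
    by (simp only: cinner_self complex_norm_square[symmetric] of_real_diff of_real_add of_real_sum)
  finally show ?thesis unfolding w_def using of_real_eq_iff by blast
qed

lemma bessel_orthonormal:
  fixes G :: "'a::complex_hilbert_space set"
  assumes "finite G" "\<And>e. e \<in> G \<Longrightarrow> norm e = 1"
    and "\<And>e f. e \<in> G \<Longrightarrow> f \<in> G \<Longrightarrow> e \<noteq> f \<Longrightarrow> cinner e f = 0"
  shows "bessel G (\<lambda>e. e)"
  unfolding bessel_def
proof (intro conjI allI)
  fix v :: 'a
  have "0 \<le> (norm (v - (\<Sum>e\<in>G. cinner v e *\<^sub>C e)))\<^sup>2" by simp
  then show "(\<Sum>i\<in>G. (cmod (cinner v i))\<^sup>2) \<le> (norm v)\<^sup>2"
    by (subst (asm) norm_diff_onb_sum[OF assms]) auto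
qed (fact assms)

lemma is_onb_subset:
  assumes "is_onb E" "G \<subseteq> E"
  shows "\<And>e. e \<in> G \<Longrightarrow> norm e = 1" "\<And>e f. e \<in> G \<Longrightarrow> f \<in> G \<Longrightarrow> e \<noteq> f \<Longrightarrow> cinner e f = 0"
  using assms unfolding is_onb_def by blast+

lemma bessel_onb: "is_onb E \<Longrightarrow> finite G \<Longrightarrow> G \<subseteq> E \<Longrightarrow> bessel G (\<lambda>e. e)"
  by (rule bessel_orthonormal) (simp_all add: is_onb_subset)

lemma bessel_single: "norm x \<le> 1 \<Longrightarrow> bessel {i} (\<lambda>_. x)"
proof -
  assume x: "norm x \<le> 1"
  have "cmod (cinner v x) \<le> norm v" for v
    using cmod_cinner_le[of v x] mult_left_mono[OF x, of "norm v"] by simp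
  then show ?thesis by (auto simp: bessel_def intro!: power_mono)
qed

lemma bessel_norm_le: 
  assumes "bessel F x" "i \<in> F" shows "norm (x i) \<le> 1"
proof -
  have "(cmod (cinner (x i) (x i)))\<^sup>2 \<le> (\<Sum>j\<in>F. (cmod (cinner (x i) (x j)))\<^sup>2)"
    using assms by (intro member_le_sum) (auto simp: bessel_def)
  also have "\<dots> \<le> (norm (x i))\<^sup>2" using assms by (auto simp: bessel_def)
  finally have "((norm (x i))\<^sup>2)\<^sup>2 \<le> (norm (x i))\<^sup>2" by (simp add: cinner_self norm_power)
  moreover have "a \<le> 1" if "a\<^sup>2 \<le> a" for a :: real
  proof (rule ccontr)
    assume "\<not> a \<le> 1"
    then have "a * 1 < a * a" by (intro mult_strict_left_mono) auto
    with that show False by (simp add: power2_eq_square)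
  qed
  ultimately have "(norm (x i))\<^sup>2 \<le> 1\<^sup>2" by simp
  then show ?thesis by (rule power2_le_imp_le) simp
qed

lemma onb_parseval_approx:
  fixes v :: "'a::complex_hilbert_space"
  assumes E: "is_onb E" and e: "0 < \<epsilon>"
  shows "\<exists>G\<subseteq>E. finite G \<and> (\<forall>G'. G \<subseteq> G' \<longrightarrow> G' \<subseteq> E \<longrightarrow> finite G' \<longrightarrow>
    (norm v)\<^sup>2 \<le> (\<Sum>e\<in>G'. (cmod (cinner v e))\<^sup>2) + \<epsilon>)"
proof -
  have "v \<in> closure (cspan E)" using E by (simp add: is_onb_def)
  then obtain w where w: "w \<in> cspan E" "dist w v < sqrt \<epsilon>"
    using e by (metis closure_approachable real_sqrt_gt_zero)
  from w(1) obtain G c where G: "finite G" "G \<subseteq> E" "w = (\<Sum>a\<in>G. c a *\<^sub>C a)"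
    by (auto simp: complex_vector.span_explicit)
  have "(norm (v - w))\<^sup>2 \<le> (sqrt \<epsilon>)\<^sup>2"
    using w(2) by (intro power_mono) (auto simp: dist_norm norm_minus_commute)
  moreover have "(norm v)\<^sup>2 - (\<Sum>e\<in>G. (cmod (cinner v e))\<^sup>2) \<le> (norm (v - w))\<^sup>2"
    unfolding G(3)
    by (subst norm_diff_onb_sum[OF G(1) is_onb_subset[OF E G(2)]]) (auto intro!: sum_nonneg)
  ultimately have "(norm v)\<^sup>2 \<le> (\<Sum>e\<in>G. (cmod (cinner v e))\<^sup>2) + \<epsilon>" using e by simp
  moreover have "(\<Sum>e\<in>G. (cmod (cinner v e))\<^sup>2) \<le> (\<Sum>e\<in>G'. (cmod (cinner v e))\<^sup>2)"
    if "G \<subseteq> G'" "finite G'" for G' using that by (intro sum_mono2) auto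
  ultimately have "\<forall>G'. G \<subseteq> G' \<longrightarrow> G' \<subseteq> E \<longrightarrow> finite G' \<longrightarrow>
    (norm v)\<^sup>2 \<le> (\<Sum>e\<in>G'. (cmod (cinner v e))\<^sup>2) + \<epsilon>" by (meson add_right_mono order_trans)
  then show ?thesis using G by blast
qed

lemma ex_onb: "\<exists>E::'a::complex_hilbert_space set. is_onb E"
proof -
  let ?A = "{E::'a set. (\<forall>e\<in>E. norm e = 1) \<and> (\<forall>e\<in>E. \<forall>f\<in>E. e \<noteq> f \<longrightarrow> cinner e f = 0)}"
  have "\<exists>M\<in>?A. \<forall>X\<in>?A. M \<subseteq> X \<longrightarrow> X = M"
  proof (rule subset_Zorn')
    fix C assume C: "subset.chain ?A C"
    have "norm e = 1" if "e \<in> \<Union>C" for e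
    proof -
      obtain X where X: "X \<in> C" "e \<in> X" using \<open>e \<in> \<Union>C\<close> by blast
      then have "X \<in> ?A" using C by (auto simp: subset.chain_def)
      then show ?thesis using X by blast
    qed
    moreover have "cinner e f = 0" if "e \<in> \<Union>C" "f \<in> \<Union>C" "e \<noteq> f" for e f
    proof -
      obtain X Y where XY: "X \<in> C" "Y \<in> C" "e \<in> X" "f \<in> Y" using \<open>e \<in> \<Union>C\<close> \<open>f \<in> \<Union>C\<close> by blast
      then have "X \<subseteq> Y \<or> Y \<subseteq> X" using subset.chain_total[OF C] by blast
      then obtain Z where Z: "Z \<in> C" "e \<in> Z" "f \<in> Z" using XY by blast
      then have "Z \<in> ?A" using C by (auto simp: subset.chain_def)
      then show ?thesis using Z \<open>e \<noteq> f\<close> by blast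
    qed
    ultimately show "\<Union>C \<in> ?A" by blast
  qed
  then obtain M where M: "M \<in> ?A" and max: "\<forall>X\<in>?A. M \<subseteq> X \<longrightarrow> X = M" by (rule bexE)
  have "x \<in> closure (cspan M)" for x
  proof (rule ccontr)
    assume x: "x \<notin> closure (cspan M)"
    have sub: "csubspace (closure (cspan M))"
      unfolding complex_vector.subspace_def
    proof (intro conjI ballI allI)
      show "0 \<in> closure (cspan M)"
        by (rule subsetD[OF closure_subset complex_vector.span_zero])
      fix y assume y: "y \<in> closure (cspan M)"
      then obtain s where s: "\<And>n. s n \<in> cspan M" "s \<longlonglongrightarrow> y"
        unfolding closure_sequential by blast
      show "y + z \<in> closure (cspan M)" if z: "z \<in> closure (cspan M)" for z
      proof -
        obtain t where t: "\<And>n. t n \<in> cspan M" "t \<longlonglongrightarrow> z"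
          using z unfolding closure_sequential by blast
        have "(\<lambda>n. s n + t n) \<longlonglongrightarrow> y + z" by (intro tendsto_add s t)
        moreover have "s n + t n \<in> cspan M" for n using s t by (simp add: complex_vector.span_add)
        ultimately show ?thesis
          unfolding closure_sequential by (intro exI[of _ "\<lambda>n. s n + t n"]) blast
      qed
      show "c *\<^sub>C y \<in> closure (cspan M)" for c
      proof -
        have "bounded_linear (\<lambda>x::'a. c *\<^sub>C x)"
          by (rule bounded_linear_intro[where K="cmod c"])
            (auto simp: scaleC_add_right norm_scaleC mult.commute scaleC_scaleC simp flip: scaleC_of_real)
        then have "(\<lambda>n. c *\<^sub>C s n) \<longlonglongrightarrow> c *\<^sub>C y" using s(2) by (rule bounded_linear.tendsto)
        moreover have "c *\<^sub>C s n \<in> cspan M" for n using s by (simp add: complex_vector.span_scale)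
        ultimately show ?thesis
          unfolding closure_sequential by (intro exI[of _ "\<lambda>n. c *\<^sub>C s n"]) blast
      qed
    qed
    obtain y where y: "y \<in> closure (cspan M)" "\<And>z. z \<in> closure (cspan M) \<Longrightarrow> cinner (x - y) z = 0"
      using closed_csubspace_projection[OF sub closed_closure, of x] by blast
    define u where "u = (1 / norm (x - y)) *\<^sub>R (x - y)"
    have ne: "x - y \<noteq> 0" using x y(1) by auto
    have u1: "norm u = 1" using ne by (simp add: u_def)
    have uM: "cinner u z = 0" if "z \<in> M" for z
      using y(2)[OF subsetD[OF closure_subset complex_vector.span_base[OF that]]]
      by (simp add: u_def cinner_scaleR_left)
    have Mu: "cinner z u = 0" if "z \<in> M" for z using uM[OF that] cinner_commute[of z u] by simp
    have "insert u M \<in> ?A" using M u1 uM Mu by auto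
    from bspec[OF max this] have "u \<in> M" by blast
    from uM[OF this] u1 show False by (simp add: cinner_self)
  qed
  then have "is_onb M" using M by (auto simp: is_onb_def)
  then show ?thesis by blast
qed

lemma some_onb: "is_onb some_onb"
  unfolding some_onb_def by (rule someI_ex[OF ex_onb])

lemma onb_parseval:
  assumes "is_onb E" "finite F" "0 < \<epsilon>"
  shows "\<exists>G\<subseteq>E. finite G \<and> (\<forall>i\<in>F. (norm (v i))\<^sup>2 \<le> (\<Sum>e\<in>G. (cmod (cinner (v i) e))\<^sup>2) + \<epsilon>)"
proof -
  define Q where "Q i G \<longleftrightarrow> G \<subseteq> E \<and> finite G \<and> (\<forall>G'. G \<subseteq> G' \<longrightarrow> G' \<subseteq> E \<longrightarrow> finite G' \<longrightarrow>
      (norm (v i))\<^sup>2 \<le> (\<Sum>e\<in>G'. (cmod (cinner (v i) e))\<^sup>2) + \<epsilon>)" for i G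
  have "\<exists>G. Q i G" for i
    using onb_parseval_approx[OF assms(1,3), of "v i"] unfolding Q_def by blast
  then obtain G where "\<And>i. Q i (G i)" by metis
  then have G: "\<And>i. G i \<subseteq> E" "\<And>i. finite (G i)"
    "\<And>i G'. G i \<subseteq> G' \<Longrightarrow> G' \<subseteq> E \<Longrightarrow> finite G' \<Longrightarrow>
      (norm (v i))\<^sup>2 \<le> (\<Sum>e\<in>G'. (cmod (cinner (v i) e))\<^sup>2) + \<epsilon>"
    by (simp_all add: Q_def)
  show ?thesis
    using G assms(2) by (intro exI[of _ "\<Union>i\<in>F. G i"]) (auto intro!: G(3))
qed

lemma onb_zero_imp_zero:
  assumes E: "is_onb E" and z: "\<And>e. e \<in> E \<Longrightarrow> cinner v e = 0"
  shows "v = 0"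
proof -
  have "(norm v)\<^sup>2 \<le> 0 + \<epsilon>" if "0 < \<epsilon>" for \<epsilon>
    using onb_parseval[OF E _ that, of "{()}" "\<lambda>_. v"] z by (auto simp: subset_iff)
  then have "(norm v)\<^sup>2 \<le> 0" by (rule field_le_epsilon)
  then show ?thesis by simp
qed

subsection \<open>Hilbert--Schmidt operators\<close>

lemma hs_adjoint_bessel:
  fixes T S :: "'a::complex_hilbert_space \<Rightarrow> 'a"
  assumes adj: "\<And>x y. cinner (T x) y = cinner x (S y)"
    and E: "is_onb E" and K: "\<And>G. finite G \<Longrightarrow> G \<subseteq> E \<Longrightarrow> (\<Sum>e\<in>G. (norm (T e))\<^sup>2) \<le> K"
    and x: "bessel F x"
  shows "(\<Sum>i\<in>F. (norm (S (x i)))\<^sup>2) \<le> K"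
proof (rule field_le_epsilon)
  fix \<epsilon> :: real assume \<epsilon>: "0 < \<epsilon>"
  have F: "finite F" using x by (simp add: bessel_def)
  define \<delta> where "\<delta> = \<epsilon> / (real (card F) + 1)"
  have \<delta>: "0 < \<delta>" "real (card F) * \<delta> \<le> \<epsilon>" using \<epsilon> by (auto simp: \<delta>_def field_simps)
  obtain G where G: "G \<subseteq> E" "finite G"
    "\<And>i. i \<in> F \<Longrightarrow> (norm (S (x i)))\<^sup>2 \<le> (\<Sum>e\<in>G. (cmod (cinner (S (x i)) e))\<^sup>2) + \<delta>"
    using onb_parseval[OF E F \<delta>(1), of "\<lambda>i. S (x i)"] by blast
  have sw: "cmod (cinner (S y) e) = cmod (cinner (T e) y)" for y e
    by (subst cinner_commute) (simp add: adj)
  have "(\<Sum>i\<in>F. (norm (S (x i)))\<^sup>2) \<le> (\<Sum>i\<in>F. (\<Sum>e\<in>G. (cmod (cinner (T e) (x i)))\<^sup>2) + \<delta>)"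
    using G(3) unfolding sw by (intro sum_mono)
  also have "\<dots> = (\<Sum>e\<in>G. \<Sum>i\<in>F. (cmod (cinner (T e) (x i)))\<^sup>2) + real (card F) * \<delta>"
    by (subst sum.swap) (simp add: sum.distrib)
  also have "\<dots> \<le> (\<Sum>e\<in>G. (norm (T e))\<^sup>2) + \<epsilon>"
    using x \<delta>(2) by (intro add_mono sum_mono) (auto simp: bessel_def)
  also have "\<dots> \<le> K + \<epsilon>" using K[OF G(2,1)] by simp
  finally show "(\<Sum>i\<in>F. (norm (S (x i)))\<^sup>2) \<le> K + \<epsilon>" .
qed

lemma hs_bessel_of_onb:
  assumes T: "clinear_op T" and E: "is_onb E"
    and K: "\<And>G. finite G \<Longrightarrow> G \<subseteq> E \<Longrightarrow> (\<Sum>e\<in>G. (norm (T e))\<^sup>2) \<le> K"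
    and x: "bessel F x"
  shows "(\<Sum>i\<in>F. (norm (T (x i)))\<^sup>2) \<le> K"
proof (rule hs_adjoint_bessel[OF _ E _ x])
  show "cinner (cadjoint T x) y = cinner x (T y)" for x y by (rule cadjoint'[OF T])
  show "(\<Sum>e\<in>G. (norm (cadjoint T e))\<^sup>2) \<le> K" if "finite G" "G \<subseteq> E" for G
    using hs_adjoint_bessel[OF cadjoint[OF T] E K bessel_onb[OF E that]] .
qed

lemma summable_on_bounded_partial:
  fixes f :: "'a \<Rightarrow> real"
  assumes "\<And>x. x \<in> E \<Longrightarrow> 0 \<le> f x" and "\<And>G. finite G \<Longrightarrow> G \<subseteq> E \<Longrightarrow> sum f G \<le> K"
  shows "f summable_on E" "infsum f E \<le> K"
proof -
  show *: "f summable_on E"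
    using assms by (intro nonneg_bdd_above_summable_on) (auto intro!: bdd_aboveI[of _ K])
  show "infsum f E \<le> K"
    using * assms(2) by (rule infsum_le_finite_sums)
qed

lemma hs_norm_nonneg: "0 \<le> hs_norm T"
  by (auto simp: hs_norm_def intro!: infsum_nonneg)

lemma hs_bessel:
  assumes "hilbert_schmidt T" "bessel F x"
  shows "(\<Sum>i\<in>F. (norm (T (x i)))\<^sup>2) \<le> (hs_norm T)\<^sup>2"
proof -
  from assms(1) obtain E where T: "clinear_op T" and E: "is_onb E"
    and sm: "(\<lambda>e. (norm (T e))\<^sup>2) summable_on E" by (auto simp: hilbert_schmidt_def)
  have "(\<Sum>e\<in>G. (norm (T e))\<^sup>2) \<le> (\<Sum>\<^sub>\<infinity>e\<in>E. (norm (T e))\<^sup>2)" if "finite G" "G \<subseteq> E" for G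
    using that by (intro finite_sum_le_infsum sm) auto
  note b = hs_bessel_of_onb[OF T E this]
  have sm': "(\<lambda>e. (norm (T e))\<^sup>2) summable_on some_onb"
    using b[OF _ _ bessel_onb[OF some_onb]] by (intro summable_on_bounded_partial) auto
  have "(hs_norm T)\<^sup>2 = (\<Sum>\<^sub>\<infinity>e\<in>some_onb. (norm (T e))\<^sup>2)"
    by (auto simp: hs_norm_def intro!: real_sqrt_pow2 infsum_nonneg)
  moreover have "(\<Sum>i\<in>F. (norm (T (x i)))\<^sup>2) \<le> (\<Sum>\<^sub>\<infinity>e\<in>some_onb. (norm (T e))\<^sup>2)"
    by (rule hs_bessel_of_onb[OF T some_onb _ assms(2)]) (intro finite_sum_le_infsum sm', auto)
  ultimately show ?thesis by simp
qed

lemma hilbert_schmidtI: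
  fixes T :: "'a::complex_hilbert_space \<Rightarrow>\<^sub>L 'a"
  assumes T: "clinear_op T" and K: "0 \<le> K"
    and b: "\<And>F x. bessel (F::'a set) x \<Longrightarrow> (\<Sum>i\<in>F. (norm (T (x i)))\<^sup>2) \<le> K\<^sup>2"
  shows "hilbert_schmidt T" "hs_norm T \<le> K"
proof -
  note * = summable_on_bounded_partial[of some_onb "\<lambda>e. (norm (T e))\<^sup>2" "K\<^sup>2"]
  show "hilbert_schmidt T"
    unfolding hilbert_schmidt_def
    using T some_onb *(1) b[OF bessel_onb[OF some_onb]] by auto
  have "(\<Sum>\<^sub>\<infinity>e\<in>some_onb. (norm (T e))\<^sup>2) \<le> K\<^sup>2"
    using *(2) b[OF bessel_onb[OF some_onb]] by auto
  then show "hs_norm T \<le> K" unfolding hs_norm_def using K by (rule real_le_lsqrt[rotated 1]) 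
qed


subsection \<open>Square roots of positive operators\<close>

lemma self_adjoint_clinear_op:
  fixes T :: "'a::complex_hilbert_space \<Rightarrow>\<^sub>L 'a"
  assumes "\<And>x y. cinner (T x) y = cinner x (T y)"
  shows "clinear_op T"
  unfolding clinear_op_def by (intro allI cinner_eqI) (simp add: assms cinner_scaleC_left)

lemma positive_op_iff:
  "positive_op T \<longleftrightarrow> (\<forall>x y. cinner (T x) y = cinner x (T y)) \<and> (\<forall>x. 0 \<le> inner (T x) x)"
  unfolding positive_op_def Re_cinner
  using cadjoint_eq_iff self_adjoint_clinear_op by metis

lemma positive_op_nonneg: "positive_op T \<Longrightarrow> 0 \<le> inner (T x) x"
  by (simp add: positive_op_iff)

lemma positive_op_clinear_op: "positive_op T \<Longrightarrow> clinear_op T"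
  by (simp add: positive_op_def)

lemma positive_op_sym: "positive_op T \<Longrightarrow> cinner (T x) y = cinner x (T y)"
  by (simp add: positive_op_iff)

lemma positive_op_symR: "positive_op T \<Longrightarrow> inner (T x) y = inner x (T y)"
  by (metis positive_op_sym Re_cinner)

lemma positive_contraction:
  fixes A :: "'a::complex_hilbert_space \<Rightarrow>\<^sub>L 'a"
  assumes A: "positive_op A" and n: "norm A \<le> 1"
  shows "(norm (z - A z))\<^sup>2 \<le> (norm z)\<^sup>2 - inner (A z) z"
proof -
  have nA: "norm (A x) \<le> norm x" for x
    using norm_blinfun[of A x] mult_right_mono[OF n, of "norm x"] by simp
  have "0 \<le> inner (A (z - A z)) (z - A z)" by (rule positive_op_nonneg[OF A])
  also have "\<dots> = inner (A z) z - 2 * inner (A z) (A z) + inner (A (A z)) (A z)"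
    using positive_op_symR[OF A, of "A z" z]
    by (simp add: blinfun.diff_right inner_diff inner_commute algebra_simps)
  also have "inner (A (A z)) (A z) \<le> norm (A z) * norm (A z)"
    using norm_cauchy_schwarz[of "A (A z)" "A z"] mult_right_mono[OF nA[of "A z"], of "norm (A z)"]
    by simp
  finally have "inner (A z) (A z) \<le> inner (A z) z"
    by (simp add: power2_norm_eq_inner flip: power2_eq_square)
  then show ?thesis
    unfolding power2_norm_eq_inner by (simp add: inner_diff inner_commute)
qed

lemma ex_sqrt_contraction:
  fixes A :: "'a::complex_hilbert_space \<Rightarrow>\<^sub>L 'a"
  assumes A: "positive_op A" and n: "norm A \<le> 1"
  shows "\<exists>R. positive_op R \<and> R o\<^sub>L R = A \<and> (\<forall>C. C o\<^sub>L A = A o\<^sub>L C \<longrightarrow> C o\<^sub>L R = R o\<^sub>L C)"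
proof -
  define B where "B = id_blinfun - A"
  have nB: "norm B \<le> 1"
  proof (rule norm_blinfun_bound)
    fix x
    have "0 \<le> inner (A x) x" using A unfolding positive_op_iff by blast
    then have "(norm (B x))\<^sup>2 \<le> (norm x)\<^sup>2"
      using positive_contraction[OF assms, of x] unfolding B_def blinfun.diff_left blinfun_apply_id_blinfun
      by linarith
    then show "norm (B x) \<le> 1 * norm x" by simp
  qed simp
  define Y where "Y = rec_nat (0 :: 'a \<Rightarrow>\<^sub>L 'a) (\<lambda>_ X. (1/2) *\<^sub>R (B + (X o\<^sub>L X)))"
  define y where "y = rec_nat (0::real) (\<lambda>_ t. (1/2) * (1 + t * t))"
  have Y0: "Y 0 = 0" and YS: "\<And>n. Y (Suc n) = (1/2) *\<^sub>R (B + (Y n o\<^sub>L Y n))" by (simp_all add: Y_def)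
  have y0: "y 0 = 0" and yS: "\<And>n. y (Suc n) = (1/2) * (1 + y n * y n)" by (simp_all add: y_def)
  have y01: "0 \<le> y n \<and> y n \<le> 1" for n
  proof (induction n)
    case (Suc n)
    then have "y n * y n \<le> 1 * 1" by (intro mult_mono) auto
    then show ?case by (simp add: yS)
  qed (simp add: y0)
  have nY: "norm (Y n) \<le> y n" for n
  proof (induction n)
    case (Suc n)
    have "norm (B + (Y n o\<^sub>L Y n)) \<le> norm B + norm (Y n) * norm (Y n)"
      by (rule order_trans[OF norm_triangle_ineq]) (intro add_left_mono norm_blinfun_compose)
    also have "\<dots> \<le> 1 + y n * y n" using Suc y01[of n] nB by (intro add_mono mult_mono) auto
    finally show ?case by (simp add: YS yS)
  qed (simp add: Y0 y0)
  have comm: "C o\<^sub>L Y n = Y n o\<^sub>L C" if C: "C o\<^sub>L B = B o\<^sub>L C" for C n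
  proof (induction n)
    case (Suc n)
    have 1: "C (Y n x) = Y n (C x)" for x using Suc by (metis blinfun_apply_blinfun_compose)
    have 2: "C (B x) = B (C x)" for x using C by (metis blinfun_apply_blinfun_compose)
    show ?case by (rule blinfun_eqI) (simp add: YS blinfun.bilinear_simps 1 2)
  qed (rule blinfun_eqI, simp add: Y0)
  have commY: "Y m (Y n x) = Y n (Y m x)" for m n x
    using comm[OF comm[OF refl, symmetric], of m n] by (metis blinfun_apply_blinfun_compose)
  have alg: "(1/2) *\<^sub>R (B + (P o\<^sub>L P)) - (1/2) *\<^sub>R (B + (Q o\<^sub>L Q)) = (1/2) *\<^sub>R ((P + Q) o\<^sub>L (P - Q))"
    if "\<And>x. P (Q x) = Q (P x)" for P Q :: "'a \<Rightarrow>\<^sub>L 'a"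
    by (rule blinfun_eqI) (simp add: blinfun.bilinear_simps that algebra_simps)
  have step: "norm (Y (Suc n) - Y n) \<le> y (Suc n) - y n" for n
  proof (induction n)
    case 0
    then show ?case using nB by (simp add: YS yS Y0 y0)
  next
    case (Suc n)
    have "Y (Suc (Suc n)) - Y (Suc n) = (1/2) *\<^sub>R ((Y (Suc n) + Y n) o\<^sub>L (Y (Suc n) - Y n))"
      unfolding YS[of "Suc n"] 
      by (subst (3) YS[of n]) (rule alg[OF commY])
    then have "norm (Y (Suc (Suc n)) - Y (Suc n)) \<le> (1/2) * (norm (Y (Suc n) + Y n) * norm (Y (Suc n) - Y n))"
      by (simp add: norm_blinfun_compose)
    also have "\<dots> \<le> (1/2) * ((y (Suc n) + y n) * (y (Suc n) - y n))"
      using Suc nY[of n] nY[of "Suc n"] y01[of n] y01[of "Suc n"]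
      by (intro mult_left_mono mult_mono order_trans[OF norm_triangle_ineq] add_mono) auto
    also have "\<dots> = y (Suc (Suc n)) - y (Suc n)"
      by (simp only: yS[of "Suc n"] yS[of n]) (simp add: algebra_simps)
    finally show ?case .
  qed
  have diff: "norm (Y (n + k) - Y n) \<le> y (n + k) - y n" for n k
  proof (induction k)
    case (Suc k)
    have "norm (Y (n + Suc k) - Y n) \<le> norm (Y (Suc (n + k)) - Y (n + k)) + norm (Y (n + k) - Y n)"
      using norm_triangle_ineq[of "Y (Suc (n + k)) - Y (n + k)" "Y (n + k) - Y n"] by simp
    also have "\<dots> \<le> y (n + Suc k) - y n" using step[of "n + k"] Suc by simp
    finally show ?case .
  qed simp
  have "y n \<le> y (Suc n)" for n
    using step[of n] norm_ge_zero[of "Y (Suc n) - Y n"] by linarith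
  then have "incseq y" by (rule incseq_SucI)
  then obtain l where "y \<longlonglongrightarrow> l" using incseq_convergent[of y 1] y01 by blast
  then have Cy: "Cauchy y" by (rule LIMSEQ_imp_Cauchy)
  have "Cauchy Y"
  proof (rule CauchyI')
    fix e :: real assume "0 < e"
    then obtain M where M: "\<And>m n. m \<ge> M \<Longrightarrow> n \<ge> M \<Longrightarrow> norm (y m - y n) < e" using CauchyD[OF Cy] by blast
    have "norm (Y m - Y n) < e" if "M \<le> m" "m < n" for m n
    proof -
      obtain k where k: "n = m + k" using less_imp_add_positive[OF \<open>m < n\<close>] by blast
      have "norm (Y m - Y n) \<le> y n - y m" using diff[of m k] k by (simp add: norm_minus_commute)
      also have "\<dots> < e" using M[of n m] that by auto
      finally show ?thesis .
    qed
    then show "\<exists>M. \<forall>m\<ge>M. \<forall>n>m. dist (Y m) (Y n) < e" unfolding dist_norm by blast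
  qed
  then obtain Z where Z: "Y \<longlonglongrightarrow> Z" using Cauchy_convergent[of Y] unfolding convergent_def by blast
  have ZB: "Z = (1/2) *\<^sub>R (B + (Z o\<^sub>L Z))"
  proof (rule LIMSEQ_unique)
    show "(\<lambda>n. Y (Suc n)) \<longlonglongrightarrow> Z" using Z by (rule LIMSEQ_Suc)
    show "(\<lambda>n. Y (Suc n)) \<longlonglongrightarrow> (1/2) *\<^sub>R (B + (Z o\<^sub>L Z))"
      unfolding YS
      by (intro tendsto_intros bounded_bilinear.tendsto[OF bounded_bilinear_blinfun_compose] Z)
  qed
  have nZ: "norm Z \<le> 1"
  proof (rule LIMSEQ_le_const2[OF tendsto_norm[OF Z]])
    show "\<exists>N. \<forall>n\<ge>N. norm (Y n) \<le> 1" using order_trans[OF nY] y01 by blast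
  qed
  have pt: "(\<lambda>n. Y n x) \<longlonglongrightarrow> Z x" for x
    using Z by (intro blinfun.tendsto tendsto_const)
  have BA: "cinner (B x) z = cinner x (B z)" for x z
    by (simp add: B_def blinfun.bilinear_simps cinner_diff_left cinner_diff_right positive_op_sym[OF A])
  have Ysa: "cinner (Y n x) z = cinner x (Y n z)" for n x z
    by (induction n arbitrary: x z)
      (simp_all add: Y0 YS blinfun.bilinear_simps cinner_add_left cinner_add_right BA
        cinner_scaleR_left cinner_scaleR_right)
  have Zsa: "cinner (Z x) z = cinner x (Z z)" for x z
  proof (rule LIMSEQ_unique)
    show "(\<lambda>n. cinner (Y n x) z) \<longlonglongrightarrow> cinner (Z x) z"
      by (rule bounded_linear.tendsto[OF bounded_linear_cinner_left pt])
    show "(\<lambda>n. cinner (Y n x) z) \<longlonglongrightarrow> cinner x (Z z)"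
      unfolding Ysa by (rule bounded_linear.tendsto[OF bounded_linear_cinner_right pt])
  qed
  define R where "R = id_blinfun - Z"
  have "positive_op R"
    unfolding positive_op_iff
  proof (intro conjI allI)
    show "cinner (R x) z = cinner x (R z)" for x z
      by (simp add: R_def blinfun.bilinear_simps cinner_diff_left cinner_diff_right Zsa)
    fix x
    have "inner (Z x) x \<le> norm (Z x) * norm x" by (rule norm_cauchy_schwarz)
    also have "\<dots> \<le> (1 * norm x) * norm x"
      using norm_blinfun[of Z x] mult_right_mono[OF nZ, of "norm x"] by (intro mult_right_mono) auto
    finally have "inner (Z x) x \<le> inner x x" by (simp add: power2_norm_eq_inner flip: power2_eq_square)
    then show "0 \<le> inner (R x) x" by (simp add: R_def blinfun.bilinear_simps inner_diff)
  qed
  moreover have "R o\<^sub>L R = A"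
  proof (rule blinfun_eqI)
    fix x
    have "Z x = ((1/2) *\<^sub>R (B + (Z o\<^sub>L Z))) x"
      using ZB by (rule arg_cong)
    also have "\<dots> = (1/2) *\<^sub>R (x - A x + Z (Z x))"
      by (simp add: B_def blinfun.bilinear_simps)
    finally have "2 *\<^sub>R Z x = 2 *\<^sub>R ((1/2) *\<^sub>R (x - A x + Z (Z x)))" by (rule arg_cong)
    then have "2 *\<^sub>R Z x = x - A x + Z (Z x)" unfolding scaleR_scaleR by simp
    then have "A x = x - 2 *\<^sub>R Z x + Z (Z x)" by simp
    then show "(R o\<^sub>L R) x = A x" by (simp add: R_def blinfun.bilinear_simps scaleR_2)
  qed
  moreover have "C o\<^sub>L R = R o\<^sub>L C" if C: "C o\<^sub>L A = A o\<^sub>L C" for C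
  proof (rule blinfun_eqI)
    fix x
    have "C o\<^sub>L B = B o\<^sub>L C"
      using C by (intro blinfun_eqI) (metis (no_types, lifting) B_def blinfun.diff_left blinfun.diff_right
          blinfun_apply_blinfun_compose blinfun_apply_id_blinfun)
    then have CY: "C (Y n x) = Y n (C x)" for n using comm by (metis blinfun_apply_blinfun_compose)
    have "C (Z x) = Z (C x)"
    proof (rule LIMSEQ_unique)
      show "(\<lambda>n. C (Y n x)) \<longlonglongrightarrow> C (Z x)" by (intro blinfun.tendsto tendsto_const pt)
      show "(\<lambda>n. C (Y n x)) \<longlonglongrightarrow> Z (C x)" unfolding CY by (rule pt)
    qed
    then show "(C o\<^sub>L R) x = (R o\<^sub>L C) x" by (simp add: R_def blinfun.bilinear_simps)
  qed
  ultimately show ?thesis by blast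
qed

lemma ex_sqrt:
  fixes A :: "'a::complex_hilbert_space \<Rightarrow>\<^sub>L 'a"
  assumes A: "positive_op A"
  shows "\<exists>R. positive_op R \<and> R o\<^sub>L R = A \<and> (\<forall>C. C o\<^sub>L A = A o\<^sub>L C \<longrightarrow> C o\<^sub>L R = R o\<^sub>L C)"
proof (cases "A = 0")
  case True
  have "positive_op (0 :: 'a \<Rightarrow>\<^sub>L 'a)" by (simp add: positive_op_iff)
  then show ?thesis using True by (intro exI[of _ 0]) (auto intro!: blinfun_eqI)
next
  case False
  define k where "k = norm A"
  have k: "k > 0" using False by (simp add: k_def)
  have p: "positive_op (r *\<^sub>R T)" if "positive_op T" "0 \<le> r" for r and T :: "'a \<Rightarrow>\<^sub>L 'a"
    unfolding positive_op_iff using positive_op_sym[OF that(1)] positive_op_nonneg[OF that(1)] that(2)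
    by (auto simp: blinfun.bilinear_simps cinner_scaleR_left cinner_scaleR_right)
  have "positive_op ((1/k) *\<^sub>R A)" "norm ((1/k) *\<^sub>R A) \<le> 1" using A k by (auto intro!: p) (simp add: k_def)
  from ex_sqrt_contraction[OF this] obtain R where R: "positive_op R" "R o\<^sub>L R = (1/k) *\<^sub>R A"
    "\<And>C. C o\<^sub>L ((1/k) *\<^sub>R A) = ((1/k) *\<^sub>R A) o\<^sub>L C \<Longrightarrow> C o\<^sub>L R = R o\<^sub>L C" by blast
  have "(sqrt k *\<^sub>R R) o\<^sub>L (sqrt k *\<^sub>R R) = k *\<^sub>R (R o\<^sub>L R)"
    using k by (intro blinfun_eqI) (simp add: blinfun.bilinear_simps)
  also have "\<dots> = A" using k by (simp add: R(2))
  finally have 1: "(sqrt k *\<^sub>R R) o\<^sub>L (sqrt k *\<^sub>R R) = A" .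
  have 2: "C o\<^sub>L (sqrt k *\<^sub>R R) = (sqrt k *\<^sub>R R) o\<^sub>L C" if C: "C o\<^sub>L A = A o\<^sub>L C" for C
  proof -
    have "C (A x) = A (C x)" for x using C by (metis blinfun_apply_blinfun_compose)
    then have "C o\<^sub>L ((1/k) *\<^sub>R A) = ((1/k) *\<^sub>R A) o\<^sub>L C"
      by (intro blinfun_eqI) (simp add: blinfun.bilinear_simps)
    from R(3)[OF this] have "C (R x) = R (C x)" for x by (metis blinfun_apply_blinfun_compose)
    then show ?thesis by (intro blinfun_eqI) (simp add: blinfun.bilinear_simps)
  qed
  have "positive_op (sqrt k *\<^sub>R R)" using p[OF R(1)] k by simp
  then show ?thesis using 1 2 by blast
qed

lemma positive_op_inner_zero:
  fixes R :: "'a::complex_hilbert_space \<Rightarrow>\<^sub>L 'a"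
  assumes R: "positive_op R" and z: "inner (R x) x = 0"
  shows "R x = 0"
proof -
  obtain S where S: "positive_op S" "S o\<^sub>L S = R" using ex_sqrt[OF R] by blast
  have RS: "R x = S (S x)" using S(2) by (metis blinfun_apply_blinfun_compose)
  then have "inner (S x) (S x) = 0" using z positive_op_symR[OF S(1), of "S x" x] by simp
  then show ?thesis by (simp add: RS blinfun.zero_right)
qed

lemma positive_sqrt_unique:
  fixes R S :: "'a::complex_hilbert_space \<Rightarrow>\<^sub>L 'a"
  assumes R: "positive_op R" and S: "positive_op S" and eq: "R o\<^sub>L R = S o\<^sub>L S"
  shows "R = S"
proof -
  have "positive_op (S o\<^sub>L S)"
    unfolding positive_op_iff blinfun_apply_blinfun_compose
    using positive_op_sym[OF S] positive_op_symR[OF S] by (metis inner_ge_zero)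
  then obtain Q where Q: "positive_op Q" "Q o\<^sub>L Q = S o\<^sub>L S"
    "\<And>C. C o\<^sub>L (S o\<^sub>L S) = (S o\<^sub>L S) o\<^sub>L C \<Longrightarrow> C o\<^sub>L Q = Q o\<^sub>L C" using ex_sqrt by blast
  have "T = Q" if T: "positive_op T" "T o\<^sub>L T = S o\<^sub>L S" for T
  proof (rule blinfun_eqI)
    fix x
    have "T o\<^sub>L Q = Q o\<^sub>L T"
      by (rule Q(3), unfold T(2)[symmetric]) (rule blinfun_eqI, simp)
    then have c: "T (Q z) = Q (T z)" for z by (metis blinfun_apply_blinfun_compose)
    have sq: "T (T z) = Q (Q z)" for z using T(2) Q(2) by (metis blinfun_apply_blinfun_compose)
    define v where "v = T x - Q x"
    have "T v + Q v = 0" by (simp add: v_def blinfun.bilinear_simps c sq)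
    then have "inner (T v) v + inner (Q v) v = 0" by (metis inner_add_left inner_zero_left)
    then have "inner (T v) v = 0" "inner (Q v) v = 0"
      using positive_op_nonneg[OF T(1), of v] positive_op_nonneg[OF Q(1), of v] by linarith+
    then have "T v = 0" "Q v = 0" using T(1) Q(1) positive_op_inner_zero by blast+
    then have "inner v v = 0"
      using positive_op_symR[OF T(1), of v x] positive_op_symR[OF Q(1), of v x]
      by (subst (2) v_def) (simp add: inner_diff_right)
    then show "T x = Q x" by (simp add: v_def)
  qed
  then show ?thesis using R S eq by metis
qed

lemma abs_op:
  fixes T :: "'a::complex_hilbert_space \<Rightarrow>\<^sub>L 'a"
  assumes T: "clinear_op T"
  shows "positive_op (abs_op T)" "abs_op T o\<^sub>L abs_op T = cadjoint T o\<^sub>L T"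
proof -
  have "positive_op (cadjoint T o\<^sub>L T)"
    unfolding positive_op_iff
    by (auto simp: cadjoint'[OF T] cadjoint[OF T, symmetric] cinner_self simp flip: Re_cinner)
  then obtain R where R: "positive_op R" "R o\<^sub>L R = cadjoint T o\<^sub>L T" using ex_sqrt by blast
  have "positive_op (abs_op T) \<and> abs_op T o\<^sub>L abs_op T = cadjoint T o\<^sub>L T"
    unfolding abs_op_def
    by (rule theI[of _ R]) (use R positive_sqrt_unique in metis)+
  then show "positive_op (abs_op T)" "abs_op T o\<^sub>L abs_op T = cadjoint T o\<^sub>L T" by auto
qed

lemma positive_resolvent:
  fixes R :: "'a::complex_hilbert_space \<Rightarrow>\<^sub>L 'a"
  assumes R: "positive_op R" and e: "0 < \<epsilon>"
  obtains g where "\<And>x. R (g x) + \<epsilon> *\<^sub>R g x = x" "\<And>x y. cinner (g x) y = cinner x (g y)"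
    "\<And>x. g (R x) = R (g x)" "\<And>x. norm (R (g x)) \<le> norm x"
proof -
  define k where "k = norm R + \<epsilon>"
  have k: "0 < k" "\<epsilon> \<le> k" using e by (simp_all add: k_def add_nonneg_pos)
  define A where "A = (1/k) *\<^sub>R (R + \<epsilon> *\<^sub>R id_blinfun)"
  have Ax: "A x = (1/k) *\<^sub>R (R x + \<epsilon> *\<^sub>R x)" for x by (simp add: A_def blinfun.bilinear_simps)
  have A: "positive_op A"
    unfolding positive_op_iff using positive_op_sym[OF R] positive_op_nonneg[OF R] k e
    by (auto simp: Ax cinner_scaleR_left cinner_scaleR_right cinner_add_left
        cinner_add_right inner_add)
  have nA: "norm A \<le> 1"
  proof (rule norm_blinfun_bound)
    fix x
    have "norm (R x + \<epsilon> *\<^sub>R x) \<le> norm R * norm x + \<epsilon> * norm x"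
      using e norm_blinfun[of R x] by (intro order_trans[OF norm_triangle_ineq] add_mono) auto
    also have "\<dots> = k * norm x" by (simp add: k_def algebra_simps)
    finally show "norm (A x) \<le> 1 * norm x" using k by (simp add: Ax divide_le_eq mult.commute)
  qed simp
  define c where "c = sqrt (1 - \<epsilon> / k)"
  have c: "0 \<le> c" "c < 1" using k e by (auto simp: c_def)
  have contr: "norm (z - A z) \<le> c * norm z" for z
  proof (rule power2_le_imp_le)
    have "\<epsilon> / k * (norm z)\<^sup>2 \<le> inner (A z) z"
      using positive_op_nonneg[OF R, of z] k
      by (simp add: Ax inner_add power2_norm_eq_inner divide_right_mono)
    then have "(norm (z - A z))\<^sup>2 \<le> (1 - \<epsilon> / k) * (norm z)\<^sup>2"
      using positive_contraction[OF A nA, of z] by (simp add: algebra_simps)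
    also have "1 - \<epsilon> / k = c\<^sup>2" using k by (simp add: c_def)
    finally show "(norm (z - A z))\<^sup>2 \<le> (c * norm z)\<^sup>2" by (simp add: power_mult_distrib)
  qed (use c in simp)
  have "\<exists>x. R x + \<epsilon> *\<^sub>R x = y" for y
  proof -
    have "\<exists>!x. x - A x + (1/k) *\<^sub>R y = x"
    proof (rule banach_fix_type[OF c], intro allI)
      fix u v
      have "u - A u + (1/k) *\<^sub>R y - (v - A v + (1/k) *\<^sub>R y) = (u - v) - A (u - v)"
        by (simp add: blinfun.bilinear_simps algebra_simps)
      then show "dist (u - A u + (1/k) *\<^sub>R y) (v - A v + (1/k) *\<^sub>R y) \<le> c * dist u v"
        using contr[of "u - v"] unfolding dist_norm by metis
    qed
    then obtain x where "x - A x + (1/k) *\<^sub>R y = x" by blast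
    then have "(1/k) *\<^sub>R y = (1/k) *\<^sub>R (R x + \<epsilon> *\<^sub>R x)" by (simp add: Ax algebra_simps)
    then have "R x + \<epsilon> *\<^sub>R x = y" using k by (metis divide_pos_pos less_irrefl scaleR_left_imp_eq zero_less_one)
    then show ?thesis by blast
  qed
  then obtain g where g: "\<And>y. R (g y) + \<epsilon> *\<^sub>R g y = y" by metis
  have sa: "cinner (g x) y = cinner x (g y)" for x y
  proof -
    have "cinner (g x) y = cinner (g x) (R (g y) + \<epsilon> *\<^sub>R g y)" by (simp only: g)
    also have "\<dots> = cinner (R (g x) + \<epsilon> *\<^sub>R g x) (g y)"
      by (simp add: cinner_add_left cinner_add_right cinner_scaleR_left cinner_scaleR_right positive_op_sym[OF R])
    also have "\<dots> = cinner x (g y)" by (simp only: g)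
    finally show ?thesis .
  qed
  have Rg: "R (g x) = x - \<epsilon> *\<^sub>R g x" for x using g[of x] by (simp add: eq_diff_eq)
  have "g (R x) = R (g x)" for x
  proof (rule cinner_eqI)
    fix z
    have "cinner (g (R x)) z = cinner x (R (g z))" by (simp add: sa positive_op_sym[OF R])
    also have "\<dots> = cinner (R (g x)) z"
      by (simp add: Rg cinner_diff_left cinner_diff_right cinner_scaleR_left cinner_scaleR_right sa)
    finally show "cinner (g (R x)) z = cinner (R (g x)) z" .
  qed
  moreover have "norm (R (g x)) \<le> norm x" for x
  proof -
    have "(norm x)\<^sup>2 = (norm (R (g x) + \<epsilon> *\<^sub>R g x))\<^sup>2" by (simp only: g)
    also have "\<dots> = (norm (R (g x)))\<^sup>2 + 2 * \<epsilon> * inner (R (g x)) (g x) + (\<epsilon> * norm (g x))\<^sup>2"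
      unfolding power_mult_distrib power2_norm_eq_inner
      by (simp add: inner_add inner_commute power2_eq_square algebra_simps)
    also have "\<dots> \<ge> (norm (R (g x)))\<^sup>2" using positive_op_nonneg[OF R, of "g x"] e by simp
    finally show ?thesis by simp
  qed
  ultimately show ?thesis using that g sa by blast
qed

subsection \<open>Trace class operators\<close>

lemma cinner_abs_op:
  fixes T :: "'a::complex_hilbert_space \<Rightarrow>\<^sub>L 'a"
  assumes T: "clinear_op T"
  shows "cinner (T x) (T y) = cinner (abs_op T x) (abs_op T y)"
proof -
  have "cinner (T x) (T y) = cinner x ((cadjoint T o\<^sub>L T) y)" by (simp add: cadjoint[OF T])
  also have "\<dots> = cinner (abs_op T x) (abs_op T y)"
    unfolding abs_op(2)[OF T, symmetric] by (simp add: positive_op_sym[OF abs_op(1)[OF T]])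
  finally show ?thesis .
qed

lemma norm_abs_op:
  fixes T :: "'a::complex_hilbert_space \<Rightarrow>\<^sub>L 'a"
  assumes "clinear_op T" shows "norm (T x) = norm (abs_op T x)"
  using arg_cong[OF cinner_abs_op[OF assms, of x x], of Re]
  by (simp add: Re_cinner norm_eq_sqrt_inner)

lemma trace_bessel_of_onb:
  fixes T :: "'a::complex_hilbert_space \<Rightarrow>\<^sub>L 'a"
  assumes T: "clinear_op T" and E: "is_onb E"
    and K: "\<And>G. finite G \<Longrightarrow> G \<subseteq> E \<Longrightarrow> (\<Sum>e\<in>G. Re (cinner (abs_op T e) e)) \<le> K"
    and x: "bessel F x" and y: "bessel F y"
  shows "(\<Sum>i\<in>F. cmod (cinner (T (x i)) (y i))) \<le> K"
proof (rule field_le_epsilon)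
  fix \<epsilon> :: real assume \<epsilon>: "0 < \<epsilon>"
  have F: "finite F" using x by (simp add: bessel_def)
  define \<delta> where "\<delta> = \<epsilon> / (real (card F) + 1)"
  have \<delta>: "0 < \<delta>" "real (card F) * \<delta> \<le> \<epsilon>" using \<epsilon> by (auto simp: \<delta>_def field_simps)
  let ?R = "abs_op T"
  have R: "positive_op ?R" by (rule abs_op[OF T])
  obtain S where S: "positive_op S" "S o\<^sub>L S = ?R" using ex_sqrt[OF R] by blast
  have RS: "?R z = S (S z)" for z using S(2) by (metis blinfun_apply_blinfun_compose)
  have SS: "cinner (?R u) v = cinner (S u) (S v)" for u v by (simp add: RS positive_op_sym[OF S(1)])
  have Sb: "(\<Sum>i\<in>F. (norm (S (z i)))\<^sup>2) \<le> K" if "bessel F z" for z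
  proof (rule hs_bessel_of_onb[OF positive_op_clinear_op[OF S(1)] E _ that])
    show "(\<Sum>e\<in>G. (norm (S e))\<^sup>2) \<le> K" if "finite G" "G \<subseteq> E" for G
      using K[OF that] by (simp add: SS cinner_self)
  qed
  obtain g where g: "\<And>x. ?R (g x) + \<delta> *\<^sub>R g x = x" "\<And>x y. cinner (g x) y = cinner x (g y)"
    "\<And>x. g (?R x) = ?R (g x)" "\<And>x. norm (?R (g x)) \<le> norm x"
    using positive_resolvent[OF R \<delta>(1)] by blast
  define w where "w i = g (cadjoint T (y i))" for i
  have Tg: "norm (T (g v)) \<le> norm v" for v using g(4) norm_abs_op[OF T] by simp
  have w: "bessel F w"
    unfolding bessel_def
  proof (intro conjI allI F)
    fix v
    have "(\<Sum>i\<in>F. (cmod (cinner v (w i)))\<^sup>2) = (\<Sum>i\<in>F. (cmod (cinner (T (g v)) (y i)))\<^sup>2)"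
      by (simp add: w_def cadjoint[OF T] g(2))
    also have "\<dots> \<le> (norm (T (g v)))\<^sup>2" using y by (simp add: bessel_def)
    also have "\<dots> \<le> (norm v)\<^sup>2" using Tg by (intro power_mono) auto
    finally show "(\<Sum>i\<in>F. (cmod (cinner v (w i)))\<^sup>2) \<le> (norm v)\<^sup>2" .
  qed
  have "cmod (cinner (T (x i)) (y i)) \<le> (norm (S (x i)))\<^sup>2 / 2 + (norm (S (w i)))\<^sup>2 / 2 + \<delta>" if i: "i \<in> F" for i
  proof -
    have "T (x i) = T (?R (g (x i)) + \<delta> *\<^sub>R g (x i))" by (simp only: g(1))
    also have "\<dots> = T (g (?R (x i))) + \<delta> *\<^sub>R T (g (x i))" by (simp add: blinfun.bilinear_simps g(3))
    finally have "cinner (T (x i)) (y i) = cinner (T (g (?R (x i)))) (y i) + complex_of_real \<delta> * cinner (T (g (x i))) (y i)"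
      by (simp add: cinner_add_left cinner_scaleR_left)
    also have "cinner (T (g (?R (x i)))) (y i) = cinner (S (x i)) (S (w i))"
      by (simp add: cadjoint[OF T] g(2) w_def SS)
    finally have "cmod (cinner (T (x i)) (y i)) \<le> cmod (cinner (S (x i)) (S (w i))) + \<delta> * cmod (cinner (T (g (x i))) (y i))"
      using \<delta>(1) by (metis norm_triangle_ineq norm_mult norm_of_real abs_of_pos)
    moreover have "cmod (cinner (S (x i)) (S (w i))) \<le> norm (S (x i)) * norm (S (w i))" by (rule cmod_cinner_le)
    moreover have "norm (S (x i)) * norm (S (w i)) \<le> (norm (S (x i)))\<^sup>2 / 2 + (norm (S (w i)))\<^sup>2 / 2"
      using sum_squares_bound[of "norm (S (x i))" "norm (S (w i))"] by simp
    moreover have "cmod (cinner (T (g (x i))) (y i)) \<le> 1"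
    proof -
      have "cmod (cinner (T (g (x i))) (y i)) \<le> norm (T (g (x i))) * norm (y i)" by (rule cmod_cinner_le)
      also have "\<dots> \<le> 1 * 1"
        using Tg[of "x i"] bessel_norm_le[OF x i] bessel_norm_le[OF y i] by (intro mult_mono) auto
      finally show ?thesis by simp
    qed
    then have "\<delta> * cmod (cinner (T (g (x i))) (y i)) \<le> \<delta> * 1" using \<delta>(1) by (intro mult_left_mono) auto
    ultimately show ?thesis by linarith
  qed
  then have "(\<Sum>i\<in>F. cmod (cinner (T (x i)) (y i)))
    \<le> (\<Sum>i\<in>F. (norm (S (x i)))\<^sup>2 / 2 + (norm (S (w i)))\<^sup>2 / 2 + \<delta>)" by (rule sum_mono)
  also have "\<dots> = (\<Sum>i\<in>F. (norm (S (x i)))\<^sup>2) / 2 + (\<Sum>i\<in>F. (norm (S (w i)))\<^sup>2) / 2 + real (card F) * \<delta>"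
    by (simp add: sum.distrib sum_divide_distrib)
  also have "\<dots> \<le> K / 2 + K / 2 + \<epsilon>"
    using Sb[OF x] Sb[OF w] \<delta>(2) by (intro add_mono) auto
  finally show "(\<Sum>i\<in>F. cmod (cinner (T (x i)) (y i))) \<le> K + \<epsilon>" by simp
qed

lemma trace_onb_of_bessel:
  fixes T :: "'a::complex_hilbert_space \<Rightarrow>\<^sub>L 'a"
  assumes T: "clinear_op T" and E: "is_onb E"
    and K: "\<And>F x y. bessel (F::'a set) x \<Longrightarrow> bessel F y \<Longrightarrow> (\<Sum>i\<in>F. cmod (cinner (T (x i)) (y i))) \<le> K"
    and G: "finite G" "G \<subseteq> E"
  shows "(\<Sum>e\<in>G. Re (cinner (abs_op T e) e)) \<le> K"
proof (rule field_le_epsilon)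
  fix \<epsilon> :: real assume \<epsilon>: "0 < \<epsilon>"
  define \<delta> where "\<delta> = \<epsilon> / (real (card G) + 1)"
  have \<delta>: "0 < \<delta>" "real (card G) * \<delta> \<le> \<epsilon>" using \<epsilon> by (auto simp: \<delta>_def field_simps)
  let ?R = "abs_op T"
  have R: "positive_op ?R" by (rule abs_op[OF T])
  obtain g where g: "\<And>x. ?R (g x) + \<delta> *\<^sub>R g x = x" "\<And>x y. cinner (g x) y = cinner x (g y)"
    "\<And>x. g (?R x) = ?R (g x)" "\<And>x. norm (?R (g x)) \<le> norm x"
    using positive_resolvent[OF R \<delta>(1)] by blast
  have Tg: "norm (T (g v)) \<le> norm v" for v using g(4) norm_abs_op[OF T] by simp
  have b: "bessel G (\<lambda>e. e)" by (rule bessel_onb[OF E G])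
  have b': "bessel G (\<lambda>e. T (g e))"
    unfolding bessel_def
  proof (intro conjI allI G(1))
    fix v
    define w where "w = g (cadjoint T v)"
    have c: "cinner v (T (g u)) = cinner w u" for u
      by (simp add: w_def g(2) cadjoint'[OF T])
    have "(norm w)\<^sup>2 = cmod (cinner w w)" by (simp add: cinner_self norm_power)
    also have "\<dots> \<le> norm v * norm w"
      unfolding c[symmetric]
      by (rule order_trans[OF cmod_cinner_le]) (intro mult_left_mono Tg, simp)
    finally have wv: "norm w \<le> norm v" by (cases "w = 0") (auto simp: power2_eq_square)
    have "(\<Sum>e\<in>G. (cmod (cinner v (T (g e))))\<^sup>2) \<le> (norm w)\<^sup>2"
      using b unfolding c bessel_def by blast
    also have "\<dots> \<le> (norm v)\<^sup>2" using wv by (intro power_mono) auto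
    finally show "(\<Sum>e\<in>G. (cmod (cinner v (T (g e))))\<^sup>2) \<le> (norm v)\<^sup>2" .
  qed
  have "Re (cinner (?R e) e) \<le> cmod (cinner (T e) (T (g e))) + \<delta>" if "e \<in> G" for e
  proof -
    have e1: "norm e = 1" using is_onb_subset(1)[OF E G(2) that] .
    have "cinner (?R e) e = cinner (?R e) (?R (g e) + \<delta> *\<^sub>R g e)" by (simp only: g(1))
    also have "\<dots> = cinner (T e) (T (g e)) + complex_of_real \<delta> * cinner e (?R (g e))"
      by (simp add: cinner_add_right cinner_scaleR_right cinner_abs_op[OF T] positive_op_sym[OF R])
    finally have "Re (cinner (?R e) e) \<le> cmod (cinner (T e) (T (g e))) + \<delta> * cmod (cinner e (?R (g e)))"
      using \<delta>(1) by (metis abs_of_pos complex_Re_le_cmod norm_mult norm_of_real norm_triangle_ineq order_trans)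
    moreover have "cmod (cinner e (?R (g e))) \<le> 1"
      using cmod_cinner_le[of e "?R (g e)"] g(4)[of e] e1 by simp
    then have "\<delta> * cmod (cinner e (?R (g e))) \<le> \<delta> * 1" using \<delta>(1) by (intro mult_left_mono) auto
    ultimately show ?thesis by simp
  qed
  then have "(\<Sum>e\<in>G. Re (cinner (?R e) e)) \<le> (\<Sum>e\<in>G. cmod (cinner (T e) (T (g e))) + \<delta>)" by (rule sum_mono)
  also have "\<dots> = (\<Sum>e\<in>G. cmod (cinner (T e) (T (g e)))) + real (card G) * \<delta>" by (simp add: sum.distrib)
  also have "\<dots> \<le> K + \<epsilon>" using K[OF b b'] \<delta>(2) by (intro add_mono) auto
  finally show "(\<Sum>e\<in>G. Re (cinner (?R e) e)) \<le> K + \<epsilon>" .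
qed

lemma abs_op_nonneg: "clinear_op T \<Longrightarrow> 0 \<le> Re (cinner (abs_op T e) e)"
  using abs_op(1) by (auto simp: positive_op_def)

lemma trace_bessel:
  assumes "trace_class T" "bessel F x" "bessel F y"
  shows "(\<Sum>i\<in>F. cmod (cinner (T (x i)) (y i))) \<le> trace_norm T"
proof -
  from assms(1) obtain E where T: "clinear_op T" and E: "is_onb E"
    and sm: "(\<lambda>e. Re (cinner (abs_op T e) e)) summable_on E" by (auto simp: trace_class_def)
  note nn = abs_op_nonneg[OF T]
  have "(\<Sum>e\<in>G. Re (cinner (abs_op T e) e)) \<le> (\<Sum>\<^sub>\<infinity>e\<in>E. Re (cinner (abs_op T e) e))"
    if "finite G" "G \<subseteq> E" for G
    using that by (intro finite_sum_le_infsum sm nn)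
  note b = trace_onb_of_bessel[OF T some_onb trace_bessel_of_onb[OF T E this]]
  have "(\<lambda>e. Re (cinner (abs_op T e) e)) summable_on some_onb"
    by (rule summable_on_bounded_partial[OF nn b])
  then have "(\<Sum>e\<in>G. Re (cinner (abs_op T e) e)) \<le> trace_norm T"
    if "finite G" "G \<subseteq> some_onb" for G
    unfolding trace_norm_def using that by (intro finite_sum_le_infsum nn)
  from trace_bessel_of_onb[OF T some_onb this assms(2,3)] show ?thesis .
qed

lemma trace_norm_nonneg: "clinear_op T \<Longrightarrow> 0 \<le> trace_norm T"
  unfolding trace_norm_def by (intro infsum_nonneg abs_op_nonneg)

lemma trace_classI:
  fixes T :: "'a::complex_hilbert_space \<Rightarrow>\<^sub>L 'a"
  assumes T: "clinear_op T"
    and K: "\<And>F x y. bessel (F::'a set) x \<Longrightarrow> bessel F y \<Longrightarrow> (\<Sum>i\<in>F. cmod (cinner (T (x i)) (y i))) \<le> K"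
  shows "trace_class T" "trace_norm T \<le> K"
proof -
  note * = summable_on_bounded_partial[OF abs_op_nonneg[OF T] trace_onb_of_bessel[OF T some_onb K]]
  show "trace_class T" unfolding trace_class_def using T some_onb *(1) by blast
  show "trace_norm T \<le> K" unfolding trace_norm_def by (rule *(2))
qed


subsection \<open>Vector space operations and limits\<close>

lemma clinear_op_add: "clinear_op S \<Longrightarrow> clinear_op T \<Longrightarrow> clinear_op (S + T)"
  by (simp add: clinear_op_def blinfun.add_left scaleC_add_right)

lemma scaleC_scaleR_commute: "c *\<^sub>C (r *\<^sub>R x) = r *\<^sub>R (c *\<^sub>C x)" for x :: "'a::complex_hilbert_space"
  unfolding scaleC_of_real[symmetric] scaleC_scaleC by (simp add: mult.commute)

lemma clinear_op_scaleR: "clinear_op T \<Longrightarrow> clinear_op (r *\<^sub>R T)"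
  by (simp add: clinear_op_def blinfun.scaleR_left scaleC_scaleR_commute)

lemma clinear_op_compose: "clinear_op S \<Longrightarrow> clinear_op T \<Longrightarrow> clinear_op (S o\<^sub>L T)"
  by (simp add: clinear_op_def)

lemma clinear_op_limit:
  fixes X :: "nat \<Rightarrow> 'a::complex_hilbert_space \<Rightarrow>\<^sub>L 'a" and T :: "'a \<Rightarrow>\<^sub>L 'a"
  assumes X: "\<And>n. clinear_op (X n)" and lim: "\<And>x. (\<lambda>n. X n x) \<longlonglongrightarrow> T x"
  shows "clinear_op T"
  unfolding clinear_op_def
proof (intro allI cinner_eqI)
  fix c x z
  have "(\<lambda>n. cinner (X n (c *\<^sub>C x)) z) \<longlonglongrightarrow> cinner (T (c *\<^sub>C x)) z"
    by (rule bounded_linear.tendsto[OF bounded_linear_cinner_left lim])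
  moreover have "(\<lambda>n. c * cinner (X n x) z) \<longlonglongrightarrow> c * cinner (T x) z"
    by (intro tendsto_mult tendsto_const bounded_linear.tendsto[OF bounded_linear_cinner_left lim])
  then have "(\<lambda>n. cinner (X n (c *\<^sub>C x)) z) \<longlonglongrightarrow> cinner (c *\<^sub>C T x) z"
    using X by (simp add: clinear_op_def cinner_scaleC_left)
  ultimately show "cinner (T (c *\<^sub>C x)) z = cinner (c *\<^sub>C T x) z" by (rule LIMSEQ_unique)
qed

lemma hilbert_schmidt_clinear_op: "hilbert_schmidt T \<Longrightarrow> clinear_op T"
  by (simp add: hilbert_schmidt_def)

lemma trace_class_clinear_op: "trace_class T \<Longrightarrow> clinear_op T"
  by (simp add: trace_class_def)

lemma hilbert_schmidt_add:
  assumes S: "hilbert_schmidt S" and T: "hilbert_schmidt T"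
  shows "hilbert_schmidt (S + T)" "hs_norm (S + T) \<le> hs_norm S + hs_norm T"
proof -
  have b: "(\<Sum>i\<in>F. (norm ((S + T) (x i)))\<^sup>2) \<le> (hs_norm S + hs_norm T)\<^sup>2" if "bessel F x" for F :: "'a set" and x
  proof -
    have "(\<Sum>i\<in>F. (norm ((S + T) (x i)))\<^sup>2) \<le> (\<Sum>i\<in>F. (norm (S (x i)) + norm (T (x i)))\<^sup>2)"
      by (intro sum_mono power_mono) (auto simp: blinfun.add_left norm_triangle_ineq)
    also have "\<dots> = (L2_set (\<lambda>i. norm (S (x i)) + norm (T (x i))) F)\<^sup>2"
      by (simp add: L2_set_def sum_nonneg)
    also have "\<dots> \<le> (L2_set (\<lambda>i. norm (S (x i))) F + L2_set (\<lambda>i. norm (T (x i))) F)\<^sup>2"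
      by (intro power_mono L2_set_triangle_ineq L2_set_nonneg)
    also have "\<dots> \<le> (hs_norm S + hs_norm T)\<^sup>2"
      using hs_bessel[OF S that] hs_bessel[OF T that]
      by (intro power_mono add_mono add_nonneg_nonneg L2_set_nonneg)
        (auto simp: L2_set_def intro!: real_le_lsqrt sum_nonneg hs_norm_nonneg)
    finally show ?thesis .
  qed
  note * = hilbert_schmidtI[OF clinear_op_add[OF hilbert_schmidt_clinear_op[OF S] hilbert_schmidt_clinear_op[OF T]]
    add_nonneg_nonneg[OF hs_norm_nonneg hs_norm_nonneg] b]
  show "hilbert_schmidt (S + T)" "hs_norm (S + T) \<le> hs_norm S + hs_norm T" by (rule *; assumption)+
qed

lemma hilbert_schmidt_scaleR:
  assumes T: "hilbert_schmidt T"
  shows "hilbert_schmidt (r *\<^sub>R T)" "hs_norm (r *\<^sub>R T) = \<bar>r\<bar> * hs_norm T"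
proof -
  have *: "hilbert_schmidt (r *\<^sub>R T) \<and> hs_norm (r *\<^sub>R T) \<le> \<bar>r\<bar> * hs_norm T"
    if T: "hilbert_schmidt T" for r and T :: "'a \<Rightarrow>\<^sub>L 'a"
  proof -
    have b: "(\<Sum>i\<in>F. (norm ((r *\<^sub>R T) (x i)))\<^sup>2) \<le> (\<bar>r\<bar> * hs_norm T)\<^sup>2" if "bessel F x" for F :: "'a set" and x
      using mult_left_mono[OF hs_bessel[OF T that], of "r\<^sup>2"]
      by (simp add: blinfun.scaleR_left power_mult_distrib sum_distrib_left)
    note * = hilbert_schmidtI[OF clinear_op_scaleR[OF hilbert_schmidt_clinear_op[OF T]]
      mult_nonneg_nonneg[OF abs_ge_zero hs_norm_nonneg] b]
    show ?thesis by (intro conjI; rule *; assumption)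
  qed
  show 1: "hilbert_schmidt (r *\<^sub>R T)" using *[OF T] by blast
  show "hs_norm (r *\<^sub>R T) = \<bar>r\<bar> * hs_norm T"
  proof (cases "r = 0")
    case True
    then show ?thesis using *[OF T, of r] hs_norm_nonneg[of "r *\<^sub>R T"] by simp
  next
    case False
    have "hs_norm T \<le> \<bar>1/r\<bar> * hs_norm (r *\<^sub>R T)" using *[OF 1, of "1/r"] False by simp
    then have "\<bar>r\<bar> * hs_norm T \<le> \<bar>r\<bar> * (\<bar>1/r\<bar> * hs_norm (r *\<^sub>R T))" by (intro mult_left_mono) auto
    also have "\<dots> = hs_norm (r *\<^sub>R T)" using False by (simp flip: mult.assoc abs_mult)
    finally show ?thesis using *[OF T, of r] by simp
  qed
qed

lemma trace_class_add:
  assumes S: "trace_class S" and T: "trace_class T"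
  shows "trace_class (S + T)" "trace_norm (S + T) \<le> trace_norm S + trace_norm T"
proof -
  have b: "(\<Sum>i\<in>F. cmod (cinner ((S + T) (x i)) (y i))) \<le> trace_norm S + trace_norm T"
    if "bessel F x" "bessel F y" for F :: "'a set" and x y
  proof -
    have "(\<Sum>i\<in>F. cmod (cinner ((S + T) (x i)) (y i)))
      \<le> (\<Sum>i\<in>F. cmod (cinner (S (x i)) (y i)) + cmod (cinner (T (x i)) (y i)))"
      by (intro sum_mono) (auto simp: blinfun.add_left cinner_add_left norm_triangle_ineq)
    also have "\<dots> \<le> trace_norm S + trace_norm T"
      unfolding sum.distrib by (rule add_mono[OF trace_bessel[OF S that] trace_bessel[OF T that]])
    finally show ?thesis .
  qed
  note * = trace_classI[OF clinear_op_add[OF trace_class_clinear_op[OF S] trace_class_clinear_op[OF T]] b]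
  show "trace_class (S + T)" "trace_norm (S + T) \<le> trace_norm S + trace_norm T" by (rule *; assumption)+
qed

lemma trace_class_scaleR:
  assumes T: "trace_class T"
  shows "trace_class (r *\<^sub>R T)" "trace_norm (r *\<^sub>R T) = \<bar>r\<bar> * trace_norm T"
proof -
  have *: "trace_class (r *\<^sub>R T) \<and> trace_norm (r *\<^sub>R T) \<le> \<bar>r\<bar> * trace_norm T"
    if T: "trace_class T" for r and T :: "'a \<Rightarrow>\<^sub>L 'a"
  proof -
    have b: "(\<Sum>i\<in>F. cmod (cinner ((r *\<^sub>R T) (x i)) (y i))) \<le> \<bar>r\<bar> * trace_norm T"
      if "bessel F x" "bessel F y" for F :: "'a set" and x y
      using mult_left_mono[OF trace_bessel[OF T that], of "\<bar>r\<bar>"]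
      by (simp add: blinfun.scaleR_left cinner_scaleR_left norm_mult sum_distrib_left)
    note * = trace_classI[OF clinear_op_scaleR[OF trace_class_clinear_op[OF T]] b]
    show ?thesis by (intro conjI; rule *; assumption)
  qed
  show 1: "trace_class (r *\<^sub>R T)" using *[OF T] by blast
  show "trace_norm (r *\<^sub>R T) = \<bar>r\<bar> * trace_norm T"
  proof (cases "r = 0")
    case True
    then show ?thesis using *[OF T, of r] trace_norm_nonneg[OF trace_class_clinear_op[OF 1]] by simp
  next
    case False
    have "trace_norm T \<le> \<bar>1/r\<bar> * trace_norm (r *\<^sub>R T)" using *[OF 1, of "1/r"] False by simp
    then have "\<bar>r\<bar> * trace_norm T \<le> \<bar>r\<bar> * (\<bar>1/r\<bar> * trace_norm (r *\<^sub>R T))" by (intro mult_left_mono) auto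
    also have "\<dots> = trace_norm (r *\<^sub>R T)" using False by (simp flip: mult.assoc abs_mult)
    finally show ?thesis using *[OF T, of r] by simp
  qed
qed

lemma clinear_op_zero: "clinear_op 0"
  by (simp add: clinear_op_def)

lemma hilbert_schmidt_zero: "hilbert_schmidt (0 :: 'a::complex_hilbert_space \<Rightarrow>\<^sub>L 'a)" "hs_norm (0 :: 'a::complex_hilbert_space \<Rightarrow>\<^sub>L 'a) = 0"
proof -
  show "hilbert_schmidt (0 :: 'a \<Rightarrow>\<^sub>L 'a)" by (rule hilbert_schmidtI(1)[where K=0]) (auto simp: clinear_op_zero)
  show "hs_norm (0 :: 'a \<Rightarrow>\<^sub>L 'a) = 0" by (simp add: hs_norm_def)
qed

lemma trace_class_zero: "trace_class (0 :: 'a::complex_hilbert_space \<Rightarrow>\<^sub>L 'a)" "trace_norm (0 :: 'a::complex_hilbert_space \<Rightarrow>\<^sub>L 'a) = 0"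
proof -
  show 1: "trace_class (0 :: 'a \<Rightarrow>\<^sub>L 'a)" by (rule trace_classI(1)[where K=0]) (auto simp: clinear_op_zero)
  show "trace_norm (0 :: 'a \<Rightarrow>\<^sub>L 'a) = 0" using trace_class_scaleR(2)[OF 1, of 0] by simp
qed

lemma norm_le_hs_norm:
  assumes T: "hilbert_schmidt T" shows "norm T \<le> hs_norm T"
proof (rule norm_blinfun_bound)
  fix x :: 'a
  define u where "u = (1 / norm x) *\<^sub>R x"
  have "norm u \<le> 1" by (simp add: u_def)
  from hs_bessel[OF T bessel_single[OF this]] have "(norm (T u))\<^sup>2 \<le> (hs_norm T)\<^sup>2" by simp
  then have "norm (T u) \<le> hs_norm T" by (rule power2_le_imp_le) (rule hs_norm_nonneg)
  then show "norm (T x) \<le> hs_norm T * norm x"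
    by (cases "x = 0") (auto simp: u_def blinfun.bilinear_simps divide_le_eq)
qed (rule hs_norm_nonneg)

lemma norm_le_trace_norm:
  assumes T: "trace_class T" shows "norm T \<le> trace_norm T"
proof (rule norm_blinfun_bound)
  fix x :: 'a
  define u where "u = (1 / norm x) *\<^sub>R x"
  define v where "v = (1 / norm (T u)) *\<^sub>R T u"
  have "norm u \<le> 1" "norm v \<le> 1" by (simp_all add: u_def v_def)
  from trace_bessel[OF T bessel_single[OF this(1)] bessel_single[OF this(2)]]
  have "cmod (cinner (T u) v) \<le> trace_norm T" by simp
  moreover have "cmod (cinner (T u) v) = norm (T u)"
    by (cases "T u = 0") (auto simp: v_def cinner_scaleR_right cinner_self norm_mult norm_power norm_divide power2_eq_square)
  ultimately have "norm (T u) \<le> trace_norm T" by simp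
  then show "norm (T x) \<le> trace_norm T * norm x"
    by (cases "x = 0") (auto simp: u_def blinfun.bilinear_simps divide_le_eq)
qed (rule trace_norm_nonneg[OF trace_class_clinear_op[OF T]])

lemma hilbert_schmidt_limit:
  fixes X :: "nat \<Rightarrow> 'a::complex_hilbert_space \<Rightarrow>\<^sub>L 'a" and T :: "'a \<Rightarrow>\<^sub>L 'a"
  assumes X: "\<And>n. N \<le> n \<Longrightarrow> hilbert_schmidt (X n) \<and> hs_norm (X n) \<le> K"
    and T: "clinear_op T" and lim: "\<And>x. (\<lambda>n. X n x) \<longlonglongrightarrow> T x"
  shows "hilbert_schmidt T" "hs_norm T \<le> K"
proof -
  have K: "0 \<le> K" using X[of N] hs_norm_nonneg[of "X N"] by linarith
  have b: "(\<Sum>i\<in>F. (norm (T (x i)))\<^sup>2) \<le> K\<^sup>2" if F: "bessel F x" for F :: "'a set" and x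
  proof (rule LIMSEQ_le_const2)
    show "(\<lambda>n. \<Sum>i\<in>F. (norm (X n (x i)))\<^sup>2) \<longlonglongrightarrow> (\<Sum>i\<in>F. (norm (T (x i)))\<^sup>2)"
      by (intro tendsto_intros lim)
    have "(\<Sum>i\<in>F. (norm (X n (x i)))\<^sup>2) \<le> K\<^sup>2" if "N \<le> n" for n
      using hs_bessel[OF conjunct1[OF X[OF that]] F]
        power_mono[OF conjunct2[OF X[OF that]] hs_norm_nonneg, of 2] by linarith
    then show "\<exists>N. \<forall>n\<ge>N. (\<Sum>i\<in>F. (norm (X n (x i)))\<^sup>2) \<le> K\<^sup>2" by blast
  qed
  show "hilbert_schmidt T" "hs_norm T \<le> K" by (rule hilbert_schmidtI[OF T K b]; assumption)+
qed

lemma trace_class_limit: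
  fixes X :: "nat \<Rightarrow> 'a::complex_hilbert_space \<Rightarrow>\<^sub>L 'a" and T :: "'a \<Rightarrow>\<^sub>L 'a"
  assumes X: "\<And>n. N \<le> n \<Longrightarrow> trace_class (X n) \<and> trace_norm (X n) \<le> K"
    and T: "clinear_op T" and lim: "\<And>x. (\<lambda>n. X n x) \<longlonglongrightarrow> T x"
  shows "trace_class T" "trace_norm T \<le> K"
proof -
  have b: "(\<Sum>i\<in>F. cmod (cinner (T (x i)) (y i))) \<le> K"
    if F: "bessel F x" "bessel F y" for F :: "'a set" and x y
  proof (rule LIMSEQ_le_const2)
    show "(\<lambda>n. \<Sum>i\<in>F. cmod (cinner (X n (x i)) (y i))) \<longlonglongrightarrow> (\<Sum>i\<in>F. cmod (cinner (T (x i)) (y i)))"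
      by (intro tendsto_intros bounded_linear.tendsto[OF bounded_linear_cinner_left lim])
    have "(\<Sum>i\<in>F. cmod (cinner (X n (x i)) (y i))) \<le> K" if "N \<le> n" for n
      using trace_bessel[OF conjunct1[OF X[OF that]] F] conjunct2[OF X[OF that]] by linarith
    then show "\<exists>N. \<forall>n\<ge>N. (\<Sum>i\<in>F. cmod (cinner (X n (x i)) (y i))) \<le> K" by blast
  qed
  show "trace_class T" "trace_norm T \<le> K" by (rule trace_classI[OF T b]; assumption)+
qed

section \<open>The restricted unitary Lie algebra and its predual\<close>

text \<open>Class axioms can only mention class operations, so density of a countable set, the subspace
  property and infinite dimension are spelled out; \<open>separable_closure\<close>, \<open>csubspace_Hplus\<close>,
  \<open>csubspace_Hminus\<close> and \<open>infinite_dim_cspan\<close> below recover the library forms.\<close>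

class polarized_hilbert_space = complex_hilbert_space +
  fixes Hplus :: "'a set" and Hminus :: "'a set"
  assumes separable: "\<exists>S. countable S \<and> (\<forall>x. \<forall>e>0. \<exists>s\<in>S. dist s x < e)"
    and Hplus_subspace: "0 \<in> Hplus" "x \<in> Hplus \<Longrightarrow> y \<in> Hplus \<Longrightarrow> x + y \<in> Hplus"
      "x \<in> Hplus \<Longrightarrow> c *\<^sub>C x \<in> Hplus"
    and Hminus_subspace: "0 \<in> Hminus" "x \<in> Hminus \<Longrightarrow> y \<in> Hminus \<Longrightarrow> x + y \<in> Hminus"
      "x \<in> Hminus \<Longrightarrow> c *\<^sub>C x \<in> Hminus"
    and closed_Hplus: "closed Hplus" and closed_Hminus: "closed Hminus"
    and Hplus_orthogonal_Hminus: "x \<in> Hplus \<Longrightarrow> y \<in> Hminus \<Longrightarrow> cinner x y = 0"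
    and Hplus_add_Hminus: "\<exists>y\<in>Hplus. \<exists>z\<in>Hminus. x = y + z"
    and infinite_dim_Hplus: "finite S \<Longrightarrow> \<exists>x\<in>Hplus. \<forall>c. x \<noteq> (\<Sum>s\<in>S. c s *\<^sub>C s)"
    and infinite_dim_Hminus: "finite S \<Longrightarrow> \<exists>x\<in>Hminus. \<forall>c. x \<noteq> (\<Sum>s\<in>S. c s *\<^sub>C s)"

lemma csubspace_Hplus: "csubspace Hplus" and csubspace_Hminus: "csubspace Hminus"
  by (simp_all add: complex_vector.subspace_def Hplus_subspace Hminus_subspace)

lemma separable_closure: "\<exists>S::'a::polarized_hilbert_space set. countable S \<and> closure S = UNIV"
  using separable[where 'a='a] by (auto simp: set_eq_iff closure_approachable)

lemma infinite_dim_cspan: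
  "finite S \<Longrightarrow> \<not> Hplus \<subseteq> cspan S" "finite S \<Longrightarrow> \<not> Hminus \<subseteq> cspan S"
  using infinite_dim_Hplus[of S] infinite_dim_Hminus[of S] by (auto simp: complex_vector.span_finite)

definition proj_plus :: "'h::polarized_hilbert_space \<Rightarrow>\<^sub>L 'h" where
  "proj_plus = Blinfun (\<lambda>x. THE y. y \<in> Hplus \<and> x - y \<in> Hminus)"

definition proj_minus :: "'h::polarized_hilbert_space \<Rightarrow>\<^sub>L 'h" where
  "proj_minus = Blinfun (\<lambda>x. THE y. y \<in> Hminus \<and> x - y \<in> Hplus)"

lemma orthogonal_decomposition_projection:
  fixes U V :: "'h::complex_hilbert_space set"
  assumes U: "csubspace U" and V: "csubspace V"
    and orth: "\<And>x y. x \<in> U \<Longrightarrow> y \<in> V \<Longrightarrow> cinner x y = 0"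
    and sum: "\<And>x. \<exists>y\<in>U. \<exists>z\<in>V. x = y + z"
  defines "P \<equiv> Blinfun (\<lambda>x. THE y. y \<in> U \<and> x - y \<in> V)"
  shows "P x \<in> U \<and> x - P x \<in> V" "y \<in> U \<Longrightarrow> x - y \<in> V \<Longrightarrow> y = P x"
    "cinner (P x) z = cinner x (P z)"
proof -
  define p where "p x = (THE y. y \<in> U \<and> x - y \<in> V)" for x
  have uniq: "y = y'" if "y \<in> U" "x - y \<in> V" "y' \<in> U" "x - y' \<in> V" for x y y'
  proof -
    have "y - y' \<in> U" using U that complex_vector.subspace_diff by blast
    moreover have "(x - y') - (x - y) \<in> V" using V that complex_vector.subspace_diff by blast
    ultimately have "cinner (y - y') (y - y') = 0" using orth by simp
    then show ?thesis by (simp add: cinner_self)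
  qed
  have p: "p x \<in> U \<and> x - p x \<in> V" for x
  proof -
    obtain y z where "y \<in> U" "z \<in> V" "x = y + z" using sum by blast
    then have "y \<in> U \<and> x - y \<in> V" by simp
    then show ?thesis unfolding p_def by (rule theI) (use \<open>y \<in> U \<and> x - y \<in> V\<close> uniq in blast)
  qed
  have pU: "\<And>x. p x \<in> U" and pV: "\<And>x. x - p x \<in> V" using p by blast+
  have pE: "y = p x" if "y \<in> U" "x - y \<in> V" for x y using uniq[OF that pU pV] .
  have orth': "cinner y x = 0" if "x \<in> U" "y \<in> V" for x y
    by (subst cinner_commute) (simp add: orth[OF that])
  have sa: "cinner (p x) z = cinner x (p z)" for x z
    using orth[OF pU[of x] pV[of z]] orth'[OF pU[of z] pV[of x]]
    by (simp add: cinner_diff_left cinner_diff_right)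
  have "bounded_linear p"
  proof (rule bounded_linear_intro[where K=1])
    show "p (x + y) = p x + p y" for x y
    proof (rule pE[symmetric])
      have "(x - p x) + (y - p y) \<in> V" using V pV complex_vector.subspace_add by blast
      then show "x + y - (p x + p y) \<in> V" by (simp add: algebra_simps)
      show "p x + p y \<in> U" using U pU complex_vector.subspace_add by blast
    qed
    show "p (r *\<^sub>R x) = r *\<^sub>R p x" for r x
    proof (rule pE[symmetric])
      have "complex_of_real r *\<^sub>C (x - p x) \<in> V" using V pV complex_vector.subspace_scale by blast
      then show "r *\<^sub>R x - r *\<^sub>R p x \<in> V" by (simp add: scaleC_of_real scaleR_diff_right)
      have "complex_of_real r *\<^sub>C p x \<in> U" using U pU complex_vector.subspace_scale by blast
      then show "r *\<^sub>R p x \<in> U" by (simp add: scaleC_of_real)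
    qed
    show "norm (p x) \<le> norm x * 1" for x
    proof -
      have "cinner (p x) (p x) = cinner (p x) x"
        using orth[OF pU[of x] pV[of x]] by (simp add: cinner_diff_right)
      then have "(norm (p x))\<^sup>2 \<le> norm (p x) * norm x"
        using cmod_cinner_le[of "p x" x] by (metis cinner_self norm_of_real abs_power2)
      then show ?thesis by (cases "p x = 0") (auto simp: power2_eq_square)
    qed
  qed
  then have P: "blinfun_apply P = p"
    unfolding P_def p_def[abs_def] by (rule bounded_linear_Blinfun_apply)
  show "P x \<in> U \<and> x - P x \<in> V" "y \<in> U \<Longrightarrow> x - y \<in> V \<Longrightarrow> y = P x"
    "cinner (P x) z = cinner x (P z)"
    unfolding P using p pE sa by blast+
qed

lemma proj_plus: "proj_plus x \<in> Hplus \<and> x - proj_plus x \<in> Hminus"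
    "y \<in> Hplus \<Longrightarrow> x - y \<in> Hminus \<Longrightarrow> y = proj_plus x"
    "cinner (proj_plus x) z = cinner x (proj_plus z)"
  unfolding proj_plus_def
  using orthogonal_decomposition_projection[OF csubspace_Hplus csubspace_Hminus
      Hplus_orthogonal_Hminus Hplus_add_Hminus, where x=x] by blast+

lemma proj_minus: "proj_minus x \<in> Hminus \<and> x - proj_minus x \<in> Hplus"
    "y \<in> Hminus \<Longrightarrow> x - y \<in> Hplus \<Longrightarrow> y = proj_minus x"
    "cinner (proj_minus x) z = cinner x (proj_minus z)"
proof -
  have orth: "cinner u v = 0" if "u \<in> Hminus" "v \<in> Hplus" for u v :: 'a
    by (subst cinner_commute) (simp add: Hplus_orthogonal_Hminus that)
  have sum: "\<exists>y\<in>Hminus. \<exists>z\<in>Hplus. u = y + z" for u :: 'a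
    using Hplus_add_Hminus[of u] by (metis add.commute)
  note * = orthogonal_decomposition_projection[OF csubspace_Hminus csubspace_Hplus orth sum, where x=x]
  show "proj_minus x \<in> Hminus \<and> x - proj_minus x \<in> Hplus"
    "y \<in> Hminus \<Longrightarrow> x - y \<in> Hplus \<Longrightarrow> y = proj_minus x"
    "cinner (proj_minus x) z = cinner x (proj_minus z)"
    unfolding proj_minus_def using * by blast+
qed

lemma proj_plus_add_proj_minus: "proj_plus x + proj_minus x = x"
proof -
  have "x - proj_plus x = proj_minus x" using proj_plus(1)[of x] by (intro proj_minus(2)) auto
  then show ?thesis by (metis add.commute diff_add_cancel)
qed

lemma proj_idem: 
  "proj_plus (proj_plus x) = proj_plus x" "proj_minus (proj_minus x) = proj_minus x"
  "proj_plus (proj_minus x) = 0" "proj_minus (proj_plus x) = 0"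
proof -
  have 0: "(0::'a) \<in> Hplus" "(0::'a) \<in> Hminus"
    using complex_vector.subspace_0[OF csubspace_Hplus] complex_vector.subspace_0[OF csubspace_Hminus] by auto
  show "proj_plus (proj_plus x) = proj_plus x" "proj_minus (proj_minus x) = proj_minus x"
    using 0 proj_plus(1)[of x] proj_minus(1)[of x]
    by (auto intro!: proj_plus(2)[symmetric] proj_minus(2)[symmetric])
  show "proj_plus (proj_minus x) = 0" "proj_minus (proj_plus x) = 0"
    using 0 proj_plus(1)[of x] proj_minus(1)[of x]
    by (auto intro!: proj_plus(2)[of 0, symmetric] proj_minus(2)[of 0, symmetric])
qed

definition is_projection :: "('a::complex_hilbert_space \<Rightarrow>\<^sub>L 'a) \<Rightarrow> bool" where
  "is_projection p \<longleftrightarrow> (\<forall>x y. cinner (p x) y = cinner x (p y)) \<and> (\<forall>x. p (p x) = p x)"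

lemma is_projection_proj: "is_projection proj_plus" "is_projection proj_minus"
  by (simp_all add: is_projection_def proj_plus(3) proj_minus(3) proj_idem)

lemma is_projection_clinear_op: "is_projection p \<Longrightarrow> clinear_op p"
  unfolding is_projection_def by (intro self_adjoint_clinear_op) blast

lemma is_projection_norm_le:
  assumes "is_projection p" shows "norm (p x) \<le> norm x"
proof -
  have "cinner (p x) (p x) = cinner x (p x)" using assms unfolding is_projection_def by metis
  then have "(norm (p x))\<^sup>2 \<le> norm x * norm (p x)"
    using cmod_cinner_le[of x "p x"] by (metis cinner_self norm_of_real abs_power2)
  then show ?thesis by (cases "p x = 0") (auto simp: power2_eq_square)
qed

lemma is_projection_bessel:
  assumes p: "is_projection p" and x: "bessel F x"
  shows "bessel F (\<lambda>i. p (x i))"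
  unfolding bessel_def
proof (intro conjI allI)
  show "finite F" using x by (simp add: bessel_def)
  fix v
  have "(\<Sum>i\<in>F. (cmod (cinner v (p (x i))))\<^sup>2) = (\<Sum>i\<in>F. (cmod (cinner (p v) (x i)))\<^sup>2)"
    using p by (simp add: is_projection_def)
  also have "\<dots> \<le> (norm (p v))\<^sup>2" using x by (simp add: bessel_def)
  also have "\<dots> \<le> (norm v)\<^sup>2" using is_projection_norm_le[OF p] by (intro power_mono) auto
  finally show "(\<Sum>i\<in>F. (cmod (cinner v (p (x i))))\<^sup>2) \<le> (norm v)\<^sup>2" .
qed

text \<open>The operator \<open>d = i (p\<^sub>+ - p\<^sub>-)\<close>.\<close>

definition pol_op :: "'h::polarized_hilbert_space \<Rightarrow>\<^sub>L 'h" where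
  "pol_op = Blinfun (\<lambda>x. \<i> *\<^sub>C (proj_plus x - proj_minus x))"

definition commutator :: "('a::real_normed_vector \<Rightarrow>\<^sub>L 'a) \<Rightarrow> ('a \<Rightarrow>\<^sub>L 'a) \<Rightarrow> ('a \<Rightarrow>\<^sub>L 'a)" where
  "commutator A B = (A o\<^sub>L B) - (B o\<^sub>L A)"

definition ures :: "('h::polarized_hilbert_space \<Rightarrow>\<^sub>L 'h) set" where
  "ures = {a. clinear_op a \<and> cadjoint a = - a \<and> hilbert_schmidt (commutator pol_op a)}"

text \<open>The block of \<open>T\<close> from the range of the projection \<open>q\<close> to that of \<open>p\<close>, as an operator on the
  whole space (extended by zero); this changes neither the trace nor the trace and
  Hilbert--Schmidt norms.\<close>

definition block :: "('a::real_normed_vector \<Rightarrow>\<^sub>L 'a) \<Rightarrow> ('a \<Rightarrow>\<^sub>L 'a) \<Rightarrow> ('a \<Rightarrow>\<^sub>L 'a) \<Rightarrow> ('a \<Rightarrow>\<^sub>L 'a)" where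
  "block p q T = p o\<^sub>L T o\<^sub>L q"

lemma block_apply: "block p q T x = p (T (q x))"
  by (simp add: block_def)

lemma block_add: "block p q (S + T) = block p q S + block p q T"
  by (rule blinfun_eqI) (simp add: block_def blinfun.bilinear_simps)

lemma block_diff: "block p q (S - T) = block p q S - block p q T"
  by (rule blinfun_eqI) (simp add: block_def blinfun.bilinear_simps)

lemma block_scaleR: "block p q (r *\<^sub>R T) = r *\<^sub>R block p q T"
  by (rule blinfun_eqI) (simp add: block_def blinfun.bilinear_simps)

lemma block_zero: "block p q 0 = 0"
  by (rule blinfun_eqI) (simp add: block_def blinfun.bilinear_simps)

lemma bounded_linear_scaleC: "bounded_linear (\<lambda>x::'a::complex_hilbert_space. c *\<^sub>C x)"
  by (rule bounded_linear_intro[where K="cmod c"])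
    (auto simp: scaleC_add_right norm_scaleC mult.commute scaleC_scaleR_commute)

lemma pol_op_apply: "pol_op x = \<i> *\<^sub>C (proj_plus x - proj_minus x)"
  unfolding pol_op_def
  by (subst bounded_linear_Blinfun_apply)
    (auto intro!: bounded_linear_compose[OF bounded_linear_scaleC] bounded_linear_sub
      blinfun.bounded_linear_right)

lemma hilbert_schmidt_dominated:
  fixes S T :: "'a::complex_hilbert_space \<Rightarrow>\<^sub>L 'a"
  assumes S: "clinear_op S" and T: "hilbert_schmidt T" and q: "is_projection q"
    and le: "\<And>x. norm (S x) \<le> c * norm (T (q x))"
  shows "hilbert_schmidt S"
proof (rule hilbert_schmidtI[OF S])
  show "0 \<le> \<bar>c\<bar> * hs_norm T" by (simp add: hs_norm_nonneg)
  fix F :: "'a set" and x :: "'a \<Rightarrow> 'a" assume x: "bessel F x"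
  have "(norm (S (x i)))\<^sup>2 \<le> c\<^sup>2 * (norm (T (q (x i))))\<^sup>2" for i
    using power_mono[OF le norm_ge_zero, of "x i" 2] by (simp add: power_mult_distrib)
  then have "(\<Sum>i\<in>F. (norm (S (x i)))\<^sup>2) \<le> c\<^sup>2 * (\<Sum>i\<in>F. (norm (T (q (x i))))\<^sup>2)"
    unfolding sum_distrib_left by (rule sum_mono)
  also have "\<dots> \<le> c\<^sup>2 * (hs_norm T)\<^sup>2"
    by (intro mult_left_mono hs_bessel[OF T is_projection_bessel[OF q x]]) auto
  finally show "(\<Sum>i\<in>F. (norm (S (x i)))\<^sup>2) \<le> (\<bar>c\<bar> * hs_norm T)\<^sup>2" by (simp add: power_mult_distrib)
qed

lemma proj_clinear:
  "proj_plus (c *\<^sub>C x) = c *\<^sub>C proj_plus x" "proj_minus (c *\<^sub>C x) = c *\<^sub>C proj_minus x"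
  by (rule clinear_op_def[THEN iffD1, rule_format], rule is_projection_clinear_op, rule is_projection_proj)+

lemma clinear_op_block:
  assumes "is_projection p" "is_projection q" "clinear_op T"
  shows "clinear_op (block p q T)"
  using assms by (simp add: block_def clinear_op_compose is_projection_clinear_op)

lemma commutator_pol_op:
  assumes a: "clinear_op a"
  shows "commutator pol_op a x = (2 * \<i>) *\<^sub>C (block proj_plus proj_minus a x - block proj_minus proj_plus a x)"
proof -
  define u v where "u = proj_plus x" and "v = proj_minus x"
  have x: "x = u + v" by (simp add: u_def v_def proj_plus_add_proj_minus)
  have pu: "proj_plus u = u" "proj_minus u = 0" "proj_plus v = 0" "proj_minus v = v"
    by (simp_all add: u_def v_def proj_idem)
  have aC: "a (c *\<^sub>C y) = c *\<^sub>C a y" for c y using a by (simp add: clinear_op_def)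
  have s: "a y = proj_plus (a y) + proj_minus (a y)" for y by (simp add: proj_plus_add_proj_minus)
  have two: "(2 * \<i>) *\<^sub>C y = \<i> *\<^sub>C y + \<i> *\<^sub>C y" for y :: 'a
    by (simp flip: scaleC_add_left)
  have "commutator pol_op a x = \<i> *\<^sub>C (proj_plus (a u) + proj_plus (a v) - (proj_minus (a u) + proj_minus (a v)))
      - \<i> *\<^sub>C (a u - a v)"
    unfolding commutator_def x
    by (simp add: pol_op_apply blinfun.bilinear_simps pu aC complex_vector.scale_right_diff_distrib scaleC_add_right
        algebra_simps)
  also have "\<dots> = \<i> *\<^sub>C ((proj_plus (a v) - proj_minus (a u)) + (proj_plus (a v) - proj_minus (a u)))"
    by (subst (5) s, subst (6) s) (simp add: algebra_simps flip: complex_vector.scale_right_diff_distrib)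
  also have "\<dots> = (2 * \<i>) *\<^sub>C (proj_plus (a v) - proj_minus (a u))"
    unfolding two scaleC_add_right ..
  finally show ?thesis by (simp add: block_apply u_def v_def)
qed

lemma hilbert_schmidt_commutator_pol_op_iff:
  assumes a: "clinear_op a"
  shows "hilbert_schmidt (commutator pol_op a) \<longleftrightarrow>
    hilbert_schmidt (block proj_plus proj_minus a) \<and> hilbert_schmidt (block proj_minus proj_plus a)"
    (is "?C \<longleftrightarrow> ?P \<and> ?M")
proof (intro iffI conjI)
  note pr = is_projection_proj
  have c: "commutator pol_op a (proj_minus x) = (2 * \<i>) *\<^sub>C block proj_plus proj_minus a x"
    "commutator pol_op a (proj_plus x) = - ((2 * \<i>) *\<^sub>C block proj_minus proj_plus a x)" for x
    by (simp_all add: commutator_pol_op[OF a] block_apply proj_idem blinfun.bilinear_simps scaleC_minus_right)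
  show ?P if ?C
  proof (rule hilbert_schmidt_dominated[OF clinear_op_block[OF pr(1,2) a] that pr(2)])
    show "norm (block proj_plus proj_minus a x) \<le> (1/2) * norm (commutator pol_op a (proj_minus x))" for x
      unfolding c by (simp add: norm_scaleC norm_mult)
  qed
  show ?M if ?C
  proof (rule hilbert_schmidt_dominated[OF clinear_op_block[OF pr(2,1) a] that pr(1)])
    show "norm (block proj_minus proj_plus a x) \<le> (1/2) * norm (commutator pol_op a (proj_plus x))" for x
      unfolding c by (simp add: norm_scaleC norm_mult)
  qed
  assume PM: "?P \<and> ?M"
  then have D: "hilbert_schmidt (block proj_plus proj_minus a + (-1) *\<^sub>R block proj_minus proj_plus a)"
    by (intro hilbert_schmidt_add hilbert_schmidt_scaleR) auto
  have id: "is_projection (id_blinfun :: 'a \<Rightarrow>\<^sub>L 'a)" by (simp add: is_projection_def)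
  have cl: "clinear_op (commutator pol_op a)"
    using clinear_op_block[OF pr(1,2) a] clinear_op_block[OF pr(2,1) a]
    unfolding clinear_op_def commutator_pol_op[OF a]
    by (simp add: scaleC_scaleC mult_ac complex_vector.scale_right_diff_distrib)
  show ?C
  proof (rule hilbert_schmidt_dominated[OF cl D id])
    show "norm (commutator pol_op a x) \<le> 2 * norm ((block proj_plus proj_minus a
        + (-1) *\<^sub>R block proj_minus proj_plus a) (id_blinfun x))" for x
      by (simp add: commutator_pol_op[OF a] norm_scaleC norm_mult blinfun.bilinear_simps)
  qed
qed

lemma skew_adjoint_iff:
  "clinear_op a \<Longrightarrow> cadjoint a = - a \<longleftrightarrow> (\<forall>x y. cinner (a x) y = - cinner x (a y))"
  by (subst cadjoint_eq_iff) (auto simp: blinfun.bilinear_simps cinner_minus_right)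

lemma ures_iff:
  "a \<in> ures \<longleftrightarrow> clinear_op a \<and> (\<forall>x y. cinner (a x) y = - cinner x (a y)) \<and>
    hilbert_schmidt (block proj_plus proj_minus a) \<and> hilbert_schmidt (block proj_minus proj_plus a)"
  unfolding ures_def
  using hilbert_schmidt_commutator_pol_op_iff skew_adjoint_iff by blast

typedef (overloaded) 'h ures_predual = "{\<rho> \<in> (ures :: ('h::polarized_hilbert_space \<Rightarrow>\<^sub>L 'h) set).
    trace_class (block proj_plus proj_plus \<rho>) \<and> trace_class (block proj_minus proj_minus \<rho>)}"
  morphisms op_of Abs_ures_predual
  by (rule exI[of _ 0])
    (auto simp: ures_iff block_zero trace_class_zero hilbert_schmidt_zero clinear_op_zero)


subsection \<open>Banach space structure\<close>

lemma ures_predual_set_iff: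
  "\<rho> \<in> {\<rho> \<in> ures. trace_class (block proj_plus proj_plus \<rho>) \<and> trace_class (block proj_minus proj_minus \<rho>)} \<longleftrightarrow>
    clinear_op \<rho> \<and> (\<forall>x y. cinner (\<rho> x) y = - cinner x (\<rho> y)) \<and>
    hilbert_schmidt (block proj_plus proj_minus \<rho>) \<and> hilbert_schmidt (block proj_minus proj_plus \<rho>) \<and>
    trace_class (block proj_plus proj_plus \<rho>) \<and> trace_class (block proj_minus proj_minus \<rho>)"
  by (auto simp: ures_iff)

lemma op_of_props:
  "clinear_op (op_of \<rho>)" "cinner (op_of \<rho> x) y = - cinner x (op_of \<rho> y)"
  "hilbert_schmidt (block proj_plus proj_minus (op_of \<rho>))"
  "hilbert_schmidt (block proj_minus proj_plus (op_of \<rho>))"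
  "trace_class (block proj_plus proj_plus (op_of \<rho>))"
  "trace_class (block proj_minus proj_minus (op_of \<rho>))"
  using op_of[of \<rho>] unfolding ures_predual_set_iff by blast+

lemma op_of_Abs:
  assumes "clinear_op \<rho>" "\<And>x y. cinner (\<rho> x) y = - cinner x (\<rho> y)"
    "hilbert_schmidt (block proj_plus proj_minus \<rho>)" "hilbert_schmidt (block proj_minus proj_plus \<rho>)"
    "trace_class (block proj_plus proj_plus \<rho>)" "trace_class (block proj_minus proj_minus \<rho>)"
  shows "op_of (Abs_ures_predual \<rho>) = \<rho>"
  by (rule Abs_ures_predual_inverse) (use assms in \<open>unfold ures_predual_set_iff, blast\<close>)

instantiation ures_predual :: (polarized_hilbert_space) real_vector
begin

definition zero_ures_predual :: "'a ures_predual" where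
  "0 = Abs_ures_predual 0"

definition plus_ures_predual :: "'a ures_predual \<Rightarrow> 'a ures_predual \<Rightarrow> 'a ures_predual" where
  "x + y = Abs_ures_predual (op_of x + op_of y)"

definition scaleR_ures_predual :: "real \<Rightarrow> 'a ures_predual \<Rightarrow> 'a ures_predual" where
  "r *\<^sub>R x = Abs_ures_predual (r *\<^sub>R op_of x)"

definition uminus_ures_predual :: "'a ures_predual \<Rightarrow> 'a ures_predual" where
  "- x = (-1) *\<^sub>R x" for x :: "'a ures_predual"

definition minus_ures_predual :: "'a ures_predual \<Rightarrow> 'a ures_predual \<Rightarrow> 'a ures_predual" where
  "x - y = x + (- y)" for x y :: "'a ures_predual"

lemma op_of_zero: "op_of (0 :: 'a ures_predual) = 0"
  unfolding zero_ures_predual_def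
  by (rule op_of_Abs)
    (simp_all add: clinear_op_zero block_zero hilbert_schmidt_zero trace_class_zero)

lemma op_of_add: "op_of (x + y) = op_of x + op_of y" for x y :: "'a ures_predual"
  unfolding plus_ures_predual_def
  by (rule op_of_Abs)
    (simp_all add: clinear_op_add op_of_props block_add hilbert_schmidt_add trace_class_add
      blinfun.add_left cinner_add_left cinner_add_right)

lemma op_of_scaleR: "op_of (r *\<^sub>R x) = r *\<^sub>R op_of x" for x :: "'a ures_predual"
  unfolding scaleR_ures_predual_def
  by (rule op_of_Abs)
    (simp_all add: clinear_op_scaleR op_of_props block_scaleR hilbert_schmidt_scaleR trace_class_scaleR
      blinfun.scaleR_left cinner_scaleR_left cinner_scaleR_right)

lemma op_of_minus: "op_of (- x) = - op_of x" for x :: "'a ures_predual"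
  by (simp add: uminus_ures_predual_def op_of_scaleR)

lemma op_of_diff: "op_of (x - y) = op_of x - op_of y" for x y :: "'a ures_predual"
  by (simp add: minus_ures_predual_def op_of_add op_of_minus)

instance
  by standard
    (simp_all add: op_of_inject[symmetric] op_of_add op_of_zero op_of_scaleR op_of_minus op_of_diff
      algebra_simps)

end

instantiation ures_predual :: (polarized_hilbert_space) real_normed_vector
begin

definition norm_ures_predual :: "'a ures_predual \<Rightarrow> real" where
  "norm \<rho> = trace_norm (block proj_plus proj_plus (op_of \<rho>))
    + trace_norm (block proj_minus proj_minus (op_of \<rho>))
    + hs_norm (block proj_plus proj_minus (op_of \<rho>))
    + hs_norm (block proj_minus proj_plus (op_of \<rho>))"

definition dist_ures_predual :: "'a ures_predual \<Rightarrow> 'a ures_predual \<Rightarrow> real" where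
  "dist x y = norm (x - y)" for x y :: "'a ures_predual"

definition sgn_ures_predual :: "'a ures_predual \<Rightarrow> 'a ures_predual" where
  "sgn x = x /\<^sub>R norm x" for x :: "'a ures_predual"

definition uniformity_ures_predual :: "('a ures_predual \<times> 'a ures_predual) filter" where
  "uniformity_ures_predual = (INF e\<in>{0 <..}. principal {(x, y). dist x y < e})"

definition open_ures_predual :: "'a ures_predual set \<Rightarrow> bool" where
  "open_ures_predual U \<longleftrightarrow> (\<forall>x\<in>U. eventually (\<lambda>(x', y). x' = x \<longrightarrow> y \<in> U) uniformity)"

lemma blocks_le_norm:
  fixes \<rho> :: "'a ures_predual"
  shows "trace_norm (block proj_plus proj_plus (op_of \<rho>)) \<le> norm \<rho>"
    "trace_norm (block proj_minus proj_minus (op_of \<rho>)) \<le> norm \<rho>"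
    "hs_norm (block proj_plus proj_minus (op_of \<rho>)) \<le> norm \<rho>"
    "hs_norm (block proj_minus proj_plus (op_of \<rho>)) \<le> norm \<rho>"
    "0 \<le> norm \<rho>"
  using hs_norm_nonneg[of "block proj_plus proj_minus (op_of \<rho>)"]
    hs_norm_nonneg[of "block proj_minus proj_plus (op_of \<rho>)"]
    trace_norm_nonneg[OF trace_class_clinear_op[OF op_of_props(5)[of \<rho>]]]
    trace_norm_nonneg[OF trace_class_clinear_op[OF op_of_props(6)[of \<rho>]]]
  by (simp_all add: norm_ures_predual_def)

lemma block_decomposition:
  fixes T :: "'a \<Rightarrow>\<^sub>L 'a"
  shows "T x = block proj_plus proj_plus T x + block proj_minus proj_minus T x
    + block proj_plus proj_minus T x + block proj_minus proj_plus T x"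
proof -
  have "T x = proj_plus (T (proj_plus x) + T (proj_minus x)) + proj_minus (T (proj_plus x) + T (proj_minus x))"
    unfolding proj_plus_add_proj_minus by (simp add: proj_plus_add_proj_minus flip: blinfun.add_right)
  then show ?thesis by (simp add: block_apply blinfun.add_right)
qed

lemma norm_op_of_le: "norm (op_of \<rho>) \<le> norm \<rho>" for \<rho> :: "'a ures_predual"
proof -
  let ?T = "op_of \<rho>"
  have "?T = block proj_plus proj_plus ?T + block proj_minus proj_minus ?T
    + block proj_plus proj_minus ?T + block proj_minus proj_plus ?T" (is "_ = ?R")
    by (rule blinfun_eqI, subst block_decomposition) (simp add: blinfun.add_left)
  then have "norm ?T = norm ?R" by simp
  also have "\<dots> \<le> norm (block proj_plus proj_plus ?T) + norm (block proj_minus proj_minus ?T)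
    + norm (block proj_plus proj_minus ?T) + norm (block proj_minus proj_plus ?T)"
    by (intro order_trans[OF norm_triangle_ineq] add_right_mono order_refl)
  also have "\<dots> \<le> norm \<rho>"
    unfolding norm_ures_predual_def
    by (intro add_mono norm_le_trace_norm norm_le_hs_norm op_of_props)
  finally show ?thesis .
qed

instance
proof
  fix x y :: "'a ures_predual" and r :: real
  show "norm x = 0 \<longleftrightarrow> x = 0"
  proof
    assume "norm x = 0"
    then have "op_of x = 0" using norm_op_of_le[of x] by simp
    then show "x = 0" by (simp add: op_of_inject[symmetric] op_of_zero)
  next
    assume "x = 0"
    then show "norm x = 0"
      by (simp add: norm_ures_predual_def op_of_zero block_zero trace_class_zero hilbert_schmidt_zero)
  qed
  show "norm (x + y) \<le> norm x + norm y"
    using trace_class_add(2)[OF op_of_props(5)[of x] op_of_props(5)[of y]]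
      trace_class_add(2)[OF op_of_props(6)[of x] op_of_props(6)[of y]]
      hilbert_schmidt_add(2)[OF op_of_props(3)[of x] op_of_props(3)[of y]]
      hilbert_schmidt_add(2)[OF op_of_props(4)[of x] op_of_props(4)[of y]]
    unfolding norm_ures_predual_def op_of_add block_add by linarith
  show "norm (r *\<^sub>R x) = \<bar>r\<bar> * norm x"
    unfolding norm_ures_predual_def op_of_scaleR block_scaleR
      trace_class_scaleR(2)[OF op_of_props(5)] trace_class_scaleR(2)[OF op_of_props(6)]
      hilbert_schmidt_scaleR(2)[OF op_of_props(3)] hilbert_schmidt_scaleR(2)[OF op_of_props(4)]
    by (simp add: distrib_left)
qed (simp_all add: dist_ures_predual_def sgn_ures_predual_def uniformity_ures_predual_def
    open_ures_predual_def)

end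

instance ures_predual :: (polarized_hilbert_space) banach
proof
  fix X :: "nat \<Rightarrow> 'a ures_predual"
  assume X: "Cauchy X"
  have "Cauchy (\<lambda>n. op_of (X n))"
  proof (rule metric_CauchyI)
    fix e :: real assume "0 < e"
    then obtain M where M: "\<And>m n. m \<ge> M \<Longrightarrow> n \<ge> M \<Longrightarrow> norm (X m - X n) < e" using CauchyD[OF X] by blast
    have "dist (op_of (X m)) (op_of (X n)) < e" if "m \<ge> M" "n \<ge> M" for m n
      using norm_op_of_le[of "X m - X n"] M[OF that] unfolding op_of_diff dist_norm by linarith
    then show "\<exists>M. \<forall>m\<ge>M. \<forall>n\<ge>M. dist (op_of (X m)) (op_of (X n)) < e" by blast
  qed
  then obtain T where T: "(\<lambda>n. op_of (X n)) \<longlonglongrightarrow> T"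
    using Cauchy_convergent unfolding convergent_def by blast
  have pt: "(\<lambda>n. op_of (X n) x) \<longlonglongrightarrow> T x" for x using T by (intro blinfun.tendsto tendsto_const)
  have cT: "clinear_op T" by (rule clinear_op_limit[OF op_of_props(1) pt])
  have skT: "cinner (T x) y = - cinner x (T y)" for x y
  proof (rule LIMSEQ_unique)
    show "(\<lambda>n. cinner (op_of (X n) x) y) \<longlonglongrightarrow> cinner (T x) y"
      by (rule bounded_linear.tendsto[OF bounded_linear_cinner_left pt])
    show "(\<lambda>n. cinner (op_of (X n) x) y) \<longlonglongrightarrow> - cinner x (T y)"
      unfolding op_of_props(2)
      by (intro tendsto_minus bounded_linear.tendsto[OF bounded_linear_cinner_right pt])
  qed
  note pr = is_projection_proj
  define D where "D m = op_of (X m) - T" for m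
  have key: "trace_class (block proj_plus proj_plus (D m)) \<and> trace_norm (block proj_plus proj_plus (D m)) \<le> e \<and>
      trace_class (block proj_minus proj_minus (D m)) \<and> trace_norm (block proj_minus proj_minus (D m)) \<le> e \<and>
      hilbert_schmidt (block proj_plus proj_minus (D m)) \<and> hs_norm (block proj_plus proj_minus (D m)) \<le> e \<and>
      hilbert_schmidt (block proj_minus proj_plus (D m)) \<and> hs_norm (block proj_minus proj_plus (D m)) \<le> e"
    if M: "\<And>m n. m \<ge> M \<Longrightarrow> n \<ge> M \<Longrightarrow> norm (X m - X n) < e" and m: "m \<ge> M" for M m e
  proof -
    let ?Y = "\<lambda>n. X m - X n"
    have le: "norm (?Y n) \<le> e" if "M \<le> n" for n using M[OF m that] by simp
    have lim: "(\<lambda>n. block p q (op_of (?Y n)) x) \<longlonglongrightarrow> block p q (D m) x" for p q :: "'a \<Rightarrow>\<^sub>L 'a" and x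
      unfolding block_apply op_of_diff D_def blinfun.diff_left
      by (intro blinfun.tendsto tendsto_const tendsto_diff pt)
    have cD: "clinear_op (D m)"
      using clinear_op_add[OF op_of_props(1)[of "X m"] clinear_op_scaleR[OF cT, of "-1"]]
      by (simp add: D_def)
    have t: "\<And>n. M \<le> n \<Longrightarrow> trace_class (block proj_plus proj_plus (op_of (?Y n))) \<and> trace_norm (block proj_plus proj_plus (op_of (?Y n))) \<le> e"
        "\<And>n. M \<le> n \<Longrightarrow> trace_class (block proj_minus proj_minus (op_of (?Y n))) \<and> trace_norm (block proj_minus proj_minus (op_of (?Y n))) \<le> e"
        "\<And>n. M \<le> n \<Longrightarrow> hilbert_schmidt (block proj_plus proj_minus (op_of (?Y n))) \<and> hs_norm (block proj_plus proj_minus (op_of (?Y n))) \<le> e"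
        "\<And>n. M \<le> n \<Longrightarrow> hilbert_schmidt (block proj_minus proj_plus (op_of (?Y n))) \<and> hs_norm (block proj_minus proj_plus (op_of (?Y n))) \<le> e"
      using op_of_props(3-6) blocks_le_norm(1-4) le order_trans by blast+
    show ?thesis
      using trace_class_limit[OF t(1) clinear_op_block[OF pr(1) pr(1) cD] lim]
        trace_class_limit[OF t(2) clinear_op_block[OF pr(2) pr(2) cD] lim]
        hilbert_schmidt_limit[OF t(3) clinear_op_block[OF pr(1) pr(2) cD] lim]
        hilbert_schmidt_limit[OF t(4) clinear_op_block[OF pr(2) pr(1) cD] lim]
      by blast
  qed
  have TD: "block p q T = block p q (op_of (X m)) + (-1) *\<^sub>R block p q (D m)" for p q m
    by (simp add: D_def block_diff)
  obtain M1 where M1: "\<And>m n. m \<ge> M1 \<Longrightarrow> n \<ge> M1 \<Longrightarrow> norm (X m - X n) < 1" using CauchyD[OF X, of 1] by auto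
  have k1: "hilbert_schmidt (block proj_plus proj_minus (D M1))" "hilbert_schmidt (block proj_minus proj_plus (D M1))"
    "trace_class (block proj_plus proj_plus (D M1))" "trace_class (block proj_minus proj_minus (D M1))"
    using key[of M1 1 M1] M1 by blast+
  define \<rho> where "\<rho> = Abs_ures_predual T"
  have "op_of \<rho> = T"
    unfolding \<rho>_def
  proof (rule op_of_Abs[OF cT skT])
    show "hilbert_schmidt (block proj_plus proj_minus T)"
      unfolding TD[of _ _ M1]
      by (rule hilbert_schmidt_add(1)[OF op_of_props(3) hilbert_schmidt_scaleR(1)[OF k1(1)]])
    show "hilbert_schmidt (block proj_minus proj_plus T)"
      unfolding TD[of _ _ M1]
      by (rule hilbert_schmidt_add(1)[OF op_of_props(4) hilbert_schmidt_scaleR(1)[OF k1(2)]])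
    show "trace_class (block proj_plus proj_plus T)"
      unfolding TD[of _ _ M1]
      by (rule trace_class_add(1)[OF op_of_props(5) trace_class_scaleR(1)[OF k1(3)]])
    show "trace_class (block proj_minus proj_minus T)"
      unfolding TD[of _ _ M1]
      by (rule trace_class_add(1)[OF op_of_props(6) trace_class_scaleR(1)[OF k1(4)]])
  qed
  then have D: "D m = op_of (X m - \<rho>)" for m by (simp add: D_def op_of_diff)
  have "X \<longlonglongrightarrow> \<rho>"
  proof (rule metric_LIMSEQ_I)
    fix e :: real assume e: "0 < e"
    then obtain M where M: "\<And>m n. m \<ge> M \<Longrightarrow> n \<ge> M \<Longrightarrow> norm (X m - X n) < e / 5"
      using CauchyD[OF X, of "e / 5"] by auto
    have "dist (X m) \<rho> < e" if "m \<ge> M" for m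
      using key[OF M that] e unfolding dist_norm norm_ures_predual_def D by linarith
    then show "\<exists>M. \<forall>m\<ge>M. dist (X m) \<rho> < e" by blast
  qed
  then show "convergent X" unfolding convergent_def by blast
qed

text \<open>\<open>Tr\<close> of a product: the sum of the traces of its two diagonal blocks.\<close>

definition res_trace :: "('h::polarized_hilbert_space \<Rightarrow>\<^sub>L 'h) \<Rightarrow> complex" where
  "res_trace T = trace (block proj_plus proj_plus T) + trace (block proj_minus proj_minus T)"

text \<open>For \<open>A, B\<close> in \<^const>\<open>ures\<close> the traces in the next two definitions are real, since both factors
  are skew-adjoint; \<^const>\<open>Re\<close> only changes the type.\<close>

definition ures_pairing :: "'h::polarized_hilbert_space ures_predual \<Rightarrow> ('h \<Rightarrow>\<^sub>L 'h) \<Rightarrow> real" where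
  "ures_pairing \<mu> A = Re (res_trace (op_of \<mu> o\<^sub>L A))"

definition ures_cocycle :: "('h::polarized_hilbert_space \<Rightarrow>\<^sub>L 'h) \<Rightarrow> ('h \<Rightarrow>\<^sub>L 'h) \<Rightarrow> real" where
  "ures_cocycle A B = Re (res_trace (A o\<^sub>L commutator pol_op B))"

section \<open>Banach Lie--Poisson spaces\<close>

text \<open>
  The \<open>n\<close>-th Frechet derivative of \<open>f\<close> at \<open>x\<close> is an element of the iterated space of bounded linear
  maps \<open>L(b, L(b, \<dots> L(b, c)))\<close>, whose type depends on \<open>n\<close>. Under the isometry of this space with the
  bounded \<open>n\<close>-linear maps it is represented below by \<open>D n x\<close>, a function of lists of length \<open>n\<close>
  (its values on lists of other lengths are irrelevant); the newest direction is the head of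
  the list, and \<open>D (Suc n) x\<close> is the Frechet derivative of \<open>D n\<close> at \<open>x\<close> with respect to the norm of
  bounded \<open>n\<close>-linear maps.
\<close>

definition bounded_multilinear ::
  "nat \<Rightarrow> ('b::real_normed_vector list \<Rightarrow> 'c::real_normed_vector) \<Rightarrow> bool" where
  "bounded_multilinear n F \<longleftrightarrow>
    (\<forall>us vs. length us + length vs + 1 = n \<longrightarrow> linear (\<lambda>h. F (us @ h # vs))) \<and>
    (\<exists>C. \<forall>hs. length hs = n \<longrightarrow> norm (F hs) \<le> C * prod_list (map norm hs))"

definition smooth :: "('b::real_normed_vector \<Rightarrow> 'c::real_normed_vector) \<Rightarrow> bool" where
  "smooth f \<longleftrightarrow> (\<exists>D :: nat \<Rightarrow> 'b \<Rightarrow> 'b list \<Rightarrow> 'c.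
    (\<forall>x. D 0 x [] = f x) \<and>
    (\<forall>n x. bounded_multilinear n (D n x)) \<and>
    (\<forall>n x. \<forall>\<epsilon>>0. \<exists>\<delta>>0. \<forall>h. norm h < \<delta> \<longrightarrow> (\<forall>hs. length hs = n \<longrightarrow>
      norm (D n (x + h) hs - D n x hs - D (Suc n) x (h # hs)) \<le> \<epsilon> * norm h * prod_list (map norm hs))))"

text \<open>A Poisson bracket on \<open>C\<^sup>\<infinity>(b)\<close>; only its values on smooth functions matter.\<close>

definition poisson_bracket ::
  "(('b::real_normed_vector \<Rightarrow> real) \<Rightarrow> ('b \<Rightarrow> real) \<Rightarrow> ('b \<Rightarrow> real)) \<Rightarrow> bool" where
  "poisson_bracket P \<longleftrightarrow>
    (\<forall>f g. smooth f \<longrightarrow> smooth g \<longrightarrow> smooth (P f g)) \<and>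
    (\<forall>f g h. smooth f \<longrightarrow> smooth g \<longrightarrow> smooth h \<longrightarrow> P (\<lambda>x. f x + g x) h = (\<lambda>x. P f h x + P g h x)) \<and>
    (\<forall>c f g. smooth f \<longrightarrow> smooth g \<longrightarrow> P (\<lambda>x. c * f x) g = (\<lambda>x. c * P f g x)) \<and>
    (\<forall>f g. smooth f \<longrightarrow> smooth g \<longrightarrow> P f g = (\<lambda>x. - P g f x)) \<and>
    (\<forall>f g h. smooth f \<longrightarrow> smooth g \<longrightarrow> smooth h \<longrightarrow>
      (\<forall>x. P f (P g h) x + P g (P h f) x + P h (P f g) x = 0)) \<and>
    (\<forall>f g h. smooth f \<longrightarrow> smooth g \<longrightarrow> smooth h \<longrightarrow>
      P (\<lambda>x. f x * g x) h = (\<lambda>x. f x * P g h x + P f h x * g x))"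

definition hamiltonian_vector_field ::
  "(('b::real_normed_vector \<Rightarrow> real) \<Rightarrow> ('b \<Rightarrow> real) \<Rightarrow> ('b \<Rightarrow> real)) \<Rightarrow> ('b \<Rightarrow> real) \<Rightarrow> ('b \<Rightarrow> 'b) \<Rightarrow> bool" where
  "hamiltonian_vector_field P h X \<longleftrightarrow>
    smooth X \<and> (\<forall>f. smooth f \<longrightarrow> (\<forall>x. frechet_derivative f (at x) (X x) = P f h x))"

definition banach_lie_algebra :: "('a::banach \<Rightarrow> 'a \<Rightarrow> 'a) \<Rightarrow> bool" where
  "banach_lie_algebra br \<longleftrightarrow> bounded_bilinear br \<and> (\<forall>x. br x x = 0) \<and>
    (\<forall>x y z. br x (br y z) + br y (br z x) + br z (br x y) = 0)"

definition banach_lie_poisson_space ::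
  "(('b::banach \<Rightarrow> real) \<Rightarrow> ('b \<Rightarrow> real) \<Rightarrow> ('b \<Rightarrow> real)) \<Rightarrow> bool" where
  "banach_lie_poisson_space P \<longleftrightarrow>
    poisson_bracket P \<and>
    (\<forall>h. smooth h \<longrightarrow> (\<exists>X. hamiltonian_vector_field P h X)) \<and>
    (\<forall>\<phi> \<psi> :: 'b \<Rightarrow>\<^sub>L real. bounded_linear (P (blinfun_apply \<phi>) (blinfun_apply \<psi>))) \<and>
    banach_lie_algebra (\<lambda>\<phi> \<psi> :: 'b \<Rightarrow>\<^sub>L real. Blinfun (P (blinfun_apply \<phi>) (blinfun_apply \<psi>)))"

section \<open>The bracket on the predual of the central extension\<close>

text \<open>The partial derivative with respect to \<open>\<mu>\<close> at \<open>(\<mu>, \<gamma>)\<close> is a bounded linear functional on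
  \<^typ>\<open>'h::polarized_hilbert_space ures_predual\<close>; \<open>D_mu f (\<mu>, \<gamma>)\<close> is the element of \<^const>\<open>ures\<close> representing it in the pairing.\<close>

definition D_mu ::
  "('h::polarized_hilbert_space ures_predual \<times> real \<Rightarrow> real) \<Rightarrow> 'h ures_predual \<times> real \<Rightarrow> ('h \<Rightarrow>\<^sub>L 'h)" where
  "D_mu f = (\<lambda>(\<mu>, \<gamma>). THE A. A \<in> ures \<and>
    ((\<lambda>\<nu>. f (\<nu>, \<gamma>)) has_derivative (\<lambda>\<nu>. ures_pairing \<nu> A)) (at \<mu>))"

definition ures_bracket ::
  "('h::polarized_hilbert_space ures_predual \<times> real \<Rightarrow> real) \<Rightarrow> ('h ures_predual \<times> real \<Rightarrow> real)
    \<Rightarrow> 'h ures_predual \<times> real \<Rightarrow> real" where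
  "ures_bracket f g = (\<lambda>(\<mu>, \<gamma>).
    ures_pairing \<mu> (commutator (D_mu f (\<mu>, \<gamma>)) (D_mu g (\<mu>, \<gamma>)))
    - \<gamma> * ures_cocycle (D_mu f (\<mu>, \<gamma>)) (D_mu g (\<mu>, \<gamma>)))"

end

theory Submission
  imports Defs
begin

text \<open>
  Every bounded functional on the predual of \<open>u_res\<close> is represented by a unique operator of \<open>u_res\<close>: its
  values on the skew rank two operators \<open>|x><y| - |y><x|\<close> define a bounded skew form, hence an operator, whose
  off-diagonal blocks are Hilbert--Schmidt by testing against finite sums of such operators; these
  operators span a dense subspace. Cyclicity of the trace gives \<open><\<mu>, [A, B]> = <[B, \<mu>], A>\<close> and
  \<open>s(A, B) = <[d, B], A>\<close>, so that \<open>{f, g}(x) = Df(x) (\<Gamma>(Dg(x), x))\<close> where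
  \<open>\<Gamma>(B, (\<mu>, \<gamma>)) = ([B, \<mu>] - \<gamma> [d, B], 0)\<close> lies in the predual again. The Jacobi identity for functions
  follows from the one for \<open>\<Gamma>\<close> on linear functionals, because the second derivative terms cancel by their
  symmetry.
\<close>

section \<open>Operator ideals and the trace\<close>

text \<open>The ideals are defined through one orthonormal basis and \<open>abs_op\<close>, which
  suits neither products nor limits. Estimates are therefore made against finite Bessel families,
  which contractions preserve: the two norms are the least constants bounding the sums over such
  families. Regularised inverses of \<open>abs_op T\<close> stand in for a polar decomposition, and
  cyclicity of the trace for a trace class operator against a bounded one is reduced to the
  Hilbert-Schmidt case by writing self-adjoint operators as differences of two squares. The
  Hamiltonian vector must lie in the predual, not in its bidual. For [B, \<mu>] this is an ideal
  property of 2 by 2 block matrices: the off-diagonal blocks of \<mu> are only Hilbert-Schmidt, but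
  they meet Hilbert-Schmidt blocks of B. For [d, B] the diagonal blocks vanish, so their trace class
  condition is trivial. The same vanishing for [d, AB] makes the cocycle antisymmetric although AB
  need not have a trace. Derivatives of all orders are handled as functions of lists, since Dg must
  be smooth as a map into the dual before brackets can be iterated.\<close>

lemma norm_cadjoint_le:
  assumes "clinear_op T"
  shows "norm (cadjoint T x) \<le> norm T * norm x"
proof (cases "cadjoint T x = 0")
  case False
  have "(norm (cadjoint T x))\<^sup>2 = cmod (cinner (cadjoint T x) (cadjoint T x))"
    by (simp add: cinner_self norm_power)
  also have "\<dots> = cmod (cinner x (T (cadjoint T x)))" by (simp add: cadjoint'[OF assms])
  also have "\<dots> \<le> norm x * norm (T (cadjoint T x))" by (rule cmod_cinner_le)
  also have "\<dots> \<le> norm x * (norm T * norm (cadjoint T x))"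
    by (intro mult_left_mono norm_blinfun) auto
  finally show ?thesis using False by (simp add: power2_eq_square mult_ac)
qed simp

text \<open>The adjoint moves Y from the family onto the test vector, and
  \<open>norm_cadjoint_le\<close> makes the rescaled adjoint a contraction. With
  \<open>1 / 0 = 0\<close> the case Y = 0 gives the zero family. This is how a bounded right factor
  is absorbed in the Bessel characterisations of both norms.\<close>

lemma bessel_op:
  assumes Y: "clinear_op Y" and x: "bessel F x"
  shows "bessel F (\<lambda>i. (1 / norm Y) *\<^sub>R Y (x i))"
  unfolding bessel_def
proof (intro conjI allI)
  show "finite F" using x by (simp add: bessel_def)
  fix v
  define w where "w = (1 / norm Y) *\<^sub>R cadjoint Y v"
  have c: "cinner v ((1 / norm Y) *\<^sub>R Y u) = cinner w u" for u
    by (simp add: w_def cinner_scaleR_left cinner_scaleR_right cadjoint'[OF Y])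
  have "norm w \<le> norm v"
    using norm_cadjoint_le[OF Y, of v] by (cases "Y = 0") (auto simp: w_def divide_le_eq mult.commute)
  moreover have "(\<Sum>i\<in>F. (cmod (cinner w (x i)))\<^sup>2) \<le> (norm w)\<^sup>2" using x by (simp add: bessel_def)
  ultimately show "(\<Sum>i\<in>F. (cmod (cinner v ((1 / norm Y) *\<^sub>R Y (x i))))\<^sup>2) \<le> (norm v)\<^sup>2"
    unfolding c using power_mono[OF \<open>norm w \<le> norm v\<close> norm_ge_zero, of 2] by linarith
qed

lemma op_rescale: "Y x = norm Y *\<^sub>R ((1 / norm Y) *\<^sub>R Y x)" for Y :: "'a::real_normed_vector \<Rightarrow>\<^sub>L 'a"
  by (cases "Y = 0") auto

section \<open>Ideal properties by Bessel families\<close>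

lemma hilbert_schmidt_compose_left:
  assumes Y: "clinear_op Y" and T: "hilbert_schmidt T"
  shows "hilbert_schmidt (Y o\<^sub>L T)" "hs_norm (Y o\<^sub>L T) \<le> norm Y * hs_norm T"
proof -
  have b: "(\<Sum>i\<in>F. (norm ((Y o\<^sub>L T) (x i)))\<^sup>2) \<le> (norm Y * hs_norm T)\<^sup>2" if "bessel F x" for F :: "'a set" and x
  proof -
    have "(\<Sum>i\<in>F. (norm ((Y o\<^sub>L T) (x i)))\<^sup>2) \<le> (\<Sum>i\<in>F. (norm Y)\<^sup>2 * (norm (T (x i)))\<^sup>2)"
      unfolding power_mult_distrib[symmetric] by (intro sum_mono power_mono) (auto simp: norm_blinfun)
    also have "\<dots> \<le> (norm Y * hs_norm T)\<^sup>2"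
      unfolding sum_distrib_left[symmetric] power_mult_distrib
      by (intro mult_left_mono hs_bessel[OF T that]) auto
    finally show ?thesis .
  qed
  note * = hilbert_schmidtI[OF clinear_op_compose[OF Y hilbert_schmidt_clinear_op[OF T]]
      mult_nonneg_nonneg[OF norm_ge_zero hs_norm_nonneg] b]
  show "hilbert_schmidt (Y o\<^sub>L T)" "hs_norm (Y o\<^sub>L T) \<le> norm Y * hs_norm T" by (rule *; assumption)+
qed

lemma hilbert_schmidt_compose_right:
  assumes Y: "clinear_op Y" and T: "hilbert_schmidt T"
  shows "hilbert_schmidt (T o\<^sub>L Y)" "hs_norm (T o\<^sub>L Y) \<le> hs_norm T * norm Y"
proof -
  have b: "(\<Sum>i\<in>F. (norm ((T o\<^sub>L Y) (x i)))\<^sup>2) \<le> (hs_norm T * norm Y)\<^sup>2" if "bessel F x" for F :: "'a set" and x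
  proof -
    have "(norm ((T o\<^sub>L Y) (x i)))\<^sup>2 = (norm Y)\<^sup>2 * (norm (T ((1 / norm Y) *\<^sub>R Y (x i))))\<^sup>2" for i
      unfolding blinfun_apply_blinfun_compose
      by (subst op_rescale) (simp only: blinfun.scaleR_right norm_scaleR power_mult_distrib power2_abs)
    then have "(\<Sum>i\<in>F. (norm ((T o\<^sub>L Y) (x i)))\<^sup>2)
        = (norm Y)\<^sup>2 * (\<Sum>i\<in>F. (norm (T ((1 / norm Y) *\<^sub>R Y (x i))))\<^sup>2)"
      by (simp only: sum_distrib_left)
    also have "\<dots> \<le> (norm Y)\<^sup>2 * (hs_norm T)\<^sup>2"
      by (intro mult_left_mono hs_bessel[OF T bessel_op[OF Y that]]) auto
    finally show ?thesis by (simp add: power_mult_distrib mult.commute)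
  qed
  note * = hilbert_schmidtI[OF clinear_op_compose[OF hilbert_schmidt_clinear_op[OF T] Y]
      mult_nonneg_nonneg[OF hs_norm_nonneg norm_ge_zero] b]
  show "hilbert_schmidt (T o\<^sub>L Y)" "hs_norm (T o\<^sub>L Y) \<le> hs_norm T * norm Y" by (rule *; assumption)+
qed

lemma hilbert_schmidt_cadjoint:
  assumes T: "hilbert_schmidt T"
  shows "hilbert_schmidt (cadjoint T)" "hs_norm (cadjoint T) \<le> hs_norm T"
proof -
  note cT = hilbert_schmidt_clinear_op[OF T]
  have b: "(\<Sum>i\<in>F. (norm (cadjoint T (x i)))\<^sup>2) \<le> (hs_norm T)\<^sup>2" if "bessel F x" for F :: "'a set" and x
    by (rule hs_adjoint_bessel[OF cadjoint[OF cT] some_onb hs_bessel[OF T bessel_onb[OF some_onb]] that])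
  note * = hilbert_schmidtI[OF clinear_op_cadjoint[OF cT] hs_norm_nonneg b]
  show "hilbert_schmidt (cadjoint T)" "hs_norm (cadjoint T) \<le> hs_norm T" by (rule *; assumption)+
qed

text \<open>Y acts on the second Bessel family as its adjoint, so the sum for T reappears with a
  rescaled family.\<close>

lemma trace_class_compose_left:
  assumes Y: "clinear_op Y" and T: "trace_class T"
  shows "trace_class (Y o\<^sub>L T)" "trace_norm (Y o\<^sub>L T) \<le> norm Y * trace_norm T"
proof -
  have b: "(\<Sum>i\<in>F. cmod (cinner ((Y o\<^sub>L T) (x i)) (y i))) \<le> norm Y * trace_norm T"
    if x: "bessel F x" and y: "bessel F y" for F :: "'a set" and x y
  proof (cases "Y = 0")
    case False
    define Z where "Z = cadjoint Y"
    have Z: "clinear_op Z" unfolding Z_def by (rule clinear_op_cadjoint[OF Y])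
    have nZ: "norm Z \<le> norm Y" unfolding Z_def
      by (rule norm_blinfun_bound) (auto intro: norm_cadjoint_le[OF Y])
    have "cmod (cinner ((Y o\<^sub>L T) (x i)) (y i))
        = norm Z * cmod (cinner (T (x i)) ((1 / norm Z) *\<^sub>R Z (y i)))" for i
      unfolding blinfun_apply_blinfun_compose cadjoint[OF Y] Z_def[symmetric]
      by (subst op_rescale) (simp only: cinner_scaleR_right norm_mult norm_of_real abs_norm_cancel)
    then have "(\<Sum>i\<in>F. cmod (cinner ((Y o\<^sub>L T) (x i)) (y i)))
        = norm Z * (\<Sum>i\<in>F. cmod (cinner (T (x i)) ((1 / norm Z) *\<^sub>R Z (y i))))"
      by (simp only: sum_distrib_left)
    also have "\<dots> \<le> norm Y * trace_norm T"
      by (intro mult_mono trace_bessel[OF T x bessel_op[OF Z y]] nZ) (auto intro: sum_nonneg)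
    finally show ?thesis .
  qed simp
  note * = trace_classI[OF clinear_op_compose[OF Y trace_class_clinear_op[OF T]] b]
  show "trace_class (Y o\<^sub>L T)" "trace_norm (Y o\<^sub>L T) \<le> norm Y * trace_norm T" by (rule *; assumption)+
qed

lemma trace_class_compose_right:
  assumes Y: "clinear_op Y" and T: "trace_class T"
  shows "trace_class (T o\<^sub>L Y)" "trace_norm (T o\<^sub>L Y) \<le> trace_norm T * norm Y"
proof -
  have b: "(\<Sum>i\<in>F. cmod (cinner ((T o\<^sub>L Y) (x i)) (y i))) \<le> trace_norm T * norm Y"
    if x: "bessel F x" and y: "bessel F y" for F :: "'a set" and x y
  proof -
    have "cmod (cinner ((T o\<^sub>L Y) (x i)) (y i))
        = norm Y * cmod (cinner (T ((1 / norm Y) *\<^sub>R Y (x i))) (y i))" for i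
      unfolding blinfun_apply_blinfun_compose
      by (subst op_rescale)
        (simp only: blinfun.scaleR_right cinner_scaleR_left norm_mult norm_of_real abs_norm_cancel)
    then have "(\<Sum>i\<in>F. cmod (cinner ((T o\<^sub>L Y) (x i)) (y i)))
        = norm Y * (\<Sum>i\<in>F. cmod (cinner (T ((1 / norm Y) *\<^sub>R Y (x i))) (y i)))"
      by (simp only: sum_distrib_left)
    also have "\<dots> \<le> norm Y * trace_norm T"
      by (intro mult_left_mono trace_bessel[OF T bessel_op[OF Y x] y]) auto
    finally show ?thesis by (simp add: mult.commute)
  qed
  note * = trace_classI[OF clinear_op_compose[OF trace_class_clinear_op[OF T] Y] b]
  show "trace_class (T o\<^sub>L Y)" "trace_norm (T o\<^sub>L Y) \<le> trace_norm T * norm Y" by (rule *; assumption)+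
qed

lemma trace_class_cadjoint:
  assumes T: "trace_class T"
  shows "trace_class (cadjoint T)" "trace_norm (cadjoint T) \<le> trace_norm T"
proof -
  note cT = trace_class_clinear_op[OF T]
  have b: "(\<Sum>i\<in>F. cmod (cinner (cadjoint T (x i)) (y i))) \<le> trace_norm T"
    if x: "bessel F x" and y: "bessel F y" for F :: "'a set" and x y
  proof -
    have "cmod (cinner (cadjoint T u) v) = cmod (cinner (T v) u)" for u v
      by (subst cinner_commute) (simp add: cadjoint[OF cT])
    then show ?thesis using trace_bessel[OF T y x] by simp
  qed
  note * = trace_classI[OF clinear_op_cadjoint[OF cT] b]
  show "trace_class (cadjoint T)" "trace_norm (cadjoint T) \<le> trace_norm T" by (rule *; assumption)+
qed

text \<open>Cauchy-Schwarz twice: in the Hilbert space for each i, then for the sum over i.\<close>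

lemma sum_cmod_cinner_le:
  fixes u v :: "'i \<Rightarrow> 'a::complex_hilbert_space"
  assumes "(\<Sum>i\<in>F. (norm (u i))\<^sup>2) \<le> a\<^sup>2" "(\<Sum>i\<in>F. (norm (v i))\<^sup>2) \<le> b\<^sup>2" "0 \<le> a" "0 \<le> b"
  shows "(\<Sum>i\<in>F. cmod (cinner (u i) (v i))) \<le> a * b"
proof -
  have "(\<Sum>i\<in>F. cmod (cinner (u i) (v i))) \<le> (\<Sum>i\<in>F. \<bar>norm (u i)\<bar> * \<bar>norm (v i)\<bar>)"
    by (intro sum_mono) (simp add: cmod_cinner_le)
  also have "\<dots> \<le> L2_set (\<lambda>i. norm (u i)) F * L2_set (\<lambda>i. norm (v i)) F"
    by (rule L2_set_mult_ineq)
  also have "\<dots> \<le> a * b"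
    using assms by (intro mult_mono L2_set_nonneg) (auto simp: L2_set_def intro!: real_le_lsqrt sum_nonneg)
  finally show ?thesis .
qed

text \<open>The adjoint of S moves to the second family, which leaves two families with bounded sums
  of squares.\<close>

lemma trace_class_hilbert_schmidt_compose:
  assumes S: "hilbert_schmidt S" and T: "hilbert_schmidt T"
  shows "trace_class (S o\<^sub>L T)" "trace_norm (S o\<^sub>L T) \<le> hs_norm S * hs_norm T"
proof -
  note cS = hilbert_schmidt_clinear_op[OF S] and cT = hilbert_schmidt_clinear_op[OF T]
  have b: "(\<Sum>i\<in>F. cmod (cinner ((S o\<^sub>L T) (x i)) (y i))) \<le> hs_norm S * hs_norm T"
    if x: "bessel F x" and y: "bessel F y" for F :: "'a set" and x y
  proof -
    have "(\<Sum>i\<in>F. cmod (cinner (T (x i)) (cadjoint S (y i)))) \<le> hs_norm T * hs_norm S"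
    proof (rule sum_cmod_cinner_le[OF hs_bessel[OF T x]])
      show "(\<Sum>i\<in>F. (norm (cadjoint S (y i)))\<^sup>2) \<le> (hs_norm S)\<^sup>2"
        using hs_bessel[OF hilbert_schmidt_cadjoint(1)[OF S] y]
          power_mono[OF hilbert_schmidt_cadjoint(2)[OF S] hs_norm_nonneg, of 2] by linarith
    qed (rule hs_norm_nonneg)+
    then show ?thesis by (simp add: cadjoint[OF cS] mult.commute)
  qed
  note * = trace_classI[OF clinear_op_compose[OF cS cT] b]
  show "trace_class (S o\<^sub>L T)" "trace_norm (S o\<^sub>L T) \<le> hs_norm S * hs_norm T" by (rule *; assumption)+
qed

subsection \<open>The trace\<close>

lemma trace_summable:
  assumes T: "trace_class T"
  shows "(\<lambda>e. cmod (cinner (T e) e)) summable_on some_onb" "cmod (trace T) \<le> trace_norm T"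
proof -
  have b: "(\<Sum>e\<in>G. cmod (cinner (T e) e)) \<le> trace_norm T" if "finite G" "G \<subseteq> some_onb" for G
    using trace_bessel[OF T] bessel_onb[OF some_onb that] by blast
  note * = summable_on_bounded_partial[of some_onb "\<lambda>e. cmod (cinner (T e) e)", OF norm_ge_zero b]
  show s: "(\<lambda>e. cmod (cinner (T e) e)) summable_on some_onb" by (rule *(1))
  show "cmod (trace T) \<le> trace_norm T"
    unfolding trace_def using norm_infsum_bound[OF s] *(2) by linarith
qed

lemma trace_add: "trace_class S \<Longrightarrow> trace_class T \<Longrightarrow> trace (S + T) = trace S + trace T"
  unfolding trace_def blinfun.add_left cinner_add_left
  by (rule infsum_add[OF abs_summable_summable[OF trace_summable(1)] abs_summable_summable[OF trace_summable(1)]])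

lemma trace_scaleR: "trace (r *\<^sub>R T) = of_real r * trace T"
  unfolding trace_def blinfun.scaleR_left cinner_scaleR_left by (rule infsum_cmult_right')

lemma trace_uminus: "trace (- T) = - trace T"
  unfolding trace_def by (simp add: blinfun.minus_left cinner_minus_left infsum_uminus)

lemma trace_diff: "trace_class S \<Longrightarrow> trace_class T \<Longrightarrow> trace (S - T) = trace S - trace T"
  using trace_add[of S "(-1) *\<^sub>R T"] trace_class_scaleR(1)[of T "-1"] trace_uminus[of T] by simp

text \<open>In \<open>norm_diff_onb_sum\<close> the choice c e = <v, e> annihilates the last sum, so
  the squared error of a partial sum is the Parseval defect.\<close>

lemma onb_expansion:
  assumes E: "is_onb E"
  shows "((\<lambda>e. cinner v e *\<^sub>C e) has_sum v) E"
  unfolding has_sum_def tendsto_iff eventually_finite_subsets_at_top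
proof (intro allI impI)
  fix \<epsilon> :: real assume \<epsilon>: "0 < \<epsilon>"
  then have "0 < (\<epsilon>/2)\<^sup>2" by simp
  from onb_parseval_approx[OF E this, of v] obtain G where G: "G \<subseteq> E" "finite G"
    "\<And>G'. G \<subseteq> G' \<Longrightarrow> G' \<subseteq> E \<Longrightarrow> finite G' \<Longrightarrow>
      (norm v)\<^sup>2 \<le> (\<Sum>e\<in>G'. (cmod (cinner v e))\<^sup>2) + (\<epsilon>/2)\<^sup>2" by blast
  have "dist (\<Sum>e\<in>H. cinner v e *\<^sub>C e) v < \<epsilon>" if H: "finite H" "G \<subseteq> H" "H \<subseteq> E" for H
  proof -
    have "(norm (v - (\<Sum>e\<in>H. cinner v e *\<^sub>C e)))\<^sup>2 \<le> (\<epsilon>/2)\<^sup>2"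
      using G(3)[OF H(2,3,1)] by (subst norm_diff_onb_sum[OF H(1) is_onb_subset[OF E H(3)]]) auto
    then have "norm (v - (\<Sum>e\<in>H. cinner v e *\<^sub>C e)) \<le> \<epsilon>/2" by (rule power2_le_imp_le) (use \<epsilon> in simp)
    then show ?thesis using \<epsilon> by (simp add: dist_norm norm_minus_commute)
  qed
  then show "\<exists>X. finite X \<and> X \<subseteq> E \<and> (\<forall>Y. finite Y \<and> X \<subseteq> Y \<and> Y \<subseteq> E \<longrightarrow>
      dist (\<Sum>e\<in>Y. cinner v e *\<^sub>C e) v < \<epsilon>)"
    using G by (intro exI[of _ G]) blast
qed

lemma parseval:
  assumes E: "is_onb E"
  shows "((\<lambda>e. cinner v e * cinner e w) has_sum cinner v w) E"
  using has_sum_bounded_linear[OF bounded_linear_cinner_left onb_expansion[OF E]]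
  by (simp add: cinner_scaleC_left)

text \<open>Both traces are sums of <T e, f> <S f, e> over pairs of basis vectors, taken in the two
  orders. Absolute summability over pairs, from the two Hilbert-Schmidt norms, allows the
  exchange.\<close>

lemma trace_commute_hilbert_schmidt:
  assumes S: "hilbert_schmidt S" and T: "hilbert_schmidt T"
  shows "trace (S o\<^sub>L T) = trace (T o\<^sub>L S)"
proof -
  note cS = hilbert_schmidt_clinear_op[OF S] and cT = hilbert_schmidt_clinear_op[OF T]
  let ?E = "some_onb :: 'a set"
  define a where "a e f = cinner (T e) f * cinner (S f) e" for e f
  have le: "cmod (a e f) \<le> (cmod (cinner (T e) f))\<^sup>2 + (cmod (cinner (S f) e))\<^sup>2" for e f
    using sum_squares_bound[of "cmod (cinner (T e) f)" "cmod (cinner (S f) e)"]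
      mult_nonneg_nonneg[OF norm_ge_zero[of "cinner (T e) f"] norm_ge_zero[of "cinner (S f) e"]]
    unfolding a_def norm_mult by linarith
  have bd: "(\<Sum>e\<in>G. \<Sum>f\<in>H. (cmod (cinner (T e) f))\<^sup>2) \<le> (hs_norm T)\<^sup>2"
    if G: "finite G" "G \<subseteq> ?E" and H: "finite H" "H \<subseteq> ?E" and T: "hilbert_schmidt T" for G H T
  proof -
    have "(\<Sum>e\<in>G. \<Sum>f\<in>H. (cmod (cinner (T e) f))\<^sup>2) \<le> (\<Sum>e\<in>G. (norm (T e))\<^sup>2)"
      using bessel_onb[OF some_onb H] by (intro sum_mono) (auto simp: bessel_def)
    also have "\<dots> \<le> (hs_norm T)\<^sup>2" by (rule hs_bessel[OF T bessel_onb[OF some_onb G]])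
    finally show ?thesis .
  qed
  have "(\<lambda>(e, f). cmod (a e f)) summable_on ?E \<times> ?E"
  proof (rule summable_on_bounded_partial(1))
    fix D assume D: "finite D" "D \<subseteq> ?E \<times> ?E"
    \<comment> \<open>Enlarging a finite set of pairs to a rectangle gives iterated sums, where
      Bessel's inequality applies in one index and \<open>hs_bessel\<close> in the other.\<close>
    define G H where "G = fst ` D" and "H = snd ` D"
    have G: "finite G" "G \<subseteq> ?E" and H: "finite H" "H \<subseteq> ?E" and DGH: "D \<subseteq> G \<times> H"
      using D by (auto simp: G_def H_def subset_fst_snd)
    have "(\<Sum>(e, f)\<in>D. cmod (a e f)) \<le> (\<Sum>(e, f)\<in>G \<times> H. cmod (a e f))"
      using G H DGH by (intro sum_mono2) auto
    also have "\<dots> = (\<Sum>e\<in>G. \<Sum>f\<in>H. cmod (a e f))" by (simp add: sum.cartesian_product)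
    also have "\<dots> \<le> (\<Sum>e\<in>G. \<Sum>f\<in>H. (cmod (cinner (T e) f))\<^sup>2 + (cmod (cinner (S f) e))\<^sup>2)"
      by (intro sum_mono le)
    also have "\<dots> = (\<Sum>e\<in>G. \<Sum>f\<in>H. (cmod (cinner (T e) f))\<^sup>2) + (\<Sum>f\<in>H. \<Sum>e\<in>G. (cmod (cinner (S f) e))\<^sup>2)"
      by (simp add: sum.distrib sum.swap[of _ G H])
    also have "\<dots> \<le> (hs_norm T)\<^sup>2 + (hs_norm S)\<^sup>2"
      by (intro add_mono bd G H S T)
    finally show "(\<Sum>(e, f)\<in>D. cmod (a e f)) \<le> (hs_norm T)\<^sup>2 + (hs_norm S)\<^sup>2" .
  qed auto
  then have "(\<lambda>(e, f). a e f) summable_on ?E \<times> ?E"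
    by - (rule abs_summable_summable, simp add: case_prod_unfold)
  then have sw: "(\<Sum>\<^sub>\<infinity>e\<in>?E. \<Sum>\<^sub>\<infinity>f\<in>?E. a e f) = (\<Sum>\<^sub>\<infinity>f\<in>?E. \<Sum>\<^sub>\<infinity>e\<in>?E. a e f)"
    by (rule infsum_swap_banach)
  have "(\<Sum>\<^sub>\<infinity>f\<in>?E. a e f) = cinner (S (T e)) e" for e
    using infsumI[OF parseval[OF some_onb, of "T e" "cadjoint S e"]]
    by (simp add: a_def cadjoint[OF cS])
  moreover have "(\<Sum>\<^sub>\<infinity>e\<in>?E. a e f) = cinner (T (S f)) f" for f
    using infsumI[OF parseval[OF some_onb, of "S f" "cadjoint T f"]]
    by (simp add: a_def cadjoint[OF cT] mult.commute)
  ultimately show ?thesis using sw by (simp only: trace_def blinfun_apply_blinfun_compose)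
qed

subsection \<open>Cyclicity of the trace\<close>

text \<open>\<open>ex_sqrt\<close> yields a root that commutes with everything commuting with
  \<open>cadjoint T o\<^sub>L T\<close>; uniqueness of positive roots identifies it with
  \<open>abs_op T\<close>.\<close>

lemma abs_op_commute:
  assumes T: "clinear_op T" and C: "C o\<^sub>L (cadjoint T o\<^sub>L T) = (cadjoint T o\<^sub>L T) o\<^sub>L C"
  shows "C o\<^sub>L abs_op T = abs_op T o\<^sub>L C"
proof -
  have "positive_op (cadjoint T o\<^sub>L T)"
    unfolding positive_op_iff
    by (auto simp: cadjoint'[OF T] cadjoint[OF T, symmetric] cinner_self simp flip: Re_cinner)
  then obtain R where R: "positive_op R" "R o\<^sub>L R = cadjoint T o\<^sub>L T"
    "\<And>C. C o\<^sub>L (cadjoint T o\<^sub>L T) = (cadjoint T o\<^sub>L T) o\<^sub>L C \<Longrightarrow> C o\<^sub>L R = R o\<^sub>L C"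
    using ex_sqrt by blast
  have "abs_op T = R"
    using positive_sqrt_unique[OF abs_op(1)[OF T] R(1)] abs_op(2)[OF T] R(2) by metis
  then show ?thesis using R(3)[OF C] by simp
qed

text \<open>With |T| = S S and a polar decomposition T = V |T|, V commuting with S, the form <T x,
  x> would be <V S x, S x>, at most the squared norm of S x. The resolvent g = (|T| + \<delta>)^-1
  replaces V by the contraction T g, at the cost of an error \<delta> <T g x, x>.\<close>

lemma self_adjoint_le_abs_op:
  fixes T :: "'a::complex_hilbert_space \<Rightarrow>\<^sub>L 'a"
  assumes sa: "\<And>x y. cinner (T x) y = cinner x (T y)"
  shows "\<bar>inner (T x) x\<bar> \<le> inner (abs_op T x) x"
proof (rule field_le_epsilon)
  fix \<epsilon> :: real assume \<epsilon>: "0 < \<epsilon>"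
  define \<delta> where "\<delta> = \<epsilon> / ((norm x)\<^sup>2 + 1)"
  have \<delta>: "0 < \<delta>" "\<delta> * (norm x)\<^sup>2 \<le> \<epsilon>"
    using \<epsilon> by (auto simp: \<delta>_def field_simps add_pos_nonneg)
  have T: "clinear_op T" by (rule self_adjoint_clinear_op[OF sa])
  have aT: "cadjoint T = T" by (rule cadjoint_eqI[OF sa])
  let ?R = "abs_op T"
  note R = abs_op(1)[OF T]
  have TR: "T (?R y) = ?R (T y)" for y
  proof -
    have "T o\<^sub>L ?R = ?R o\<^sub>L T"
      by (rule abs_op_commute[OF T]) (auto simp: aT intro!: blinfun_eqI)
    then show ?thesis by (metis blinfun_apply_blinfun_compose)
  qed
  obtain S where S: "positive_op S" "S o\<^sub>L S = ?R" "\<And>C. C o\<^sub>L ?R = ?R o\<^sub>L C \<Longrightarrow> C o\<^sub>L S = S o\<^sub>L C"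
    using ex_sqrt[OF R] by blast
  have RS: "?R z = S (S z)" for z using S(2) by (metis blinfun_apply_blinfun_compose)
  have TS: "T (S y) = S (T y)" for y
  proof -
    have "T o\<^sub>L S = S o\<^sub>L T" by (rule S(3)) (auto intro!: blinfun_eqI simp: TR)
    then show ?thesis by (metis blinfun_apply_blinfun_compose)
  qed
  obtain g where g: "\<And>x. ?R (g x) + \<delta> *\<^sub>R g x = x" "\<And>x y. cinner (g x) y = cinner x (g y)"
    "\<And>x. g (?R x) = ?R (g x)" "\<And>x. norm (?R (g x)) \<le> norm x"
    using positive_resolvent[OF R \<delta>(1)] by blast
  \<comment> \<open>\<open>positive_resolvent\<close> gives g as a bare function; its linearity
    follows from its symmetry.\<close>
  have gadd: "g (a + b) = g a + g b" and gR: "g (r *\<^sub>R a) = r *\<^sub>R g a" for a b r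
    by (rule cinner_eqI, simp add: g(2) cinner_add_left cinner_scaleR_left)+
  have inj: "g (?R y) + \<delta> *\<^sub>R g y = y" for y using g(1)[of y] by (simp add: g(3))
  \<comment> \<open>S commutes with |T| + \<delta>, hence with its inverse g; \<open>inj\<close>
    says that g is also a left inverse.\<close>
  have gS: "g (S y) = S (g y)" for y
  proof -
    have "g (S y) = g (S (?R (g y) + \<delta> *\<^sub>R g y))" by (simp only: g(1))
    also have "\<dots> = g (?R (S (g y)) + \<delta> *\<^sub>R S (g y))" by (simp add: RS blinfun.bilinear_simps)
    also have "\<dots> = S (g y)" by (simp only: gadd gR inj)
    finally show ?thesis .
  qed
  have nT: "norm (T z) = norm (?R z)" for z by (rule norm_abs_op[OF T])
  have "T x = T (?R (g x)) + \<delta> *\<^sub>R T (g x)"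
    by (subst (1) g(1)[symmetric]) (simp only: blinfun.bilinear_simps)
  then have "inner (T x) x = inner (T (?R (g x))) x + \<delta> * inner (T (g x)) x"
    by (simp add: inner_add_left)
  also have "inner (T (?R (g x))) x = inner (T (g (S x))) (S x)"
    by (simp add: RS TS gS positive_op_symR[OF S(1), symmetric])
  finally have eq: "inner (T x) x = inner (T (g (S x))) (S x) + \<delta> * inner (T (g x)) x" .
  have "\<bar>inner (T (g y)) y\<bar> \<le> (norm y)\<^sup>2" for y
  proof -
    \<comment> \<open>T (g y) has the same norm as |T| (g y), which is at most the norm of
      y.\<close>
    have "\<bar>inner (T (g y)) y\<bar> \<le> norm (T (g y)) * norm y" by (rule Cauchy_Schwarz_ineq2)
    also have "\<dots> \<le> norm y * norm y" using g(4)[of y] by (intro mult_right_mono) (auto simp: nT)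
    finally show ?thesis by (simp add: power2_eq_square)
  qed
  note b = this[of x] this[of "S x"]
  have "\<bar>inner (T x) x\<bar> \<le> (norm (S x))\<^sup>2 + \<delta> * (norm x)\<^sup>2"
    unfolding eq using b \<delta>(1) mult_left_mono[OF b(1), of \<delta>]
    by (intro order_trans[OF abs_triangle_ineq] add_mono) (auto simp: abs_mult)
  also have "(norm (S x))\<^sup>2 = inner (?R x) x"
    by (simp add: power2_norm_eq_inner RS positive_op_symR[OF S(1)])
  finally show "\<bar>inner (T x) x\<bar> \<le> inner (?R x) x + \<epsilon>" using \<delta>(2) by linarith
qed

text \<open>For the square root S of P the squared norm of S e is <P e, e>, so the trace norm of P
  bounds the Hilbert-Schmidt sums of S.\<close>

lemma positive_trace_class_sqrt:
  assumes P: "positive_op P" and t: "trace_class P"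
  obtains S where "positive_op S" "hilbert_schmidt S" "S o\<^sub>L S = P"
proof -
  obtain S where S: "positive_op S" "S o\<^sub>L S = P" using ex_sqrt[OF P] by blast
  have PS: "P z = S (S z)" for z using S(2) by (metis blinfun_apply_blinfun_compose)
  have "(\<Sum>e\<in>G. (norm (S e))\<^sup>2) \<le> trace_norm P" if "bessel G (\<lambda>e. e)" for G
  proof -
    have "(\<Sum>e\<in>G. (norm (S e))\<^sup>2) = (\<Sum>e\<in>G. cmod (cinner (P e) e))"
      by (intro sum.cong) (simp_all add: PS positive_op_sym[OF S(1)] cinner_self norm_power)
    also have "\<dots> \<le> trace_norm P" by (rule trace_bessel[OF t that that])
    finally show ?thesis .
  qed
  then have "(\<lambda>e. (norm (S e))\<^sup>2) summable_on some_onb"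
    using bessel_onb[OF some_onb] by (intro summable_on_bounded_partial(1)) auto
  then have "hilbert_schmidt S"
    unfolding hilbert_schmidt_def using some_onb positive_op_clinear_op[OF S(1)] by blast
  then show ?thesis using that S by blast
qed

text \<open>S and U are the roots of the positive and negative parts (|T| + T) / 2 and (|T| - T) /
  2, whose positivity is \<open>self_adjoint_le_abs_op\<close>. Such differences of squares serve
  both for cyclicity of the trace and for finite rank approximation.\<close>

lemma self_adjoint_trace_class_decomposition:
  fixes T :: "'a::complex_hilbert_space \<Rightarrow>\<^sub>L 'a"
  assumes sa: "\<And>x y. cinner (T x) y = cinner x (T y)" and t: "trace_class T"
  obtains S U where "positive_op S" "hilbert_schmidt S" "positive_op U" "hilbert_schmidt U"
    "T = (S o\<^sub>L S) - (U o\<^sub>L U)"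
proof -
  let ?R = "abs_op T"
  note T = trace_class_clinear_op[OF t]
  note R = abs_op(1)[OF T]
  \<comment> \<open>Apart from linearity, \<open>trace_class\<close> speaks of T only through
    \<open>abs_op T\<close>, so this equality transfers it to \<open>abs_op T\<close>.\<close>
  have "abs_op ?R = ?R"
  proof (rule positive_sqrt_unique[OF _ R])
    have cR: "clinear_op ?R" by (rule positive_op_clinear_op[OF R])
    show "positive_op (abs_op ?R)" by (rule abs_op(1)[OF cR])
    show "abs_op ?R o\<^sub>L abs_op ?R = ?R o\<^sub>L ?R" using abs_op(2)[OF cR] R by (simp add: positive_op_def)
  qed
  then have tR: "trace_class ?R"
    using t positive_op_clinear_op[OF R] by (simp add: trace_class_def)
  define P N where "P = (1/2) *\<^sub>R (?R + T)" and "N = (1/2) *\<^sub>R (?R + (-1) *\<^sub>R T)"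
  have le: "\<bar>inner (T x) x\<bar> \<le> inner (?R x) x" for x by (rule self_adjoint_le_abs_op[OF sa])
  have nn: "0 \<le> inner (?R x) x + inner (T x) x" "0 \<le> inner (?R x) x - inner (T x) x" for x
    using le[of x] by linarith+
  have "positive_op P" "positive_op N"
    unfolding P_def N_def
    using nn by (auto simp: cinner_scaleR_left cinner_scaleR_right positive_op_iff blinfun.bilinear_simps cinner_add_left
        cinner_add_right cinner_minus_left cinner_minus_right cinner_diff_left cinner_diff_right
        sa positive_op_sym[OF R] inner_add_left inner_diff_left)
  moreover have "trace_class P" "trace_class N"
    unfolding P_def N_def by (intro trace_class_add trace_class_scaleR t tR)+
  ultimately obtain S U where SU: "positive_op S" "hilbert_schmidt S" "S o\<^sub>L S = P"
    "positive_op U" "hilbert_schmidt U" "U o\<^sub>L U = N"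
    by (metis positive_trace_class_sqrt)
  have "T = P - N" by (rule blinfun_eqI) (simp add: P_def N_def blinfun.bilinear_simps field_simps flip: scaleR_add_left)
  then show ?thesis using that SU by metis
qed

text \<open>The operators form a real vector space here, so multiplication by i enters operator
  products as an operator of its own.\<close>

definition imag_op :: "'a::complex_hilbert_space \<Rightarrow>\<^sub>L 'a" where
  "imag_op = Blinfun (\<lambda>x. \<i> *\<^sub>C x)"

lemma imag_op_apply: "imag_op x = \<i> *\<^sub>C x"
  by (simp add: imag_op_def bounded_linear_Blinfun_apply bounded_linear_scaleC)

lemma clinear_op_imag_op: "clinear_op imag_op"
  by (simp add: clinear_op_def imag_op_apply scaleC_scaleC mult.commute)

lemma trace_imag_op: "trace (imag_op o\<^sub>L T) = \<i> * trace T"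
  by (simp add: trace_def imag_op_apply cinner_scaleC_left infsum_cmult_right')

lemma blinfun_compose_assoc: "(A o\<^sub>L B) o\<^sub>L C = A o\<^sub>L (B o\<^sub>L C)"
  by (rule blinfun_eqI) simp

lemma blinfun_compose_simps:
  "(A + B) o\<^sub>L C = (A o\<^sub>L C) + (B o\<^sub>L C)" "C o\<^sub>L (A + B) = (C o\<^sub>L A) + (C o\<^sub>L B)"
  "(A - B) o\<^sub>L C = (A o\<^sub>L C) - (B o\<^sub>L C)" "C o\<^sub>L (A - B) = (C o\<^sub>L A) - (C o\<^sub>L B)"
  "(- A) o\<^sub>L C = - (A o\<^sub>L C)" "C o\<^sub>L (- A) = - (C o\<^sub>L A)"
  "(r *\<^sub>R A) o\<^sub>L C = r *\<^sub>R (A o\<^sub>L C)" "C o\<^sub>L (r *\<^sub>R A) = r *\<^sub>R (C o\<^sub>L A)"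
  "0 o\<^sub>L C = 0" "C o\<^sub>L 0 = 0"
  for A B C :: "'a::real_normed_vector \<Rightarrow>\<^sub>L 'a"
  by (auto intro!: blinfun_eqI simp: blinfun.bilinear_simps)

text \<open>For T = S S one Hilbert-Schmidt factor is moved at a time: S (S Y), (S Y) S = S (Y S)
  and (Y S) S have the same trace.\<close>

lemma trace_commute_self_adjoint:
  fixes T Y :: "'a::complex_hilbert_space \<Rightarrow>\<^sub>L 'a"
  assumes sa: "\<And>x y. cinner (T x) y = cinner x (T y)" and t: "trace_class T" and Y: "clinear_op Y"
  shows "trace (T o\<^sub>L Y) = trace (Y o\<^sub>L T)"
proof -
  obtain S U where S: "hilbert_schmidt S" and U: "hilbert_schmidt U" and T: "T = (S o\<^sub>L S) - (U o\<^sub>L U)"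
    using self_adjoint_trace_class_decomposition[OF sa t] by metis
  have c: "trace ((S o\<^sub>L S) o\<^sub>L Y) = trace (Y o\<^sub>L (S o\<^sub>L S))"
    and t: "trace_class ((S o\<^sub>L S) o\<^sub>L Y)" "trace_class (Y o\<^sub>L (S o\<^sub>L S))" if S: "hilbert_schmidt S" for S
  proof -
    note SY = hilbert_schmidt_compose_right(1)[OF Y S] and YS = hilbert_schmidt_compose_left(1)[OF Y S]
    have "trace (S o\<^sub>L (S o\<^sub>L Y)) = trace (S o\<^sub>L (Y o\<^sub>L S))"
      unfolding trace_commute_hilbert_schmidt[OF S SY] by (simp add: blinfun_compose_assoc)
    also have "\<dots> = trace ((Y o\<^sub>L S) o\<^sub>L S)" by (rule trace_commute_hilbert_schmidt[OF S YS])
    finally show "trace ((S o\<^sub>L S) o\<^sub>L Y) = trace (Y o\<^sub>L (S o\<^sub>L S))" by (simp add: blinfun_compose_assoc)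
    note tS = trace_class_hilbert_schmidt_compose(1)[OF S S]
    show "trace_class ((S o\<^sub>L S) o\<^sub>L Y)" "trace_class (Y o\<^sub>L (S o\<^sub>L S))"
      by (rule trace_class_compose_right(1)[OF Y tS], rule trace_class_compose_left(1)[OF Y tS])
  qed
  show ?thesis unfolding T blinfun_compose_simps
    using c[OF S] c[OF U] t[OF S] t[OF U] by (simp add: trace_diff)
qed

text \<open>Real and imaginary parts reduce this to the self-adjoint case; i leaves the trace by
  \<open>trace_imag_op\<close> and passes Y because Y is complex linear.\<close>

lemma trace_commute:
  fixes T Y :: "'a::complex_hilbert_space \<Rightarrow>\<^sub>L 'a"
  assumes t: "trace_class T" and Y: "clinear_op Y"
  shows "trace (T o\<^sub>L Y) = trace (Y o\<^sub>L T)"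
proof -
  note T = trace_class_clinear_op[OF t]
  note tL = trace_class_compose_left(1) and tR = trace_class_compose_right(1)
  \<comment> \<open>With T' the adjoint of T, B is i (T - T') / 2: the factor i makes the skew part
    self-adjoint, and T = A - i B.\<close>
  define A B where "A = (1/2) *\<^sub>R (T + cadjoint T)"
    and "B = imag_op o\<^sub>L ((1/2) *\<^sub>R (T + (-1) *\<^sub>R cadjoint T))"
  have tA: "trace_class A" unfolding A_def
    by (intro trace_class_scaleR trace_class_add t trace_class_cadjoint)
  have tB: "trace_class B" unfolding B_def
    by (intro tL clinear_op_imag_op trace_class_scaleR trace_class_add t trace_class_cadjoint)
  have A: "trace (A o\<^sub>L Y) = trace (Y o\<^sub>L A)"
    by (rule trace_commute_self_adjoint[OF _ tA Y])
      (simp add: A_def blinfun.bilinear_simps cinner_scaleR_left cinner_scaleR_right cinner_add_left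
        cinner_add_right cadjoint[OF T] cadjoint'[OF T])
  have B: "trace (B o\<^sub>L Y) = trace (Y o\<^sub>L B)"
    by (rule trace_commute_self_adjoint[OF _ tB Y])
      (simp add: B_def blinfun.bilinear_simps imag_op_apply cinner_scaleC_left cinner_scaleC_right
        cinner_scaleR_left cinner_scaleR_right cinner_diff_left cinner_diff_right cadjoint[OF T] cadjoint'[OF T]
        algebra_simps)
  have half: "x = (1/2) *\<^sub>R (x + y) - (1/2) *\<^sub>R (y - x)" for x y :: 'a
    by (simp add: scaleR_2 flip: scaleR_diff_right)
  have eq: "T = A - (imag_op o\<^sub>L B)"
    by (rule blinfun_eqI)
      (simp add: A_def B_def blinfun.bilinear_simps imag_op_apply scaleC_scaleC scaleC_minus_right flip: half)
  have "trace (T o\<^sub>L Y) = trace (A o\<^sub>L Y) - trace (imag_op o\<^sub>L (B o\<^sub>L Y))"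
    unfolding eq blinfun_compose_simps blinfun_compose_assoc
    by (intro trace_diff tL tR clinear_op_imag_op Y tA tB)
  also have "\<dots> = trace (Y o\<^sub>L A) - trace (imag_op o\<^sub>L (Y o\<^sub>L B))"
    by (simp add: A B trace_imag_op)
  also have "imag_op o\<^sub>L (Y o\<^sub>L B) = Y o\<^sub>L (imag_op o\<^sub>L B)"
    using Y by (intro blinfun_eqI) (simp add: imag_op_apply clinear_op_def)
  also have "trace (Y o\<^sub>L A) - trace (Y o\<^sub>L (imag_op o\<^sub>L B)) = trace (Y o\<^sub>L T)"
    unfolding eq blinfun_compose_simps by (intro trace_diff[symmetric] tL clinear_op_imag_op Y tA tB)
  finally show ?thesis .
qed

section \<open>Restricted operators\<close>

text \<open>\<open>ures\<close> is closed under commutators but not under products. The block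
  estimates therefore live in this associative algebra, and skew-adjointness is added only at the
  end.\<close>

definition restricted_op :: "('h::polarized_hilbert_space \<Rightarrow>\<^sub>L 'h) \<Rightarrow> bool" where
  "restricted_op T \<longleftrightarrow> clinear_op T \<and> hilbert_schmidt (block proj_plus proj_minus T) \<and>
    hilbert_schmidt (block proj_minus proj_plus T)"

definition restricted_norm :: "('h::polarized_hilbert_space \<Rightarrow>\<^sub>L 'h) \<Rightarrow> real" where
  "restricted_norm T = norm T + hs_norm (block proj_plus proj_minus T) + hs_norm (block proj_minus proj_plus T)"

text \<open>The predual before skew-adjointness is imposed: a two-sided ideal of the restricted
  operators whose elements need not be trace class as a whole.\<close>

definition restricted_trace_class :: "('h::polarized_hilbert_space \<Rightarrow>\<^sub>L 'h) \<Rightarrow> bool" where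
  "restricted_trace_class T \<longleftrightarrow> restricted_op T \<and> trace_class (block proj_plus proj_plus T) \<and>
    trace_class (block proj_minus proj_minus T)"

definition restricted_trace_norm :: "('h::polarized_hilbert_space \<Rightarrow>\<^sub>L 'h) \<Rightarrow> real" where
  "restricted_trace_norm T = trace_norm (block proj_plus proj_plus T) + trace_norm (block proj_minus proj_minus T)
    + hs_norm (block proj_plus proj_minus T) + hs_norm (block proj_minus proj_plus T)"

lemma ures_restricted: "a \<in> ures \<longleftrightarrow> restricted_op a \<and> (\<forall>x y. cinner (a x) y = - cinner x (a y))"
  by (auto simp: ures_iff restricted_op_def)

lemma ures_restricted_op: "A \<in> ures \<Longrightarrow> restricted_op A"
  by (simp add: ures_restricted)

lemma ures_skew: "A \<in> ures \<Longrightarrow> cinner (A x) y = - cinner x (A y)"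
  by (simp add: ures_restricted)

lemma restricted_op_clinear: "restricted_op T \<Longrightarrow> clinear_op T"
  by (simp add: restricted_op_def)

lemma restricted_trace_class_op_of: "restricted_trace_class (op_of \<rho>)"
  using op_of_props[of \<rho>] by (simp add: restricted_trace_class_def restricted_op_def)

lemma norm_eq_restricted_trace_norm: "norm \<rho> = restricted_trace_norm (op_of \<rho>)"
  by (simp add: norm_ures_predual_def restricted_trace_norm_def)

lemma restricted_norm_nonneg: "0 \<le> restricted_norm T"
  by (simp add: restricted_norm_def hs_norm_nonneg)

lemma op_of_Abs_restricted:
  assumes "restricted_trace_class T" "\<And>x y. cinner (T x) y = - cinner x (T y)"
  shows "op_of (Abs_ures_predual T) = T"
  by (rule op_of_Abs) (use assms in \<open>auto simp: restricted_trace_class_def restricted_op_def\<close>)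

section \<open>Two by two block matrices and the ideal property\<close>

lemma block_compose:
  "block p q (A o\<^sub>L B) = (block p proj_plus A o\<^sub>L block proj_plus q B) + (block p proj_minus A o\<^sub>L block proj_minus q B)"
proof (rule blinfun_eqI)
  fix x
  have "A (B (q x)) = A (proj_plus (B (q x)) + proj_minus (B (q x)))" by (simp only: proj_plus_add_proj_minus)
  then show "block p q (A o\<^sub>L B) x
      = ((block p proj_plus A o\<^sub>L block proj_plus q B) + (block p proj_minus A o\<^sub>L block proj_minus q B)) x"
    by (simp add: block_apply blinfun.bilinear_simps proj_idem)
qed

lemma norm_block_le:
  assumes p: "is_projection p" and q: "is_projection q"
  shows "norm (block p q T) \<le> norm T"
proof (rule norm_blinfun_bound)
  fix x
  have "norm (block p q T x) \<le> norm (T (q x))" unfolding block_apply by (rule is_projection_norm_le[OF p])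
  also have "\<dots> \<le> norm T * norm (q x)" by (rule norm_blinfun)
  also have "\<dots> \<le> norm T * norm x" by (intro mult_left_mono is_projection_norm_le[OF q]) simp
  finally show "norm (block p q T x) \<le> norm T * norm x" .
qed simp

lemma hs_norm_compose_block_right:
  assumes Y: "clinear_op Y" and p: "is_projection p" and q: "is_projection q" and T: "hilbert_schmidt T"
  shows "hilbert_schmidt (T o\<^sub>L block p q Y)" "hs_norm (T o\<^sub>L block p q Y) \<le> hs_norm T * norm Y"
  using hilbert_schmidt_compose_right[OF clinear_op_block[OF p q Y] T]
    mult_left_mono[OF norm_block_le[OF p q, of Y] hs_norm_nonneg[of T]] by linarith+

lemma hs_norm_compose_block_left:
  assumes Y: "clinear_op Y" and p: "is_projection p" and q: "is_projection q" and T: "hilbert_schmidt T"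
  shows "hilbert_schmidt (block p q Y o\<^sub>L T)" "hs_norm (block p q Y o\<^sub>L T) \<le> norm Y * hs_norm T"
  using hilbert_schmidt_compose_left[OF clinear_op_block[OF p q Y] T]
    mult_right_mono[OF norm_block_le[OF p q, of Y] hs_norm_nonneg[of T]] by linarith+

lemma trace_norm_compose_block_right:
  assumes Y: "clinear_op Y" and p: "is_projection p" and q: "is_projection q" and T: "trace_class T"
  shows "trace_class (T o\<^sub>L block p q Y)" "trace_norm (T o\<^sub>L block p q Y) \<le> trace_norm T * norm Y"
  using trace_class_compose_right[OF clinear_op_block[OF p q Y] T]
    mult_left_mono[OF norm_block_le[OF p q] trace_norm_nonneg[OF trace_class_clinear_op[OF T]], of Y] by linarith+

lemma trace_norm_compose_block_left:
  assumes Y: "clinear_op Y" and p: "is_projection p" and q: "is_projection q" and T: "trace_class T"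
  shows "trace_class (block p q Y o\<^sub>L T)" "trace_norm (block p q Y o\<^sub>L T) \<le> norm Y * trace_norm T"
  using trace_class_compose_left[OF clinear_op_block[OF p q Y] T]
    mult_right_mono[OF norm_block_le[OF p q] trace_norm_nonneg[OF trace_class_clinear_op[OF T]], of Y] by linarith+

text \<open>The trace norm dominates the operator norm, so this is the bounded ideal property in a
  form that fits products of block norms.\<close>

lemma hs_compose_trace_class:
  assumes T: "trace_class T" and Y: "hilbert_schmidt Y"
  shows "hilbert_schmidt (T o\<^sub>L Y)" "hs_norm (T o\<^sub>L Y) \<le> trace_norm T * hs_norm Y"
    "hilbert_schmidt (Y o\<^sub>L T)" "hs_norm (Y o\<^sub>L T) \<le> hs_norm Y * trace_norm T"
  using hilbert_schmidt_compose_left[OF trace_class_clinear_op[OF T] Y]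
    hilbert_schmidt_compose_right[OF trace_class_clinear_op[OF T] Y]
    mult_right_mono[OF norm_le_trace_norm[OF T] hs_norm_nonneg, of Y]
    mult_left_mono[OF norm_le_trace_norm[OF T] hs_norm_nonneg, of Y] by linarith+

lemma hilbert_schmidt_add_le:
  assumes "hilbert_schmidt S" "hs_norm S \<le> a" "hilbert_schmidt T" "hs_norm T \<le> b"
  shows "hilbert_schmidt (S + T)" "hs_norm (S + T) \<le> a + b"
  using hilbert_schmidt_add[OF assms(1,3)] assms(2,4) by linarith+

lemma trace_class_add_le:
  assumes "trace_class S" "trace_norm S \<le> a" "trace_class T" "trace_norm T \<le> b"
  shows "trace_class (S + T)" "trace_norm (S + T) \<le> a + b"
  using trace_class_add[OF assms(1,3)] assms(2,4) by linarith+

lemma restricted_op_compose: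
  assumes "restricted_op S" "restricted_op T"
  shows "restricted_op (S o\<^sub>L T)"
proof -
  note pr = is_projection_proj
  have S: "clinear_op S" "hilbert_schmidt (block proj_plus proj_minus S)" "hilbert_schmidt (block proj_minus proj_plus S)"
    and T: "clinear_op T" "hilbert_schmidt (block proj_plus proj_minus T)" "hilbert_schmidt (block proj_minus proj_plus T)"
    using assms by (auto simp: restricted_op_def)
  show ?thesis unfolding restricted_op_def block_compose
    by (intro conjI clinear_op_compose hilbert_schmidt_add(1) S(1) T(1)
        hs_norm_compose_block_left(1)[OF S(1)] hs_norm_compose_block_right(1)[OF T(1)] pr S(2,3) T(2,3))
qed

text \<open>In the block matrix product a diagonal entry is trace class times bounded plus
  Hilbert-Schmidt times Hilbert-Schmidt; an off-diagonal entry is trace class times Hilbert-Schmidt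
  plus Hilbert-Schmidt times bounded. Each product has its ideal estimate.\<close>

lemma restricted_trace_class_compose_right:
  fixes X Y :: "'h::polarized_hilbert_space \<Rightarrow>\<^sub>L 'h"
  assumes X: "restricted_trace_class X" and Y: "restricted_op Y"
  shows "restricted_trace_class (X o\<^sub>L Y)"
    "restricted_trace_norm (X o\<^sub>L Y) \<le> restricted_trace_norm X * restricted_norm Y"
proof -
  note pr = is_projection_proj
  have oX: "restricted_op X" and
    x: "trace_class (block proj_plus proj_plus X)" "trace_class (block proj_minus proj_minus X)"
      "hilbert_schmidt (block proj_plus proj_minus X)" "hilbert_schmidt (block proj_minus proj_plus X)"
    using X by (auto simp: restricted_trace_class_def restricted_op_def)
  have y: "clinear_op Y" "hilbert_schmidt (block proj_plus proj_minus Y)" "hilbert_schmidt (block proj_minus proj_plus Y)"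
    using Y by (auto simp: restricted_op_def)
  let ?a = "trace_norm (block proj_plus proj_plus X)" and ?b = "trace_norm (block proj_minus proj_minus X)"
    and ?c = "hs_norm (block proj_plus proj_minus X)" and ?d = "hs_norm (block proj_minus proj_plus X)"
    and ?u = "hs_norm (block proj_plus proj_minus Y)" and ?v = "hs_norm (block proj_minus proj_plus Y)"
  have 1: "trace_class (block proj_plus proj_plus (X o\<^sub>L Y))"
      "trace_norm (block proj_plus proj_plus (X o\<^sub>L Y)) \<le> ?a * norm Y + ?c * ?v"
    unfolding block_compose
    by (rule trace_class_add_le[OF trace_norm_compose_block_right[OF y(1) pr(1) pr(1) x(1)] trace_class_hilbert_schmidt_compose[OF x(3) y(3)]])+
  have 2: "trace_class (block proj_minus proj_minus (X o\<^sub>L Y))"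
      "trace_norm (block proj_minus proj_minus (X o\<^sub>L Y)) \<le> ?d * ?u + ?b * norm Y"
    unfolding block_compose
    by (rule trace_class_add_le[OF trace_class_hilbert_schmidt_compose[OF x(4) y(2)] trace_norm_compose_block_right[OF y(1) pr(2) pr(2) x(2)]])+
  have 3: "hs_norm (block proj_plus proj_minus (X o\<^sub>L Y)) \<le> ?a * ?u + ?c * norm Y"
    unfolding block_compose
    by (rule hilbert_schmidt_add_le[OF hs_compose_trace_class(1,2)[OF x(1) y(2)] hs_norm_compose_block_right[OF y(1) pr(2) pr(2) x(3)]])
  have 4: "hs_norm (block proj_minus proj_plus (X o\<^sub>L Y)) \<le> ?d * norm Y + ?b * ?v"
    unfolding block_compose
    by (rule hilbert_schmidt_add_le[OF hs_norm_compose_block_right[OF y(1) pr(1) pr(1) x(4)] hs_compose_trace_class(1,2)[OF x(2) y(3)]])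
  show "restricted_trace_class (X o\<^sub>L Y)"
    unfolding restricted_trace_class_def using 1 2 restricted_op_compose[OF oX Y] by blast
  have nn: "0 \<le> ?a" "0 \<le> ?b" "0 \<le> ?c" "0 \<le> ?d" "0 \<le> ?u" "0 \<le> ?v"
    using x trace_norm_nonneg trace_class_clinear_op hs_norm_nonneg by blast+
  \<comment> \<open>Of the twelve products in the expanded right side these four are missing on the
    left; the other eight match term by term.\<close>
  have "0 \<le> ?a * ?v" "0 \<le> ?b * ?u" "0 \<le> ?c * ?u" "0 \<le> ?d * ?v"
    using nn by simp_all
  then have "?a * norm Y + ?c * ?v + (?d * ?u + ?b * norm Y) + (?a * ?u + ?c * norm Y) + (?d * norm Y + ?b * ?v)
      \<le> (?a + ?b + ?c + ?d) * (norm Y + ?u + ?v)"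
    by (simp add: algebra_simps)
  then show "restricted_trace_norm (X o\<^sub>L Y) \<le> restricted_trace_norm X * restricted_norm Y"
    unfolding restricted_trace_norm_def restricted_norm_def using 1 2 3 4 by linarith
qed

lemma restricted_trace_class_compose_left:
  fixes X Y :: "'h::polarized_hilbert_space \<Rightarrow>\<^sub>L 'h"
  assumes X: "restricted_trace_class X" and Y: "restricted_op Y"
  shows "restricted_trace_class (Y o\<^sub>L X)"
    "restricted_trace_norm (Y o\<^sub>L X) \<le> restricted_norm Y * restricted_trace_norm X"
proof -
  note pr = is_projection_proj
  have oX: "restricted_op X" and
    x: "trace_class (block proj_plus proj_plus X)" "trace_class (block proj_minus proj_minus X)"
      "hilbert_schmidt (block proj_plus proj_minus X)" "hilbert_schmidt (block proj_minus proj_plus X)"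
    using X by (auto simp: restricted_trace_class_def restricted_op_def)
  have y: "clinear_op Y" "hilbert_schmidt (block proj_plus proj_minus Y)" "hilbert_schmidt (block proj_minus proj_plus Y)"
    using Y by (auto simp: restricted_op_def)
  let ?a = "trace_norm (block proj_plus proj_plus X)" and ?b = "trace_norm (block proj_minus proj_minus X)"
    and ?c = "hs_norm (block proj_plus proj_minus X)" and ?d = "hs_norm (block proj_minus proj_plus X)"
    and ?u = "hs_norm (block proj_plus proj_minus Y)" and ?v = "hs_norm (block proj_minus proj_plus Y)"
  have 1: "trace_class (block proj_plus proj_plus (Y o\<^sub>L X))"
      "trace_norm (block proj_plus proj_plus (Y o\<^sub>L X)) \<le> norm Y * ?a + ?u * ?d"
    unfolding block_compose
    by (rule trace_class_add_le[OF trace_norm_compose_block_left[OF y(1) pr(1) pr(1) x(1)] trace_class_hilbert_schmidt_compose[OF y(2) x(4)]])+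
  have 2: "trace_class (block proj_minus proj_minus (Y o\<^sub>L X))"
      "trace_norm (block proj_minus proj_minus (Y o\<^sub>L X)) \<le> ?v * ?c + norm Y * ?b"
    unfolding block_compose
    by (rule trace_class_add_le[OF trace_class_hilbert_schmidt_compose[OF y(3) x(3)] trace_norm_compose_block_left[OF y(1) pr(2) pr(2) x(2)]])+
  have 3: "hs_norm (block proj_plus proj_minus (Y o\<^sub>L X)) \<le> norm Y * ?c + ?u * ?b"
    unfolding block_compose
    by (rule hilbert_schmidt_add_le[OF hs_norm_compose_block_left[OF y(1) pr(1) pr(1) x(3)] hs_compose_trace_class(3,4)[OF x(2) y(2)]])
  have 4: "hs_norm (block proj_minus proj_plus (Y o\<^sub>L X)) \<le> ?v * ?a + norm Y * ?d"
    unfolding block_compose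
    by (rule hilbert_schmidt_add_le[OF hs_compose_trace_class(3,4)[OF x(1) y(3)] hs_norm_compose_block_left[OF y(1) pr(2) pr(2) x(4)]])
  show "restricted_trace_class (Y o\<^sub>L X)"
    unfolding restricted_trace_class_def using 1 2 restricted_op_compose[OF Y oX] by blast
  have nn: "0 \<le> ?a" "0 \<le> ?b" "0 \<le> ?c" "0 \<le> ?d" "0 \<le> ?u" "0 \<le> ?v"
    using x trace_norm_nonneg trace_class_clinear_op hs_norm_nonneg by blast+
  have "0 \<le> ?u * ?a" "0 \<le> ?v * ?b" "0 \<le> ?u * ?c" "0 \<le> ?v * ?d"
    using nn by simp_all
  then have "norm Y * ?a + ?u * ?d + (?v * ?c + norm Y * ?b) + (norm Y * ?c + ?u * ?b) + (?v * ?a + norm Y * ?d)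
      \<le> (norm Y + ?u + ?v) * (?a + ?b + ?c + ?d)"
    by (simp add: algebra_simps)
  then show "restricted_trace_norm (Y o\<^sub>L X) \<le> restricted_norm Y * restricted_trace_norm X"
    unfolding restricted_trace_norm_def restricted_norm_def using 1 2 3 4 by linarith
qed

lemma restricted_op_add: "restricted_op S \<Longrightarrow> restricted_op T \<Longrightarrow> restricted_op (S + T)"
  by (simp add: restricted_op_def clinear_op_add block_add hilbert_schmidt_add(1))

lemma restricted_op_scaleR: "restricted_op T \<Longrightarrow> restricted_op (r *\<^sub>R T)"
  by (simp add: restricted_op_def clinear_op_scaleR block_scaleR hilbert_schmidt_scaleR(1))

lemma restricted_op_diff: "restricted_op S \<Longrightarrow> restricted_op T \<Longrightarrow> restricted_op (S - T)"
  using restricted_op_add[of S "(-1) *\<^sub>R T"] restricted_op_scaleR[of T "-1"] by simp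

lemma restricted_trace_class_add:
  assumes "restricted_trace_class S" "restricted_trace_class T"
  shows "restricted_trace_class (S + T)"
    "restricted_trace_norm (S + T) \<le> restricted_trace_norm S + restricted_trace_norm T"
proof -
  have S: "restricted_op S" "trace_class (block proj_plus proj_plus S)" "trace_class (block proj_minus proj_minus S)"
      "hilbert_schmidt (block proj_plus proj_minus S)" "hilbert_schmidt (block proj_minus proj_plus S)"
    and T: "restricted_op T" "trace_class (block proj_plus proj_plus T)" "trace_class (block proj_minus proj_minus T)"
      "hilbert_schmidt (block proj_plus proj_minus T)" "hilbert_schmidt (block proj_minus proj_plus T)"
    using assms by (auto simp: restricted_trace_class_def restricted_op_def)
  show "restricted_trace_class (S + T)"
    using S T by (simp add: restricted_trace_class_def restricted_op_add block_add trace_class_add(1))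
  show "restricted_trace_norm (S + T) \<le> restricted_trace_norm S + restricted_trace_norm T"
    using trace_class_add(2)[OF S(2) T(2)] trace_class_add(2)[OF S(3) T(3)]
      hilbert_schmidt_add(2)[OF S(4) T(4)] hilbert_schmidt_add(2)[OF S(5) T(5)]
    unfolding restricted_trace_norm_def block_add by linarith
qed

lemma restricted_trace_class_scaleR:
  assumes "restricted_trace_class T"
  shows "restricted_trace_class (r *\<^sub>R T)"
    "restricted_trace_norm (r *\<^sub>R T) = \<bar>r\<bar> * restricted_trace_norm T"
  using assms
  by (auto simp: restricted_trace_class_def restricted_op_def clinear_op_scaleR block_scaleR trace_class_scaleR
      hilbert_schmidt_scaleR restricted_trace_norm_def distrib_left)

lemma restricted_trace_class_diff:
  assumes "restricted_trace_class S" "restricted_trace_class T"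
  shows "restricted_trace_class (S - T)"
    "restricted_trace_norm (S - T) \<le> restricted_trace_norm S + restricted_trace_norm T"
  using restricted_trace_class_add[OF assms(1) restricted_trace_class_scaleR(1)[OF assms(2), of "-1"]]
    restricted_trace_class_scaleR(2)[OF assms(2), of "-1"] by simp_all

subsection \<open>The restricted trace\<close>

lemma res_trace_add:
  "restricted_trace_class S \<Longrightarrow> restricted_trace_class T \<Longrightarrow> res_trace (S + T) = res_trace S + res_trace T"
  by (simp add: res_trace_def restricted_trace_class_def block_add trace_add)

lemma res_trace_diff:
  "restricted_trace_class S \<Longrightarrow> restricted_trace_class T \<Longrightarrow> res_trace (S - T) = res_trace S - res_trace T"
  by (simp add: res_trace_def restricted_trace_class_def block_diff trace_diff)

lemma res_trace_scaleR: "res_trace (r *\<^sub>R T) = of_real r * res_trace T"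
  by (simp add: res_trace_def block_scaleR trace_scaleR distrib_left)

lemma cmod_res_trace_le:
  assumes "restricted_trace_class T"
  shows "cmod (res_trace T) \<le> restricted_trace_norm T"
proof -
  have t: "trace_class (block proj_plus proj_plus T)" "trace_class (block proj_minus proj_minus T)"
    using assms by (auto simp: restricted_trace_class_def)
  show ?thesis
    using trace_summable(2)[OF t(1)] trace_summable(2)[OF t(2)] hs_norm_nonneg[of "block proj_plus proj_minus T"]
      hs_norm_nonneg[of "block proj_minus proj_plus T"]
      norm_triangle_ineq[of "trace (block proj_plus proj_plus T)" "trace (block proj_minus proj_minus T)"]
    unfolding res_trace_def restricted_trace_norm_def by linarith
qed

text \<open>Diagonal blocks commute under the trace by \<open>trace_commute\<close>, off-diagonal
  ones by the Hilbert-Schmidt case, which exchanges the contributions to the two diagonal blocks. X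
  as a whole need not be trace class, so the argument has to go block by block.\<close>

lemma res_trace_commute:
  assumes X: "restricted_trace_class X" and Y: "restricted_op Y"
  shows "res_trace (X o\<^sub>L Y) = res_trace (Y o\<^sub>L X)"
proof -
  note pr = is_projection_proj
  have x: "trace_class (block proj_plus proj_plus X)" "trace_class (block proj_minus proj_minus X)"
      "hilbert_schmidt (block proj_plus proj_minus X)" "hilbert_schmidt (block proj_minus proj_plus X)"
    using X by (auto simp: restricted_trace_class_def restricted_op_def)
  have y: "clinear_op Y" "hilbert_schmidt (block proj_plus proj_minus Y)" "hilbert_schmidt (block proj_minus proj_plus Y)"
    using Y by (auto simp: restricted_op_def)
  note t = trace_norm_compose_block_right(1)[OF y(1)] trace_norm_compose_block_left(1)[OF y(1)]
    trace_class_hilbert_schmidt_compose(1)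
  show ?thesis
    unfolding res_trace_def block_compose
    by (simp add: trace_add t x y pr trace_commute_hilbert_schmidt[OF x(3) y(3)]
        trace_commute_hilbert_schmidt[OF x(4) y(2)] trace_commute[OF x(1) clinear_op_block[OF pr(1,1) y(1)]]
        trace_commute[OF x(2) clinear_op_block[OF pr(2,2) y(1)]])
qed

subsection \<open>The pairing and the coadjoint operators\<close>

lemma ures_pairing_restricted: "A \<in> ures \<Longrightarrow> restricted_trace_class (op_of \<mu> o\<^sub>L A)"
  by (rule restricted_trace_class_compose_right(1)[OF restricted_trace_class_op_of ures_restricted_op])

lemma bounded_linear_ures_pairing:
  assumes A: "A \<in> ures"
  shows "bounded_linear (\<lambda>\<mu>. ures_pairing \<mu> A)"
proof (rule bounded_linear_intro)
  note t = ures_pairing_restricted[OF A]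
  show "ures_pairing (\<mu> + \<nu>) A = ures_pairing \<mu> A + ures_pairing \<nu> A" for \<mu> \<nu>
    by (simp add: ures_pairing_def op_of_add blinfun_compose_simps res_trace_add t)
  show "ures_pairing (r *\<^sub>R \<mu>) A = r *\<^sub>R ures_pairing \<mu> A" for r \<mu>
    by (simp add: ures_pairing_def op_of_scaleR blinfun_compose_simps res_trace_scaleR)
  show "norm (ures_pairing \<mu> A) \<le> norm \<mu> * restricted_norm A" for \<mu>
    unfolding ures_pairing_def norm_eq_restricted_trace_norm real_norm_def
    using abs_Re_le_cmod[of "res_trace (op_of \<mu> o\<^sub>L A)"] cmod_res_trace_le[OF t[of \<mu>]]
      restricted_trace_class_compose_right(2)[OF restricted_trace_class_op_of[of \<mu>] ures_restricted_op[OF A]]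
    by linarith
qed

lemma ures_add: "A \<in> ures \<Longrightarrow> B \<in> ures \<Longrightarrow> A + B \<in> ures"
  by (simp add: ures_restricted restricted_op_add blinfun.bilinear_simps cinner_add_left cinner_add_right)

lemma ures_scaleR: "A \<in> ures \<Longrightarrow> r *\<^sub>R A \<in> ures"
  by (simp add: ures_restricted restricted_op_scaleR blinfun.bilinear_simps cinner_scaleR_left cinner_scaleR_right)

lemma ures_commutator: "A \<in> ures \<Longrightarrow> B \<in> ures \<Longrightarrow> commutator A B \<in> ures"
  by (simp add: ures_restricted commutator_def restricted_op_diff restricted_op_compose blinfun.bilinear_simps
      cinner_diff_left cinner_diff_right)

lemma ures_pairing_add: "A \<in> ures \<Longrightarrow> B \<in> ures \<Longrightarrow> ures_pairing \<mu> (A + B) = ures_pairing \<mu> A + ures_pairing \<mu> B"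
  by (simp add: ures_pairing_def blinfun_compose_simps res_trace_add ures_pairing_restricted)

lemma ures_pairing_scaleR: "ures_pairing \<mu> (r *\<^sub>R A) = r * ures_pairing \<mu> A"
  by (simp add: ures_pairing_def blinfun_compose_simps res_trace_scaleR)

text \<open>The coadjoint representation in the trace pairing: by \<open>ures_pairing_coad\<close>
  it is minus the transpose of the commutator with A.\<close>

definition ures_coad :: "('h::polarized_hilbert_space \<Rightarrow>\<^sub>L 'h) \<Rightarrow> 'h ures_predual \<Rightarrow> 'h ures_predual" where
  "ures_coad A \<mu> = Abs_ures_predual (commutator A (op_of \<mu>))"

text \<open>The cocycle as a map from \<open>ures\<close> into its predual: pairing this element
  with B gives s(B, A).\<close>

definition ures_dcomm :: "('h::polarized_hilbert_space \<Rightarrow>\<^sub>L 'h) \<Rightarrow> 'h ures_predual" where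
  "ures_dcomm A = Abs_ures_predual (commutator pol_op A)"

lemma op_of_ures_coad:
  assumes A: "A \<in> ures"
  shows "op_of (ures_coad A \<mu>) = commutator A (op_of \<mu>)"
    "norm (ures_coad A \<mu>) \<le> 2 * restricted_norm A * norm \<mu>"
proof -
  note * = restricted_trace_class_compose_left[OF restricted_trace_class_op_of ures_restricted_op[OF A], of \<mu>]
    restricted_trace_class_compose_right[OF restricted_trace_class_op_of ures_restricted_op[OF A], of \<mu>]
  show eq: "op_of (ures_coad A \<mu>) = commutator A (op_of \<mu>)"
    unfolding ures_coad_def
  proof (rule op_of_Abs_restricted)
    show "restricted_trace_class (commutator A (op_of \<mu>))"
      unfolding commutator_def by (intro restricted_trace_class_diff *)
    show "cinner (commutator A (op_of \<mu>) x) y = - cinner x (commutator A (op_of \<mu>) y)" for x y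
      by (simp add: commutator_def blinfun.bilinear_simps cinner_diff_left cinner_diff_right
          ures_skew[OF A] op_of_props(2))
  qed
  show "norm (ures_coad A \<mu>) \<le> 2 * restricted_norm A * norm \<mu>"
    unfolding norm_eq_restricted_trace_norm eq commutator_def
    using restricted_trace_class_diff(2)[OF *(1,3)] *(2,4) by (simp add: mult_ac)
qed

lemma norm_imag_op_le: "norm (imag_op :: 'a::complex_hilbert_space \<Rightarrow>\<^sub>L 'a) \<le> 1"
  by (rule norm_blinfun_bound) (simp_all add: imag_op_apply norm_scaleC)

text \<open>d is i on the plus summand and -i on the minus summand, so the commutator cancels
  diagonal blocks and multiplies off-diagonal ones by 2i and -2i. It is stated for complex linear A
  so that it also covers products of elements of \<open>ures\<close>.\<close>

lemma block_commutator_pol_op: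
  assumes A: "clinear_op A"
  shows "block proj_plus proj_plus (commutator pol_op A) = 0" "block proj_minus proj_minus (commutator pol_op A) = 0"
    "block proj_plus proj_minus (commutator pol_op A) = 2 *\<^sub>R (imag_op o\<^sub>L block proj_plus proj_minus A)"
    "block proj_minus proj_plus (commutator pol_op A) = - (2 *\<^sub>R (imag_op o\<^sub>L block proj_minus proj_plus A))"
  by (auto intro!: blinfun_eqI simp: block_apply commutator_pol_op[OF A] proj_clinear blinfun.bilinear_simps proj_idem
      imag_op_apply scaleC_minus_right scaleC_scaleC simp flip: scaleC_of_real)

lemma op_of_ures_dcomm:
  fixes A :: "'h::polarized_hilbert_space \<Rightarrow>\<^sub>L 'h"
  assumes A: "A \<in> ures"
  shows "op_of (ures_dcomm A) = commutator pol_op A" "norm (ures_dcomm A) \<le> 2 * restricted_norm A"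
proof -
  note cA = restricted_op_clinear[OF ures_restricted_op[OF A]]
  note b = block_commutator_pol_op[OF cA]
  have hs: "hilbert_schmidt (block proj_plus proj_minus A)" "hilbert_schmidt (block proj_minus proj_plus A)"
    using A by (auto simp: ures_iff)
  have t: "hilbert_schmidt (2 *\<^sub>R (imag_op o\<^sub>L T)) \<and> hilbert_schmidt (- (2 *\<^sub>R (imag_op o\<^sub>L T)))
      \<and> hs_norm (2 *\<^sub>R (imag_op o\<^sub>L T)) \<le> 2 * hs_norm T \<and> hs_norm (- (2 *\<^sub>R (imag_op o\<^sub>L T))) \<le> 2 * hs_norm T"
    if T: "hilbert_schmidt T" for T :: "'h \<Rightarrow>\<^sub>L 'h"
  proof -
    note i = hilbert_schmidt_compose_left[OF clinear_op_imag_op T]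
    have "hs_norm (imag_op o\<^sub>L T) \<le> hs_norm T"
      using i(2) mult_right_mono[OF norm_imag_op_le[where 'a='h] hs_norm_nonneg[of T]] by simp
    then show ?thesis
      using hilbert_schmidt_scaleR[OF i(1), of 2] hilbert_schmidt_scaleR[OF i(1), of "-2"] by simp
  qed
  have cd: "clinear_op (commutator pol_op A)"
    using A by (auto simp: ures_def hilbert_schmidt_def)
  show eq: "op_of (ures_dcomm A) = commutator pol_op A"
    unfolding ures_dcomm_def
  proof (rule op_of_Abs_restricted)
    show "restricted_trace_class (commutator pol_op A)"
      unfolding restricted_trace_class_def restricted_op_def b
      using cd t[OF hs(1)] t[OF hs(2)] by (simp add: trace_class_zero)
    have d: "cinner (pol_op x) y = - cinner x (pol_op y)" for x y :: 'h
      by (simp add: pol_op_apply cinner_scaleC_left cinner_scaleC_right cinner_diff_left cinner_diff_right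
          proj_plus(3) proj_minus(3))
    show "cinner (commutator pol_op A x) y = - cinner x (commutator pol_op A y)" for x y
      by (simp add: commutator_def blinfun.bilinear_simps cinner_diff_left cinner_diff_right ures_skew[OF A] d)
  qed
  show "norm (ures_dcomm A) \<le> 2 * restricted_norm A"
    unfolding norm_eq_restricted_trace_norm eq restricted_trace_norm_def restricted_norm_def b
    using t[OF hs(1)] t[OF hs(2)] norm_ge_zero[of A] unfolding trace_class_zero distrib_left by linarith
qed

text \<open>Only B moves around the cycle, past the product \<mu> A, which is restricted trace
  class.\<close>

lemma ures_pairing_coad:
  assumes A: "A \<in> ures" and B: "B \<in> ures"
  shows "ures_pairing (ures_coad B \<mu>) A = ures_pairing \<mu> (commutator A B)"
proof -
  note rA = ures_restricted_op[OF A] and rB = ures_restricted_op[OF B] and m = restricted_trace_class_op_of[of \<mu>]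
  note c = restricted_trace_class_compose_right(1) restricted_trace_class_compose_left(1)
  have "res_trace (op_of (ures_coad B \<mu>) o\<^sub>L A) = res_trace (B o\<^sub>L (op_of \<mu> o\<^sub>L A)) - res_trace (op_of \<mu> o\<^sub>L (B o\<^sub>L A))"
    unfolding op_of_ures_coad(1)[OF B] commutator_def blinfun_compose_simps blinfun_compose_assoc
    by (intro res_trace_diff c restricted_op_compose m rA rB)
  also have "res_trace (B o\<^sub>L (op_of \<mu> o\<^sub>L A)) = res_trace (op_of \<mu> o\<^sub>L (A o\<^sub>L B))"
    using res_trace_commute[OF c(1)[OF m rA] rB] by (simp add: blinfun_compose_assoc)
  also have "\<dots> - res_trace (op_of \<mu> o\<^sub>L (B o\<^sub>L A)) = res_trace (op_of \<mu> o\<^sub>L commutator A B)"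
    unfolding commutator_def blinfun_compose_simps
    by (intro res_trace_diff[symmetric] c restricted_op_compose m rA rB)
  finally show ?thesis by (simp add: ures_pairing_def)
qed

lemma ures_cocycle_eq_pairing:
  assumes A: "A \<in> ures" and B: "B \<in> ures"
  shows "ures_cocycle A B = ures_pairing (ures_dcomm B) A"
  unfolding ures_cocycle_def ures_pairing_def
  using res_trace_commute[OF restricted_trace_class_op_of ures_restricted_op[OF A], of "ures_dcomm B"]
  by (simp add: op_of_ures_dcomm[OF B])

text \<open>The commutator with d is a derivation: A [d, B] + [d, A] B = [d, A B]. The diagonal
  blocks of the right side vanish, so its restricted trace is zero.\<close>

lemma ures_pairing_dcomm_antisym:
  assumes A: "A \<in> ures" and B: "B \<in> ures"
  shows "ures_pairing (ures_dcomm B) A = - ures_pairing (ures_dcomm A) B"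
proof -
  note rA = ures_restricted_op[OF A] and rB = ures_restricted_op[OF B]
  have dA: "restricted_trace_class (commutator pol_op A)" and dB: "restricted_trace_class (commutator pol_op B)"
    using restricted_trace_class_op_of op_of_ures_dcomm(1) A B by metis+
  have "res_trace (A o\<^sub>L commutator pol_op B) + res_trace (commutator pol_op A o\<^sub>L B)
      = res_trace ((A o\<^sub>L commutator pol_op B) + (commutator pol_op A o\<^sub>L B))"
    by (intro res_trace_add[symmetric] restricted_trace_class_compose_left(1) restricted_trace_class_compose_right(1)
        dA dB rA rB)
  also have "(A o\<^sub>L commutator pol_op B) + (commutator pol_op A o\<^sub>L B) = commutator pol_op (A o\<^sub>L B)"
    by (simp add: commutator_def blinfun_compose_simps blinfun_compose_assoc)
  also have "res_trace (commutator pol_op (A o\<^sub>L B)) = 0"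
    using block_commutator_pol_op[OF restricted_op_clinear[OF restricted_op_compose[OF rA rB]]]
    by (simp add: res_trace_def trace_def)
  finally have "Re (res_trace (A o\<^sub>L commutator pol_op B)) + Re (res_trace (commutator pol_op A o\<^sub>L B)) = 0"
    by (metis plus_complex.sel(1) zero_complex.sel(1))
  moreover have "Re (res_trace (A o\<^sub>L commutator pol_op B)) = ures_pairing (ures_dcomm B) A"
    using ures_cocycle_eq_pairing[OF A B] by (simp add: ures_cocycle_def)
  ultimately show ?thesis by (simp add: ures_pairing_def op_of_ures_dcomm[OF A])
qed

text \<open>The derivation property of the commutator with d; paired with a third operator it
  becomes the cocycle identity in \<open>ures_dcomm_jacobi\<close>.\<close>

lemma ures_dcomm_commutator:
  assumes A: "A \<in> ures" and B: "B \<in> ures"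
  shows "ures_dcomm (commutator A B) = ures_coad A (ures_dcomm B) - ures_coad B (ures_dcomm A)"
  unfolding op_of_inject[symmetric] op_of_diff op_of_ures_coad(1)[OF A] op_of_ures_coad(1)[OF B]
    op_of_ures_dcomm(1)[OF A] op_of_ures_dcomm(1)[OF B] op_of_ures_dcomm(1)[OF ures_commutator[OF A B]]
  by (simp add: commutator_def blinfun_compose_simps blinfun_compose_assoc)

subsection \<open>Operators of rank one and two\<close>

definition rank_one :: "'a::complex_hilbert_space \<Rightarrow> 'a \<Rightarrow> ('a \<Rightarrow>\<^sub>L 'a)" where
  "rank_one x y = Blinfun (\<lambda>z. cinner z y *\<^sub>C x)"

lemma rank_one_apply: "rank_one x y z = cinner z y *\<^sub>C x"
proof -
  have "bounded_linear (\<lambda>z. cinner z y *\<^sub>C x)"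
  proof (rule bounded_linear_intro[where K="norm y * norm x"])
    show "cinner (u + v) y *\<^sub>C x = cinner u y *\<^sub>C x + cinner v y *\<^sub>C x" for u v
      by (simp add: cinner_add_left scaleC_add_left)
    show "cinner (r *\<^sub>R u) y *\<^sub>C x = r *\<^sub>R (cinner u y *\<^sub>C x)" for r u
      by (simp only: cinner_scaleR_left scaleC_of_real flip: scaleC_scaleC)
    show "norm (cinner u y *\<^sub>C x) \<le> norm u * (norm y * norm x)" for u
      using mult_right_mono[OF cmod_cinner_le[of u y] norm_ge_zero[of x]] by (simp add: norm_scaleC mult.assoc)
  qed
  then show ?thesis by (simp add: rank_one_def bounded_linear_Blinfun_apply)
qed

lemma clinear_op_rank_one: "clinear_op (rank_one x y)"
  by (simp add: clinear_op_def rank_one_apply cinner_scaleC_left scaleC_scaleC)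

lemma cinner_rank_one: "cinner (rank_one x y u) v = cinner u (rank_one y x v)"
  by (simp add: rank_one_apply cinner_scaleC_left cinner_scaleC_right cinner_commute[of x v] mult.commute)

lemma block_rank_one:
  assumes "is_projection q" "clinear_op p"
  shows "block p q (rank_one x y) = rank_one (p x) (q y)"
  using assms
  by (intro blinfun_eqI) (simp add: block_apply rank_one_apply is_projection_def clinear_op_def)

lemma trace_class_rank_one: "trace_class (rank_one x y)" "trace_norm (rank_one x y) \<le> norm x * norm y"
  and hilbert_schmidt_rank_one: "hilbert_schmidt (rank_one x y)" "hs_norm (rank_one x y) \<le> norm x * norm y"
proof -
  have b: "(\<Sum>i\<in>F. cmod (cinner (rank_one x y (u i)) (v i))) \<le> norm x * norm y"
    if u: "bessel F u" and v: "bessel F v" for F :: "'a set" and u v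
  proof -
    have "(\<Sum>i\<in>F. cmod (cinner (rank_one x y (u i)) (v i)))
        = (\<Sum>i\<in>F. \<bar>cmod (cinner y (u i))\<bar> * \<bar>cmod (cinner x (v i))\<bar>)"
      by (intro sum.cong refl)
        (simp add: rank_one_apply cinner_scaleC_left norm_mult cinner_commute[of y])
    also have "\<dots> \<le> L2_set (\<lambda>i. cmod (cinner y (u i))) F * L2_set (\<lambda>i. cmod (cinner x (v i))) F"
      by (rule L2_set_mult_ineq)
    also have "\<dots> \<le> norm y * norm x"
      using u v by (intro mult_mono L2_set_nonneg)
        (auto simp: L2_set_def bessel_def intro!: real_le_lsqrt sum_nonneg)
    finally show ?thesis by (simp add: mult.commute)
  qed
  note * = trace_classI[OF clinear_op_rank_one b]
  show "trace_class (rank_one x y)" "trace_norm (rank_one x y) \<le> norm x * norm y" by (rule *; assumption)+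
  have h: "(\<Sum>i\<in>F. (norm (rank_one x y (u i)))\<^sup>2) \<le> (norm x * norm y)\<^sup>2"
    if u: "bessel F u" for F :: "'a set" and u
  proof -
    have "(\<Sum>i\<in>F. (norm (rank_one x y (u i)))\<^sup>2) = (\<Sum>i\<in>F. (cmod (cinner y (u i)))\<^sup>2) * (norm x)\<^sup>2"
      unfolding sum_distrib_right
      by (intro sum.cong refl) (simp add: rank_one_apply norm_scaleC power_mult_distrib cinner_commute[of y])
    also have "\<dots> \<le> (norm y)\<^sup>2 * (norm x)\<^sup>2" using u by (intro mult_right_mono) (auto simp: bessel_def)
    finally show ?thesis by (simp add: power_mult_distrib mult.commute)
  qed
  note * = hilbert_schmidtI[OF clinear_op_rank_one mult_nonneg_nonneg[OF norm_ge_zero norm_ge_zero] h]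
  show "hilbert_schmidt (rank_one x y)" "hs_norm (rank_one x y) \<le> norm x * norm y" by (rule *; assumption)+
qed

lemma trace_rank_one: "trace (rank_one x y) = cinner x y"
  using infsumI[OF parseval[OF some_onb, of x y]]
  by (simp add: trace_def rank_one_apply cinner_scaleC_left mult.commute)

lemma clinear_proj: "clinear_op proj_plus" "clinear_op proj_minus"
  by (rule is_projection_clinear_op, rule is_projection_proj)+

lemmas block_proj_rank_one =
  block_rank_one[OF is_projection_proj(1) clinear_proj(1)] block_rank_one[OF is_projection_proj(1) clinear_proj(2)]
  block_rank_one[OF is_projection_proj(2) clinear_proj(1)] block_rank_one[OF is_projection_proj(2) clinear_proj(2)]

lemma restricted_trace_class_rank_one: "restricted_trace_class (rank_one x y)"
  unfolding restricted_trace_class_def restricted_op_def block_proj_rank_one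
  by (simp add: clinear_op_rank_one trace_class_rank_one hilbert_schmidt_rank_one)

text \<open>The four blocks are again of rank one and contribute at most
  \<open>norm x * norm y\<close> each, since projections do not increase norms.\<close>

lemma restricted_trace_norm_rank_one: "restricted_trace_norm (rank_one x y) \<le> 4 * (norm x * norm y)"
proof -
  have le: "norm (p x) * norm (q y) \<le> norm x * norm y" if "is_projection p" "is_projection q" for p q :: "'a \<Rightarrow>\<^sub>L 'a"
    using that by (intro mult_mono is_projection_norm_le) auto
  note pr = is_projection_proj
  show ?thesis
    unfolding restricted_trace_norm_def block_proj_rank_one
    using order_trans[OF trace_class_rank_one(2) le[OF pr(1,1)]]
      order_trans[OF trace_class_rank_one(2) le[OF pr(2,2)]]
      order_trans[OF hilbert_schmidt_rank_one(2) le[OF pr(1,2)]]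
      order_trans[OF hilbert_schmidt_rank_one(2) le[OF pr(2,1)]] by linarith
qed

lemma res_trace_rank_one: "res_trace (rank_one x y) = cinner x y"
proof -
  have "cinner (proj_plus x) (proj_plus y) + cinner (proj_minus x) (proj_minus y)
      = cinner (proj_plus x + proj_minus x) y"
    by (simp add: cinner_add_left proj_plus(3)[symmetric] proj_minus(3)[symmetric] proj_idem)
  then show ?thesis
    by (simp add: res_trace_def block_proj_rank_one trace_rank_one proj_plus_add_proj_minus)
qed

definition rank_two :: "'h::polarized_hilbert_space \<Rightarrow> 'h \<Rightarrow> 'h ures_predual" where
  "rank_two x y = Abs_ures_predual (rank_one x y - rank_one y x)"

lemma op_of_rank_two: "op_of (rank_two x y) = rank_one x y - rank_one y x"
  unfolding rank_two_def
  by (rule op_of_Abs_restricted)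
    (simp_all add: restricted_trace_class_diff restricted_trace_class_rank_one blinfun.bilinear_simps
      cinner_diff_left cinner_diff_right cinner_rank_one)

lemma norm_rank_two_le: "norm (rank_two x y) \<le> 8 * (norm x * norm y)"
  unfolding norm_eq_restricted_trace_norm op_of_rank_two
  using restricted_trace_class_diff(2)[OF restricted_trace_class_rank_one restricted_trace_class_rank_one, of x y y x]
    restricted_trace_norm_rank_one[of x y] restricted_trace_norm_rank_one[of y x]
  by (simp add: mult.commute[of "norm y"])

lemma rank_one_linear:
  "rank_one (x + x') y = rank_one x y + rank_one x' y" "rank_one x (y + y') = rank_one x y + rank_one x y'"
  "rank_one (r *\<^sub>R x) y = r *\<^sub>R rank_one x y" "rank_one x (r *\<^sub>R y) = r *\<^sub>R rank_one x y"
  "rank_one (c *\<^sub>C x) y = rank_one x (cnj c *\<^sub>C y)"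
  by (auto intro!: blinfun_eqI simp: rank_one_apply blinfun.bilinear_simps scaleC_add_right scaleC_add_left
      cinner_add_right cinner_scaleR_right cinner_scaleC_right scaleC_scaleC scaleC_scaleR_commute mult.commute
      simp flip: scaleC_of_real)

text \<open>The last two relations become skew symmetry and compatibility with i of the form that a
  functional defines, hence skew-adjointness and complex linearity of its operator.\<close>

lemma rank_two_linear:
  "rank_two (x + x') y = rank_two x y + rank_two x' y" "rank_two x (y + y') = rank_two x y + rank_two x y'"
  "rank_two (r *\<^sub>R x) y = r *\<^sub>R rank_two x y" "rank_two x (r *\<^sub>R y) = r *\<^sub>R rank_two x y"
  "rank_two y x = - rank_two x y" "rank_two (\<i> *\<^sub>C x) y = - rank_two x (\<i> *\<^sub>C y)"
proof -
  have "rank_one x (- y) = - rank_one x y" "rank_one (- x) y = - rank_one x y" for x y :: 'a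
    using rank_one_linear(4)[of x "-1" y] rank_one_linear(3)[of "-1" x y] by simp_all
  note * = this rank_one_linear
  show "rank_two (x + x') y = rank_two x y + rank_two x' y" "rank_two x (y + y') = rank_two x y + rank_two x y'"
    "rank_two (r *\<^sub>R x) y = r *\<^sub>R rank_two x y" "rank_two x (r *\<^sub>R y) = r *\<^sub>R rank_two x y"
    "rank_two y x = - rank_two x y"
    by (simp_all add: op_of_inject[symmetric] op_of_add op_of_scaleR op_of_minus op_of_rank_two *(1-6) algebra_simps)
  show "rank_two (\<i> *\<^sub>C x) y = - rank_two x (\<i> *\<^sub>C y)"
    using *(7)[of \<i> x y] *(7)[of \<i> y x]
    by (simp add: op_of_inject[symmetric] op_of_minus op_of_rank_two *(1-2) complex_vector.scale_minus_left algebra_simps)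
qed

text \<open>The two rank one terms give <A x, y> and its complex conjugate; hence the factor 2 and
  the real inner product.\<close>

lemma ures_pairing_rank_two:
  assumes A: "A \<in> ures"
  shows "ures_pairing (rank_two x y) A = 2 * inner (A x) y"
proof -
  have c: "rank_one x y o\<^sub>L A = rank_one x (- A y)" for x y
    by (rule blinfun_eqI) (simp add: rank_one_apply ures_skew[OF A] cinner_minus_right)
  have "res_trace (op_of (rank_two x y) o\<^sub>L A) = cinner x (- A y) - cinner y (- A x)"
    unfolding op_of_rank_two blinfun_compose_simps c
    by (simp add: res_trace_diff restricted_trace_class_rank_one res_trace_rank_one)
  also have "\<dots> = cinner (A x) y + cinner y (A x)"
    using ures_skew[OF A, of x y] by (simp add: cinner_minus_right)
  finally show ?thesis by (simp add: ures_pairing_def Re_cinner inner_commute)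
qed

text \<open>Real inner products with all y already separate operators, so testing on rank two
  elements suffices.\<close>

lemma ures_eqI:
  assumes "A \<in> ures" "B \<in> ures" "\<And>\<mu>. ures_pairing \<mu> A = ures_pairing \<mu> B"
  shows "A = B"
proof (rule blinfun_eqI)
  fix x
  have "inner (A x - B x) y = 0" for y
    using assms(3)[of "rank_two x y"] by (simp add: ures_pairing_rank_two assms(1,2) inner_diff_left)
  from this[of "A x - B x"] show "A x = B x" by simp
qed

subsection \<open>Density of the finite rank operators\<close>

text \<open>The remainder vanishes on the basis vectors in G and equals T on the others, so its
  squared norm is a tail of a convergent series.\<close>

lemma hilbert_schmidt_truncate:
  assumes T: "hilbert_schmidt T" and e: "0 < \<epsilon>"
  obtains G where "finite G" "hilbert_schmidt (T - (\<Sum>e\<in>G. rank_one (T e) e))"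
    "hs_norm (T - (\<Sum>e\<in>G. rank_one (T e) e)) \<le> \<epsilon>"
proof -
  let ?E = "some_onb :: 'a set"
  note E = some_onb[where 'a='a]
  have bd: "(\<Sum>e\<in>G. (norm (T e))\<^sup>2) \<le> (hs_norm T)\<^sup>2" if "finite G" "G \<subseteq> ?E" for G
    by (rule hs_bessel[OF T bessel_onb[OF E that]])
  then have sm: "(\<lambda>e. (norm (T e))\<^sup>2) summable_on ?E"
    by (intro summable_on_bounded_partial(1)) auto
  define s where "s = (\<Sum>\<^sub>\<infinity>e\<in>?E. (norm (T e))\<^sup>2)"
  have "((\<lambda>e. (norm (T e))\<^sup>2) has_sum s) ?E" unfolding s_def by (rule has_sum_infsum[OF sm])
  then have "\<forall>\<^sub>F G in finite_subsets_at_top ?E. dist (\<Sum>e\<in>G. (norm (T e))\<^sup>2) s < \<epsilon>\<^sup>2"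
    unfolding has_sum_def using e tendstoD by (metis zero_less_power)
  then obtain G where G: "finite G" "G \<subseteq> ?E" "dist (\<Sum>e\<in>G. (norm (T e))\<^sup>2) s < \<epsilon>\<^sup>2"
    unfolding eventually_finite_subsets_at_top by blast
  define R where "R = T - (\<Sum>e\<in>G. rank_one (T e) e)"
  have hR: "hilbert_schmidt R"
  proof -
    have "hilbert_schmidt (\<Sum>e\<in>G. rank_one (T e) e)"
      by (induction G rule: infinite_finite_induct)
        (auto intro: hilbert_schmidt_zero hilbert_schmidt_add(1) hilbert_schmidt_rank_one(1))
    then show ?thesis
      using hilbert_schmidt_add(1)[OF T hilbert_schmidt_scaleR(1), of _ "-1"] by (simp add: R_def)
  qed
  have Re: "R e = (if e \<in> G then 0 else T e)" if "e \<in> ?E" for e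
  proof -
    have "(\<Sum>f\<in>G. rank_one (T f) f e) = (\<Sum>f\<in>G. if f = e then T e else 0)"
      using E G(2) that by (intro sum.cong) (auto simp: rank_one_apply is_onb_def cinner_self subset_iff)
    then show ?thesis using G(1) by (simp add: R_def blinfun.diff_left blinfun.sum_left)
  qed
  have "(\<Sum>e\<in>H. (norm (R e))\<^sup>2) \<le> \<epsilon>\<^sup>2" if H: "finite H" "H \<subseteq> ?E" for H
  proof -
    have "(\<Sum>e\<in>H. (norm (R e))\<^sup>2) = (\<Sum>e\<in>H - G. (norm (T e))\<^sup>2)"
      using H by (intro sum.mono_neutral_cong_right) (auto simp: Re subset_iff)
    also have "\<dots> = (\<Sum>e\<in>H \<union> G. (norm (T e))\<^sup>2) - (\<Sum>e\<in>G. (norm (T e))\<^sup>2)"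
      using H G sum.subset_diff[of G "H \<union> G" "\<lambda>e. (norm (T e))\<^sup>2"] by (simp add: Un_Diff)
    also have "(\<Sum>e\<in>H \<union> G. (norm (T e))\<^sup>2) \<le> s"
      unfolding s_def using H G by (intro finite_sum_le_infsum sm) auto
    finally show ?thesis using G(3) by (simp add: dist_real_def)
  qed
  then have "(\<Sum>\<^sub>\<infinity>e\<in>?E. (norm (R e))\<^sup>2) \<le> \<epsilon>\<^sup>2" by (intro summable_on_bounded_partial(2)) auto
  then have "hs_norm R \<le> \<epsilon>" unfolding hs_norm_def using e by (intro real_le_lsqrt) auto
  then show ?thesis using that G(1) hR by (simp add: R_def)
qed

lemma op_of_sum: "op_of (\<Sum>i\<in>F. f i) = (\<Sum>i\<in>F. op_of (f i))"
  by (induction F rule: infinite_finite_induct) (auto simp: op_of_zero op_of_add)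

lemma block_sum: "block p q (\<Sum>i\<in>F. f i) = (\<Sum>i\<in>F. block p q (f i))"
  by (induction F rule: infinite_finite_induct) (auto simp: block_zero block_add)

lemma hs_norm_block_le:
  assumes p: "is_projection p" and q: "is_projection q" and T: "hilbert_schmidt T"
  shows "hs_norm (block p q T) \<le> hs_norm T"
proof -
  have n: "norm p \<le> 1" "norm q \<le> 1"
    by (auto intro!: norm_blinfun_bound simp: is_projection_norm_le p q)
  have "hs_norm (block p q T) \<le> (norm p * hs_norm T) * norm q"
    unfolding block_def
    using hilbert_schmidt_compose_right(2)[OF is_projection_clinear_op[OF q]
        hilbert_schmidt_compose_left(1)[OF is_projection_clinear_op[OF p] T]]
      mult_right_mono[OF hilbert_schmidt_compose_left(2)[OF is_projection_clinear_op[OF p] T] norm_ge_zero[of q]]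
    by linarith
  also have "\<dots> \<le> (1 * hs_norm T) * 1" using n by (intro mult_mono) (auto simp: hs_norm_nonneg)
  finally show ?thesis by simp
qed

lemma trace_norm_block_le:
  assumes p: "is_projection p" and q: "is_projection q" and T: "trace_class T"
  shows "trace_norm (block p q T) \<le> trace_norm T"
proof -
  have n: "norm p \<le> 1" "norm q \<le> 1"
    by (auto intro!: norm_blinfun_bound simp: is_projection_norm_le p q)
  have "trace_norm (block p q T) \<le> (norm p * trace_norm T) * norm q"
    unfolding block_def
    using trace_class_compose_right(2)[OF is_projection_clinear_op[OF q]
        trace_class_compose_left(1)[OF is_projection_clinear_op[OF p] T]]
      mult_right_mono[OF trace_class_compose_left(2)[OF is_projection_clinear_op[OF p] T] norm_ge_zero[of q]]
    by linarith
  also have "\<dots> \<le> (1 * trace_norm T) * 1"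
    using n by (intro mult_mono) (auto simp: trace_norm_nonneg trace_class_clinear_op T)
  finally show ?thesis by simp
qed

text \<open>With F = \<Sum> |S e><e| the truncation of S, self-adjointness of S turns F S into
  \<Sum> |S e><S e|, and i |u><u| is half of \<open>rank_two\<close> at iu and u. The error comes
  from (S - F) S, small in trace norm as a product of Hilbert-Schmidt operators. Compression by p
  keeps this form, with u = p (S e).\<close>

lemma diagonal_approximation:
  fixes S p :: "'h::polarized_hilbert_space \<Rightarrow>\<^sub>L 'h"
  assumes S: "positive_op S" and hS: "hilbert_schmidt S" and p: "is_projection p" and e: "0 < \<epsilon>"
  obtains \<sigma> where "\<sigma> \<in> span (range (case_prod rank_two))" "op_of \<sigma> = block p p (op_of \<sigma>)"
    "trace_class (block p p (imag_op o\<^sub>L (S o\<^sub>L S)) - op_of \<sigma>)"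
    "trace_norm (block p p (imag_op o\<^sub>L (S o\<^sub>L S)) - op_of \<sigma>) \<le> \<epsilon>"
proof -
  \<comment> \<open>The trace norm error will be at most \<delta> times \<open>hs_norm S\<close>;
    the summand 1 avoids division by zero.\<close>
  define \<delta> where "\<delta> = \<epsilon> / (hs_norm S + 1)"
  have \<delta>: "0 < \<delta>" "\<delta> * hs_norm S \<le> \<epsilon>"
    using e hs_norm_nonneg[of S] by (auto simp: \<delta>_def field_simps add_nonneg_pos)
  obtain G where G: "finite G" "hilbert_schmidt (S - (\<Sum>e\<in>G. rank_one (S e) e))"
    "hs_norm (S - (\<Sum>e\<in>G. rank_one (S e) e)) \<le> \<delta>" using hilbert_schmidt_truncate[OF hS \<delta>(1)] .
  define R where "R = S - (\<Sum>e\<in>G. rank_one (S e) e)"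
  define \<sigma> where "\<sigma> = (\<Sum>e\<in>G. (1/2) *\<^sub>R rank_two (\<i> *\<^sub>C p (S e)) (p (S e)))"
  note cp = is_projection_clinear_op[OF p]
  have r2: "(1/2) *\<^sub>R (rank_one (\<i> *\<^sub>C u) u - rank_one u (\<i> *\<^sub>C u)) = imag_op o\<^sub>L rank_one u u" for u :: 'h
    by (rule blinfun_eqI)
      (simp add: blinfun.bilinear_simps rank_one_apply imag_op_apply scaleC_scaleC cinner_scaleC_right mult.commute
        complex_vector.scale_minus_left flip: scaleR_2 scaleC_of_real)
  have "op_of \<sigma> = (\<Sum>e\<in>G. imag_op o\<^sub>L rank_one (p (S e)) (p (S e)))"
    unfolding \<sigma>_def op_of_sum op_of_scaleR op_of_rank_two r2 ..
  also have "\<dots> = block p p (imag_op o\<^sub>L ((\<Sum>e\<in>G. rank_one (S e) e) o\<^sub>L S))"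
    using cp p by (intro blinfun_eqI)
      (simp add: block_apply blinfun.sum_left imag_op_apply rank_one_apply clinear_op_def is_projection_def
        complex_vector.scale_sum_right blinfun.sum_right positive_op_sym[OF S])
  finally have op: "op_of \<sigma> = block p p (imag_op o\<^sub>L ((\<Sum>e\<in>G. rank_one (S e) e) o\<^sub>L S))" .
  have "\<sigma> \<in> span (range (case_prod rank_two))"
    unfolding \<sigma>_def by (intro span_sum span_scale span_base) auto
  moreover have "op_of \<sigma> = block p p (op_of \<sigma>)"
    unfolding op using p by (intro blinfun_eqI) (simp add: block_apply is_projection_def)
  moreover have "trace_class (block p p (imag_op o\<^sub>L (S o\<^sub>L S)) - op_of \<sigma>) \<and>
      trace_norm (block p p (imag_op o\<^sub>L (S o\<^sub>L S)) - op_of \<sigma>) \<le> \<epsilon>"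
  proof -
    note t = trace_class_hilbert_schmidt_compose[OF G(2) hS, folded R_def]
    note i = trace_class_compose_left[OF clinear_op_imag_op t(1)]
    have eq: "block p p (imag_op o\<^sub>L (S o\<^sub>L S)) - op_of \<sigma> = block p p (imag_op o\<^sub>L (R o\<^sub>L S))"
      unfolding op R_def block_diff[symmetric] blinfun_compose_simps ..
    have "trace_norm (block p p (imag_op o\<^sub>L (R o\<^sub>L S))) \<le> trace_norm (imag_op o\<^sub>L (R o\<^sub>L S))"
      by (rule trace_norm_block_le[OF p p i(1)])
    also have "\<dots> \<le> 1 * trace_norm (R o\<^sub>L S)"
      using i(2) mult_right_mono[OF norm_imag_op_le[where 'a='h] trace_norm_nonneg[OF trace_class_clinear_op[OF t(1)]]]
      by linarith
    also have "\<dots> \<le> \<delta> * hs_norm S"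
      using t(2) mult_right_mono[OF G(3)[folded R_def] hs_norm_nonneg[of S]] by linarith
    finally have "trace_norm (block p p (imag_op o\<^sub>L (R o\<^sub>L S))) \<le> \<epsilon>" using \<delta>(2) by linarith
    moreover have "trace_class (block p p (imag_op o\<^sub>L (R o\<^sub>L S)))"
      unfolding block_def by (intro trace_class_compose_left(1) trace_class_compose_right(1) cp i(1))
    ultimately show ?thesis by (simp add: eq)
  qed
  ultimately show ?thesis using that by blast
qed

text \<open>i D is self-adjoint for the skew-adjoint block D, so it is S S - U U, and multiplication
  by -i expresses D by i times squares.\<close>

lemma diagonal_block_approximation:
  fixes \<mu> :: "'h::polarized_hilbert_space ures_predual"
  assumes p: "is_projection p" and t: "trace_class (block p p (op_of \<mu>))" and e: "0 < \<epsilon>"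
  obtains \<sigma> where "\<sigma> \<in> span (range (case_prod rank_two))" "op_of \<sigma> = block p p (op_of \<sigma>)"
    "trace_norm (block p p (op_of \<mu>) - op_of \<sigma>) \<le> \<epsilon>"
proof -
  define D where "D = block p p (op_of \<mu>)"
  have D: "clinear_op D" using t unfolding D_def by (rule trace_class_clinear_op)
  have skD: "cinner (D x) y = - cinner x (D y)" for x y
    using p by (simp add: D_def block_apply is_projection_def op_of_props(2))
  have "cinner ((imag_op o\<^sub>L D) x) y = cinner x ((imag_op o\<^sub>L D) y)" for x y
    by (simp add: imag_op_apply cinner_scaleC_left cinner_scaleC_right skD)
  moreover have "trace_class (imag_op o\<^sub>L D)"
    unfolding D_def by (rule trace_class_compose_left(1)[OF clinear_op_imag_op t])
  ultimately obtain S U where SU: "positive_op S" "hilbert_schmidt S" "positive_op U" "hilbert_schmidt U"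
    "imag_op o\<^sub>L D = (S o\<^sub>L S) - (U o\<^sub>L U)" using self_adjoint_trace_class_decomposition by blast
  have "D = - (imag_op o\<^sub>L (imag_op o\<^sub>L D))"
    by (rule blinfun_eqI) (simp add: imag_op_apply scaleC_scaleC blinfun.bilinear_simps)
  then have "block p p D = block p p (imag_op o\<^sub>L (U o\<^sub>L U)) - block p p (imag_op o\<^sub>L (S o\<^sub>L S))"
    unfolding SU(5) blinfun_compose_simps block_diff[symmetric] by simp
  moreover have "block p p D = D"
    using p by (intro blinfun_eqI) (simp add: D_def block_apply is_projection_def)
  ultimately have eq: "D = block p p (imag_op o\<^sub>L (U o\<^sub>L U)) - block p p (imag_op o\<^sub>L (S o\<^sub>L S))" by simp
  have e2: "0 < \<epsilon> / 2" using e by simp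
  obtain \<sigma> where \<sigma>: "\<sigma> \<in> span (range (case_prod rank_two))" "op_of \<sigma> = block p p (op_of \<sigma>)"
    "trace_class (block p p (imag_op o\<^sub>L (S o\<^sub>L S)) - op_of \<sigma>)"
    "trace_norm (block p p (imag_op o\<^sub>L (S o\<^sub>L S)) - op_of \<sigma>) \<le> \<epsilon> / 2"
    using diagonal_approximation[OF SU(1,2) p e2] .
  obtain \<tau> where \<tau>: "\<tau> \<in> span (range (case_prod rank_two))" "op_of \<tau> = block p p (op_of \<tau>)"
    "trace_class (block p p (imag_op o\<^sub>L (U o\<^sub>L U)) - op_of \<tau>)"
    "trace_norm (block p p (imag_op o\<^sub>L (U o\<^sub>L U)) - op_of \<tau>) \<le> \<epsilon> / 2"
    using diagonal_approximation[OF SU(3,4) p e2] .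
  have "D - op_of (\<tau> - \<sigma>) = (block p p (imag_op o\<^sub>L (U o\<^sub>L U)) - op_of \<tau>)
      + (-1) *\<^sub>R (block p p (imag_op o\<^sub>L (S o\<^sub>L S)) - op_of \<sigma>)"
    by (subst eq) (simp add: op_of_diff)
  moreover have "trace_norm ((-1) *\<^sub>R (block p p (imag_op o\<^sub>L (S o\<^sub>L S)) - op_of \<sigma>)) \<le> \<epsilon> / 2"
    using \<sigma>(4) by (simp only: trace_class_scaleR(2)[OF \<sigma>(3)] abs_neg_one mult_1)
  ultimately have "trace_norm (D - op_of (\<tau> - \<sigma>)) \<le> \<epsilon>"
    using trace_class_add_le(2)[OF \<tau>(3,4) trace_class_scaleR(1)[OF \<sigma>(3), of "-1"], of "\<epsilon> / 2"] by simp
  moreover have "op_of (\<tau> - \<sigma>) = block p p (op_of (\<tau> - \<sigma>))"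
    unfolding op_of_diff block_diff using \<sigma>(2) \<tau>(2) by simp
  ultimately show ?thesis using that[of "\<tau> - \<sigma>"] \<sigma>(1) \<tau>(1) span_diff unfolding D_def by blast
qed

text \<open>Only the block V from minus to plus is truncated; the other block is minus its adjoint
  by skewness. V e lies in the plus summand and \<open>proj_minus e\<close> in the minus summand, so
  no diagonal blocks arise.\<close>

lemma off_diagonal_approximation:
  fixes \<mu> :: "'h::polarized_hilbert_space ures_predual"
  assumes e: "0 < \<epsilon>"
  obtains \<sigma> where "\<sigma> \<in> span (range (case_prod rank_two))"
    "block proj_plus proj_plus (op_of \<sigma>) = 0" "block proj_minus proj_minus (op_of \<sigma>) = 0"
    "hs_norm (block proj_plus proj_minus (op_of \<mu>) - block proj_plus proj_minus (op_of \<sigma>)) \<le> \<epsilon>"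
    "hs_norm (block proj_minus proj_plus (op_of \<mu>) - block proj_minus proj_plus (op_of \<sigma>)) \<le> \<epsilon>"
proof -
  note pr = is_projection_proj
  define V where "V = block proj_plus proj_minus (op_of \<mu>)"
  have hV: "hilbert_schmidt V" unfolding V_def by (rule op_of_props)
  obtain G where G: "finite G" "hilbert_schmidt (V - (\<Sum>e\<in>G. rank_one (V e) e))"
    "hs_norm (V - (\<Sum>e\<in>G. rank_one (V e) e)) \<le> \<epsilon>" using hilbert_schmidt_truncate[OF hV e] .
  define \<sigma> where "\<sigma> = (\<Sum>e\<in>G. rank_two (V e) (proj_minus e))"
  have VV: "proj_plus (V e) = V e" "proj_minus (V e) = 0" for e
    by (simp_all add: V_def block_apply proj_idem)
  have z: "rank_one 0 y = 0" "rank_one y 0 = 0" for y :: 'h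
    by (auto intro!: blinfun_eqI simp: rank_one_apply)
  have op: "op_of \<sigma> = (\<Sum>e\<in>G. rank_one (V e) (proj_minus e) - rank_one (proj_minus e) (V e))"
    unfolding \<sigma>_def op_of_sum op_of_rank_two ..
  have pm: "block proj_plus proj_minus (op_of \<sigma>) = (\<Sum>e\<in>G. rank_one (V e) (proj_minus e))"
    unfolding op block_sum block_diff block_proj_rank_one by (simp add: VV proj_idem z)
  define W where "W = V - block proj_plus proj_minus (op_of \<sigma>)"
  \<comment> \<open>V is unchanged by its own projections, so the error is the compressed truncation
    error.\<close>
  have W: "W = block proj_plus proj_minus (V - (\<Sum>e\<in>G. rank_one (V e) e))"
    unfolding W_def pm block_diff block_sum block_proj_rank_one VV
    by (auto intro!: blinfun_eqI simp: V_def block_apply proj_idem blinfun.bilinear_simps)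
  have hW: "hilbert_schmidt W"
    unfolding W block_def
    by (intro hilbert_schmidt_compose_right(1) hilbert_schmidt_compose_left(1) clinear_proj G)
  have nW: "hs_norm W \<le> \<epsilon>"
    using hs_norm_block_le[OF pr(1,2) G(2)] G(3) unfolding W by linarith
  have adj: "cadjoint W = - (block proj_minus proj_plus (op_of \<mu>) - block proj_minus proj_plus (op_of \<sigma>))"
    by (rule cadjoint_eqI)
      (simp add: W_def V_def block_apply blinfun.bilinear_simps cinner_diff_left cinner_diff_right
        proj_plus(3) proj_minus(3) op_of_props(2))
  show ?thesis
  proof (rule that)
    show "\<sigma> \<in> span (range (case_prod rank_two))"
      unfolding \<sigma>_def by (intro span_sum span_base) auto
    show "block proj_plus proj_plus (op_of \<sigma>) = 0" "block proj_minus proj_minus (op_of \<sigma>) = 0"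
      unfolding op block_sum block_diff block_proj_rank_one by (simp_all add: VV proj_idem z)
    show "hs_norm (block proj_plus proj_minus (op_of \<mu>) - block proj_plus proj_minus (op_of \<sigma>)) \<le> \<epsilon>"
      using nW by (simp add: W_def V_def)
    show "hs_norm (block proj_minus proj_plus (op_of \<mu>) - block proj_minus proj_plus (op_of \<sigma>)) \<le> \<epsilon>"
      using hilbert_schmidt_cadjoint[OF hW] nW hilbert_schmidt_scaleR(2)[of "cadjoint W" "-1"]
      by (simp add: adj)
  qed
qed

lemma closure_span_rank_two: "closure (span (range (case_prod rank_two))) = (UNIV :: 'h::polarized_hilbert_space ures_predual set)"
proof (intro set_eqI iffI UNIV_I)
  fix \<mu> :: "'h ures_predual"
  note pr = is_projection_proj
  show "\<mu> \<in> closure (span (range (case_prod rank_two)))"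
    unfolding closure_approachable
  proof (intro allI impI)
    fix \<epsilon> :: real assume "0 < \<epsilon>"
    \<comment> \<open>The four block errors sum to at most 4/5 of \<epsilon>, which leaves the
      strict inequality required of the distance.\<close>
    then have e: "0 < \<epsilon> / 5" by simp
    obtain \<alpha> where \<alpha>: "\<alpha> \<in> span (range (case_prod rank_two))" "op_of \<alpha> = block proj_plus proj_plus (op_of \<alpha>)"
      "trace_norm (block proj_plus proj_plus (op_of \<mu>) - op_of \<alpha>) \<le> \<epsilon> / 5"
      using diagonal_block_approximation[OF pr(1) op_of_props(5) e] .
    obtain \<beta> where \<beta>: "\<beta> \<in> span (range (case_prod rank_two))" "op_of \<beta> = block proj_minus proj_minus (op_of \<beta>)"
      "trace_norm (block proj_minus proj_minus (op_of \<mu>) - op_of \<beta>) \<le> \<epsilon> / 5"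
      using diagonal_block_approximation[OF pr(2) op_of_props(6) e] .
    obtain \<gamma> where \<gamma>: "\<gamma> \<in> span (range (case_prod rank_two))"
      "block proj_plus proj_plus (op_of \<gamma>) = 0" "block proj_minus proj_minus (op_of \<gamma>) = 0"
      "hs_norm (block proj_plus proj_minus (op_of \<mu>) - block proj_plus proj_minus (op_of \<gamma>)) \<le> \<epsilon> / 5"
      "hs_norm (block proj_minus proj_plus (op_of \<mu>) - block proj_minus proj_plus (op_of \<gamma>)) \<le> \<epsilon> / 5"
      using off_diagonal_approximation[OF e, of \<mu>] .
    have z: "block p q (op_of \<alpha>) = block p q (block proj_plus proj_plus (op_of \<alpha>))"
      "block p q (op_of \<beta>) = block p q (block proj_minus proj_minus (op_of \<beta>))" for p q
      using \<alpha>(2) \<beta>(2) by simp_all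
    have z': "block proj_minus proj_minus (op_of \<alpha>) = 0" "block proj_plus proj_minus (op_of \<alpha>) = 0"
      "block proj_minus proj_plus (op_of \<alpha>) = 0" "block proj_plus proj_plus (op_of \<beta>) = 0"
      "block proj_plus proj_minus (op_of \<beta>) = 0" "block proj_minus proj_plus (op_of \<beta>) = 0"
      by (subst z, rule blinfun_eqI, simp add: block_apply proj_idem blinfun.bilinear_simps)+
    have "norm (\<mu> - (\<alpha> + \<beta> + \<gamma>)) \<le> 4 * (\<epsilon> / 5)"
      using \<alpha>(3) \<beta>(3) \<gamma>(4,5)
      unfolding norm_ures_predual_def op_of_diff op_of_add block_diff block_add z' \<alpha>(2)[symmetric] \<beta>(2)[symmetric] \<gamma>(2,3)
      by simp
    then have "dist (\<alpha> + \<beta> + \<gamma>) \<mu> < \<epsilon>" using \<open>0 < \<epsilon>\<close> by (simp add: dist_norm norm_minus_commute)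
    then show "\<exists>y\<in>span (range (case_prod rank_two)). dist y \<mu> < \<epsilon>"
      using \<alpha>(1) \<beta>(1) \<gamma>(1) span_add by blast
  qed
qed

lemma bounded_linear_eq_rank_two:
  assumes f: "bounded_linear f" and g: "bounded_linear g" and eq: "\<And>x y. f (rank_two x y) = g (rank_two x y)"
  shows "f \<mu> = g \<mu>"
proof -
  interpret f: bounded_linear f by fact
  interpret g: bounded_linear g by fact
  have "f \<nu> = g \<nu>" if "\<nu> \<in> span (range (case_prod rank_two))" for \<nu>
    by (rule linear_eq_on[OF f.linear g.linear that]) (use eq in auto)
  then have "span (range (case_prod rank_two)) \<subseteq> {\<mu>. f \<mu> = g \<mu>}" by blast
  moreover have "closed {\<mu>. f \<mu> = g \<mu>}"
    by (intro closed_Collect_eq f.continuous_on g.continuous_on continuous_intros)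
  ultimately have "closure (span (range (case_prod rank_two))) \<subseteq> {\<mu>. f \<mu> = g \<mu>}" by (rule closure_minimal)
  then show ?thesis unfolding closure_span_rank_two by blast
qed

subsection \<open>Duality\<close>

text \<open>The adjoint of the Bessel inequality: <u, u> is the sum of c i <x i, u>, Cauchy-Schwarz
  and Bessel bound it by C times the norm of u, and one factor cancels.\<close>

lemma norm_bessel_sum_le:
  assumes x: "bessel F x"
  shows "(norm (\<Sum>i\<in>F. c i *\<^sub>C x i))\<^sup>2 \<le> (\<Sum>i\<in>F. (cmod (c i))\<^sup>2)"
proof -
  define u where "u = (\<Sum>i\<in>F. c i *\<^sub>C x i)"
  define C where "C = L2_set (\<lambda>i. cmod (c i)) F"
  have "(norm u)\<^sup>2 = cmod (cinner u u)" by (simp add: cinner_self norm_power)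
  also have "cinner u u = (\<Sum>i\<in>F. c i * cinner (x i) u)"
    by (subst (1) u_def) (simp add: cinner_sum_left cinner_scaleC_left)
  also have "cmod \<dots> \<le> (\<Sum>i\<in>F. \<bar>cmod (c i)\<bar> * \<bar>cmod (cinner u (x i))\<bar>)"
    by (rule order_trans[OF norm_sum]) (simp add: norm_mult cinner_commute[of u])
  also have "\<dots> \<le> C * L2_set (\<lambda>i. cmod (cinner u (x i))) F" unfolding C_def by (rule L2_set_mult_ineq)
  also have "\<dots> \<le> C * norm u"
    using x by (intro mult_left_mono) (auto simp: C_def L2_set_nonneg L2_set_def bessel_def intro!: real_le_lsqrt sum_nonneg)
  finally have "norm u \<le> C"
    by (cases "u = 0") (auto simp: power2_eq_square C_def L2_set_nonneg)
  then have "(norm u)\<^sup>2 \<le> C\<^sup>2" by (intro power_mono) auto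
  also have "C\<^sup>2 = (\<Sum>i\<in>F. (cmod (c i))\<^sup>2)" by (simp add: C_def L2_set_def sum_nonneg)
  finally show ?thesis by (simp add: u_def)
qed

text \<open>By the bound on x the image of z has norm at most the l2 norm of the numbers <z, y i>;
  exchanging the sums over i and over test vectors applies Bessel's inequality to each y i. The
  third bound is that of the adjoint.\<close>

lemma hilbert_schmidt_sum_rank_one:
  fixes x y :: "'i \<Rightarrow> 'a::complex_hilbert_space"
  assumes x: "bessel F x"
  shows "hilbert_schmidt (\<Sum>i\<in>F. rank_one (x i) (y i))"
    "hs_norm (\<Sum>i\<in>F. rank_one (x i) (y i)) \<le> L2_set (\<lambda>i. norm (y i)) F"
    "hs_norm (\<Sum>i\<in>F. rank_one (y i) (x i)) \<le> L2_set (\<lambda>i. norm (y i)) F"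
proof -
  let ?W = "\<Sum>i\<in>F. rank_one (x i) (y i)"
  have cW: "clinear_op ?W"
    by (induction F rule: infinite_finite_induct) (auto simp: clinear_op_zero clinear_op_add clinear_op_rank_one)
  have b: "(\<Sum>j\<in>G. (norm (?W (z j)))\<^sup>2) \<le> (L2_set (\<lambda>i. norm (y i)) F)\<^sup>2" if z: "bessel G z" for G :: "'a set" and z
  proof -
    have "(\<Sum>j\<in>G. (norm (?W (z j)))\<^sup>2) \<le> (\<Sum>j\<in>G. \<Sum>i\<in>F. (cmod (cinner (z j) (y i)))\<^sup>2)"
      unfolding blinfun.sum_left rank_one_apply by (intro sum_mono norm_bessel_sum_le[OF x])
    also have "\<dots> = (\<Sum>i\<in>F. \<Sum>j\<in>G. (cmod (cinner (y i) (z j)))\<^sup>2)"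
      by (subst sum.swap, subst cinner_commute) simp
    also have "\<dots> \<le> (\<Sum>i\<in>F. (norm (y i))\<^sup>2)" using z by (intro sum_mono) (auto simp: bessel_def)
    also have "\<dots> = (L2_set (\<lambda>i. norm (y i)) F)\<^sup>2" by (simp add: L2_set_def sum_nonneg)
    finally show ?thesis .
  qed
  note * = hilbert_schmidtI[OF cW L2_set_nonneg b]
  show h: "hilbert_schmidt ?W" "hs_norm ?W \<le> L2_set (\<lambda>i. norm (y i)) F" by (rule *; assumption)+
  have "cadjoint ?W = (\<Sum>i\<in>F. rank_one (y i) (x i))"
    by (rule cadjoint_eqI) (simp add: blinfun.sum_left cinner_sum_left cinner_sum_right cinner_rank_one)
  then show "hs_norm (\<Sum>i\<in>F. rank_one (y i) (x i)) \<le> L2_set (\<lambda>i. norm (y i)) F"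
    using hilbert_schmidt_cadjoint(2)[OF h(1)] h(2) by simp
qed

lemma hs_norm_uminus: "hs_norm (- T) = hs_norm T"
  by (simp add: hs_norm_def blinfun.minus_left)

text \<open>These elements have off-diagonal blocks only, two of them, whence the factor 2. The
  bound by the l2 norm of y, independent of the number of terms, is what forces the Hilbert-Schmidt
  condition in \<open>ures_predual_dual\<close>.\<close>

lemma norm_sum_rank_two_le:
  fixes x y :: "'i \<Rightarrow> 'h::polarized_hilbert_space"
  assumes x: "bessel F x"
  shows "norm (\<Sum>i\<in>F. rank_two (proj_minus (x i)) (proj_plus (y i))) \<le> 2 * L2_set (\<lambda>i. norm (y i)) F"
proof -
  let ?x = "\<lambda>i. proj_minus (x i)" and ?y = "\<lambda>i. proj_plus (y i)"
  have z: "rank_one 0 v = 0" "rank_one v 0 = 0" for v :: 'h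
    by (auto intro!: blinfun_eqI simp: rank_one_apply)
  have bx: "bessel F ?x" by (rule is_projection_bessel[OF is_projection_proj(2) x])
  have b: "block proj_plus proj_plus (op_of (\<Sum>i\<in>F. rank_two (?x i) (?y i))) = 0"
    "block proj_minus proj_minus (op_of (\<Sum>i\<in>F. rank_two (?x i) (?y i))) = 0"
    "block proj_plus proj_minus (op_of (\<Sum>i\<in>F. rank_two (?x i) (?y i))) = - (\<Sum>i\<in>F. rank_one (?y i) (?x i))"
    "block proj_minus proj_plus (op_of (\<Sum>i\<in>F. rank_two (?x i) (?y i))) = (\<Sum>i\<in>F. rank_one (?x i) (?y i))"
    unfolding op_of_sum op_of_rank_two block_sum block_diff block_proj_rank_one
    by (simp_all add: proj_idem z sum_negf)
  have "L2_set (\<lambda>i. norm (?y i)) F \<le> L2_set (\<lambda>i. norm (y i)) F"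
    by (intro L2_set_mono is_projection_norm_le is_projection_proj) auto
  then show ?thesis
    unfolding norm_ures_predual_def b hs_norm_uminus
    using hilbert_schmidt_sum_rank_one(2,3)[OF bx, of ?y] by (simp add: trace_class_zero)
qed

text \<open>Riesz representation needs complex linear functionals while b is real, so it is applied
  to the functional with real part b x. Skewness of b makes the operator skew, and the relation of b
  to i makes it commute with i.\<close>

lemma skew_form_representation:
  fixes b :: "'a::complex_hilbert_space \<Rightarrow> 'a \<Rightarrow> real"
  assumes b: "bounded_bilinear b" and K: "\<And>x y. \<bar>b x y\<bar> \<le> K * norm x * norm y" and K0: "0 \<le> K"
    and skew: "\<And>x y. b y x = - b x y" and im: "\<And>x y. b (\<i> *\<^sub>C x) y = - b x (\<i> *\<^sub>C y)"
  obtains A :: "'a \<Rightarrow>\<^sub>L 'a" where "clinear_op A" "\<And>x y. cinner (A x) y = - cinner x (A y)"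
    "\<And>x y. inner (A x) y = b x y" "norm A \<le> K"
proof -
  interpret b: bounded_bilinear b by fact
  have ii: "\<i> *\<^sub>C \<i> *\<^sub>C x = - x" for x :: 'a
    by (simp add: scaleC_scaleC complex_vector.scale_minus_left)
  have cR: "c *\<^sub>C x = Re c *\<^sub>R x + Im c *\<^sub>R (\<i> *\<^sub>C x)" for c and x :: 'a
    by (subst (1) complex_eq)
      (simp add: scaleC_add_left scaleC_scaleC mult.commute flip: scaleC_of_real)
  have "\<exists>z. \<forall>y. inner z y = b x y" for x
  proof -
    \<comment> \<open>The unique complex linear functional whose real part is b x.\<close>
    define \<psi> where "\<psi> y = complex_of_real (b x y) - \<i> * complex_of_real (b x (\<i> *\<^sub>C y))" for y
    have "bounded_linear \<psi>"
      unfolding \<psi>_def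
      by (intro bounded_linear_intros bounded_linear_sub bounded_linear_compose[OF bounded_linear_of_real]
          bounded_linear_const_mult b.bounded_linear_right
          bounded_linear_compose[OF b.bounded_linear_right bounded_linear_scaleC])
    moreover have "\<psi> (c *\<^sub>C y) = c * \<psi> y" for c y
      by (subst cR[of c y])
        (simp add: \<psi>_def b.add_right b.scaleR_right scaleC_add_right scaleC_scaleR_commute ii b.minus_right b.diff_right
          complex_eq_iff algebra_simps)
    ultimately obtain z where z: "\<And>y. \<psi> y = cinner y z" using riesz[of \<psi>] by blast
    have "inner z y = b x y" for y
      using arg_cong[OF z[of y], of Re] by (simp add: \<psi>_def Re_cinner inner_commute)
    then show ?thesis by blast
  qed
  then obtain a where a: "\<And>x y. inner (a x) y = b x y" by metis
  have eqI: "u = v" if "\<And>y. inner u y = inner v y" for u v :: 'a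
  proof -
    have "inner (u - v) (u - v) = 0" using that by (simp add: inner_diff_left)
    then show ?thesis by simp
  qed
  have "norm (a x) \<le> norm x * K" for x
  proof (cases "a x = 0")
    case False
    have "(norm (a x))\<^sup>2 = b x (a x)" by (simp add: power2_norm_eq_inner a)
    also have "\<dots> \<le> K * norm x * norm (a x)" using K[of x "a x"] by simp
    finally show ?thesis using False by (simp add: power2_eq_square mult.commute)
  qed (simp add: K0)
  then have "bounded_linear a"
    by (intro bounded_linear_intro[where K=K] eqI) (auto simp: a inner_add_left b.add_left b.scaleR_left)
  define A where "A = Blinfun a"
  have A: "A x = a x" for x unfolding A_def by (simp add: bounded_linear_Blinfun_apply \<open>bounded_linear a\<close>)
  \<comment> \<open>Multiplication by i is skew for the real inner product, which matches the
    assumption on b.\<close>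
  have inner_i: "inner (\<i> *\<^sub>C u) v = - inner u (\<i> *\<^sub>C v)" for u v :: 'a
    by (simp add: Re_cinner[symmetric] cinner_scaleC_left cinner_scaleC_right)
  have Ai: "A (\<i> *\<^sub>C x) = \<i> *\<^sub>C A x" for x
    by (rule eqI) (simp add: A a im inner_i)
  have cA: "clinear_op A"
    unfolding clinear_op_def by (intro allI, subst (1 2) cR) (simp add: blinfun.bilinear_simps Ai)
  have sk: "inner (A x) y = - inner x (A y)" for x y
    using skew[of y x] by (simp add: A a inner_commute[of x])
  have "cinner (A x) y = - cinner x (A y)" for x y
  proof (rule complex_eqI)
    have im: "Im (cinner u v) = inner u (\<i> *\<^sub>C v)" for u v :: 'a
      by (simp add: Re_cinner[symmetric] cinner_scaleC_right)
    show "Re (cinner (A x) y) = Re (- cinner x (A y))" by (simp add: Re_cinner sk)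
    show "Im (cinner (A x) y) = Im (- cinner x (A y))" by (simp add: im sk Ai)
  qed
  moreover have "norm A \<le> K"
    by (rule norm_blinfun_bound[OF K0]) (use \<open>\<And>x. norm (a x) \<le> norm x * K\<close> in \<open>simp add: A mult.commute\<close>)
  ultimately show ?thesis using that[of A] cA A a by metis
qed

text \<open>Values on rank two elements give a bounded operator A. Its off-diagonal block B is
  Hilbert-Schmidt by testing \<phi> on finite sums built from x i and B (x i): the value is
  quadratic in the l2 norm s of the images, the norm of the test element only linear. The constant 6
  is 4 for the operator norm and 1 for each off-diagonal block.\<close>

theorem ures_predual_dual:
  fixes \<phi> :: "'h::polarized_hilbert_space ures_predual \<Rightarrow>\<^sub>L real"
  obtains A where "A \<in> ures" "\<And>\<mu>. \<phi> \<mu> = ures_pairing \<mu> A" "restricted_norm A \<le> 6 * norm \<phi>"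
proof -
  \<comment> \<open>The division by 2 undoes the factor in \<open>ures_pairing_rank_two\<close>;
    with the 8 in \<open>norm_rank_two_le\<close> it gives the bound 4.\<close>
  define b where "b x y = \<phi> (rank_two x y) / 2" for x y
  have K: "\<bar>b x y\<bar> \<le> (4 * norm \<phi>) * norm x * norm y" for x y
  proof -
    have "\<bar>\<phi> (rank_two x y)\<bar> \<le> norm \<phi> * (8 * (norm x * norm y))"
      using norm_blinfun[of \<phi> "rank_two x y"] mult_left_mono[OF norm_rank_two_le[of x y] norm_ge_zero[of \<phi>]]
      by simp
    then show ?thesis by (simp add: b_def)
  qed
  have bb: "bounded_bilinear b"
  proof (standard; (intro exI allI)?)
    show "norm (b x y) \<le> norm x * norm y * (4 * norm \<phi>)" for x y using K[of x y] by (simp add: mult_ac)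
  qed (simp_all add: b_def rank_two_linear(1-4) blinfun.bilinear_simps add_divide_distrib)
  have sk: "b y x = - b x y" and im: "b (\<i> *\<^sub>C x) y = - b x (\<i> *\<^sub>C y)" for x y
    by (simp_all add: b_def rank_two_linear(5)[of y x] rank_two_linear(6) blinfun.bilinear_simps)
  have K0: "0 \<le> 4 * norm \<phi>" by simp
  obtain A where A: "clinear_op A" "\<And>x y. cinner (A x) y = - cinner x (A y)"
    "\<And>x y. inner (A x) y = b x y" "norm A \<le> 4 * norm \<phi>"
    using skew_form_representation[OF bb K K0 sk im] by blast
  let ?B = "block proj_plus proj_minus A"
  have bd: "(\<Sum>i\<in>F. (norm (?B (x i)))\<^sup>2) \<le> (norm \<phi>)\<^sup>2" if x: "bessel F x" for F :: "'h set" and x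
  proof -
    \<comment> \<open>The images themselves are the test vectors, so that each term contributes a
      multiple of its squared norm.\<close>
    define y where "y i = ?B (x i)" for i
    define s where "s = L2_set (\<lambda>i. norm (y i)) F"
    have s2: "s\<^sup>2 = (\<Sum>i\<in>F. (norm (y i))\<^sup>2)" by (simp add: s_def L2_set_def sum_nonneg)
    have "inner (A (proj_minus (x i))) (proj_plus (y i)) = (norm (y i))\<^sup>2" for i
      unfolding Re_cinner[symmetric] by (simp add: proj_plus(3)[symmetric] y_def block_apply cinner_self)
    then have "\<phi> (rank_two (proj_minus (x i)) (proj_plus (y i))) = 2 * (norm (y i))\<^sup>2" for i
      using A(3)[of "proj_minus (x i)" "proj_plus (y i)"] by (simp add: b_def)
    then have "2 * s\<^sup>2 = \<phi> (\<Sum>i\<in>F. rank_two (proj_minus (x i)) (proj_plus (y i)))"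
      by (simp add: s2 blinfun.sum_right sum_distrib_left)
    also have "\<dots> \<le> norm \<phi> * norm (\<Sum>i\<in>F. rank_two (proj_minus (x i)) (proj_plus (y i)))"
      using norm_blinfun[of \<phi>] by (metis abs_le_iff real_norm_def)
    also have "\<dots> \<le> norm \<phi> * (2 * s)"
      unfolding s_def by (intro mult_left_mono norm_sum_rank_two_le x) simp
    finally have "s * s \<le> norm \<phi> * s" by (simp add: power2_eq_square)
    moreover have "0 \<le> s" by (simp add: s_def L2_set_nonneg)
    ultimately have "s \<le> norm \<phi>" by (cases "s = 0") auto
    then have "s\<^sup>2 \<le> (norm \<phi>)\<^sup>2" by (intro power_mono) (auto simp: s_def L2_set_nonneg)
    then show ?thesis unfolding s2 y_def .
  qed
  note cB = clinear_op_block[OF is_projection_proj(1,2) A(1)]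
  have B: "hilbert_schmidt ?B" "hs_norm ?B \<le> norm \<phi>"
    by (rule hilbert_schmidtI[OF cB norm_ge_zero bd]; assumption)+
  have adj: "cadjoint ?B = - block proj_minus proj_plus A"
    by (rule cadjoint_eqI)
      (simp add: block_apply blinfun.bilinear_simps proj_plus(3) proj_minus(3) A(2) cinner_minus_right)
  have C: "hilbert_schmidt (block proj_minus proj_plus A)" "hs_norm (block proj_minus proj_plus A) \<le> norm \<phi>"
    using hilbert_schmidt_cadjoint[OF B(1)] B(2) hilbert_schmidt_scaleR(1)[of "cadjoint ?B" "-1"]
    by (simp_all add: adj hs_norm_uminus)
  have Au: "A \<in> ures" using A B C by (simp add: ures_iff)
  moreover have "\<phi> \<mu> = ures_pairing \<mu> A" for \<mu>
  proof (rule bounded_linear_eq_rank_two[OF blinfun.bounded_linear_right bounded_linear_ures_pairing[OF Au]])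
    show "\<phi> (rank_two x y) = ures_pairing (rank_two x y) A" for x y
      using A(3)[of x y] by (simp add: ures_pairing_rank_two[OF Au] b_def)
  qed
  moreover have "restricted_norm A \<le> 6 * norm \<phi>"
    using A(4) B(2) C(2) unfolding restricted_norm_def by linarith
  ultimately show ?thesis using that by blast
qed

definition ures_rep :: "('h::polarized_hilbert_space ures_predual \<Rightarrow>\<^sub>L real) \<Rightarrow> ('h \<Rightarrow>\<^sub>L 'h)" where
  "ures_rep \<phi> = (THE A. A \<in> ures \<and> (\<forall>\<mu>. \<phi> \<mu> = ures_pairing \<mu> A))"

lemma ures_rep_eqI:
  fixes \<phi> :: "'h::polarized_hilbert_space ures_predual \<Rightarrow>\<^sub>L real"
  assumes "A \<in> ures" "\<And>\<mu>. \<phi> \<mu> = ures_pairing \<mu> A"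
  shows "ures_rep \<phi> = A"
  unfolding ures_rep_def
proof (rule the_equality)
  show "B = A" if "B \<in> ures \<and> (\<forall>\<mu>. \<phi> \<mu> = ures_pairing \<mu> B)" for B
    using that assms by (intro ures_eqI) auto
qed (use assms in blast)

lemma ures_rep:
  "ures_rep \<phi> \<in> ures" "\<phi> \<mu> = ures_pairing \<mu> (ures_rep \<phi>)" "restricted_norm (ures_rep \<phi>) \<le> 6 * norm \<phi>"
  by (rule ures_predual_dual[of \<phi>]; metis ures_rep_eqI)+

section \<open>Smooth functions\<close>

abbreviation prod_norm :: "'a::real_normed_vector list \<Rightarrow> real" where
  "prod_norm hs \<equiv> prod_list (map norm hs)"

lemma prod_norm_nonneg: "0 \<le> prod_norm hs"
  by (induction hs) auto

definition list_multilinear :: "('b::real_vector list \<Rightarrow> 'c::real_vector) \<Rightarrow> bool" where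
  "list_multilinear F \<longleftrightarrow> (\<forall>us vs. linear (\<lambda>h. F (us @ h # vs)))"

text \<open>The order is read off from the length of the list, so one function D carries the
  derivatives of all orders and the index n of \<open>smooth\<close> disappears.\<close>

definition derivative_family ::
  "('b::real_normed_vector \<Rightarrow> 'c::real_normed_vector) \<Rightarrow> ('b \<Rightarrow> 'b list \<Rightarrow> 'c) \<Rightarrow> bool" where
  "derivative_family f D \<longleftrightarrow> (\<forall>x. D x [] = f x) \<and> (\<forall>x. list_multilinear (D x)) \<and>
    (\<forall>n x. \<exists>C. \<forall>hs. length hs = n \<longrightarrow> norm (D x hs) \<le> C * prod_norm hs) \<and>
    (\<forall>n x. \<forall>\<epsilon>>0. \<exists>\<delta>>0. \<forall>h. norm h < \<delta> \<longrightarrow> (\<forall>hs. length hs = n \<longrightarrow>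
      norm (D (x + h) hs - D x hs - D x (h # hs)) \<le> \<epsilon> * norm h * prod_norm hs))"

lemma smooth_iff_derivative_family: "smooth f \<longleftrightarrow> (\<exists>D. derivative_family f D)"
proof
  assume "smooth f"
  then obtain D where D: "\<And>x. D 0 x [] = f x" "\<And>n x. bounded_multilinear n (D n x)"
    "\<And>n x \<epsilon>. 0 < \<epsilon> \<Longrightarrow> \<exists>\<delta>>0. \<forall>h. norm h < \<delta> \<longrightarrow> (\<forall>hs. length hs = n \<longrightarrow>
      norm (D n (x + h) hs - D n x hs - D (Suc n) x (h # hs)) \<le> \<epsilon> * norm h * prod_norm hs)"
    unfolding smooth_def by blast
  have "derivative_family f (\<lambda>x hs. D (length hs) x hs)"
    unfolding derivative_family_def list_multilinear_def
  proof (intro conjI allI impI)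
    show "linear (\<lambda>h. D (length (us @ h # vs)) x (us @ h # vs))" for x us vs
      using D(2)[of "length us + length vs + 1" x] unfolding bounded_multilinear_def by simp
    show "\<exists>C. \<forall>hs. length hs = n \<longrightarrow> norm (D (length hs) x hs) \<le> C * prod_norm hs" for n x
      using D(2)[of n x] unfolding bounded_multilinear_def by auto
    show "\<exists>\<delta>>0. \<forall>h. norm h < \<delta> \<longrightarrow> (\<forall>hs. length hs = n \<longrightarrow>
      norm (D (length hs) (x + h) hs - D (length hs) x hs - D (length (h # hs)) x (h # hs))
        \<le> \<epsilon> * norm h * prod_norm hs)" if "0 < \<epsilon>" for n x \<epsilon>
      using D(3)[OF that, of n x] by auto
  qed (simp add: D(1))
  then show "\<exists>D. derivative_family f D" by blast
next
  assume "\<exists>D. derivative_family f D"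
  then obtain D where D: "derivative_family f D" by blast
  show "smooth f"
    unfolding smooth_def bounded_multilinear_def
    by (rule exI[of _ "\<lambda>n. D"]) (use D in \<open>auto simp: derivative_family_def list_multilinear_def\<close>)
qed

lemma derivative_family_linear:
  "derivative_family f D \<Longrightarrow> linear (\<lambda>h. D x (us @ h # vs))"
  by (simp add: derivative_family_def list_multilinear_def)

text \<open>One constant for all orders up to n, since product rules mix lists of different
  lengths.\<close>

lemma derivative_family_bound:
  assumes "derivative_family f D"
  obtains C where "0 \<le> C" "\<And>hs. length hs \<le> n \<Longrightarrow> norm (D x hs) \<le> C * prod_norm hs"
proof -
  have ex: "\<forall>n x. \<exists>C. \<forall>hs. length hs = n \<longrightarrow> norm (D x hs) \<le> C * prod_norm hs"
    using assms unfolding derivative_family_def by (elim conjE)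
  have "\<exists>C\<ge>0. \<forall>hs. length hs \<le> n \<longrightarrow> norm (D x hs) \<le> C * prod_norm hs"
  proof (induction n)
    case 0
    show ?case by (rule exI[of _ "norm (D x [])"]) auto
  next
    case (Suc n)
    then obtain C where C: "0 \<le> C" "\<And>hs. length hs \<le> n \<Longrightarrow> norm (D x hs) \<le> C * prod_norm hs" by blast
    obtain C' where C': "\<And>hs. length hs = Suc n \<Longrightarrow> norm (D x hs) \<le> C' * prod_norm hs"
      using ex[rule_format, of "Suc n" x] by blast
    have "norm (D x hs) \<le> max C C' * prod_norm hs" if "length hs \<le> Suc n" for hs
    proof (cases "length hs = Suc n")
      case True
      then show ?thesis
        using C'[OF True] mult_right_mono[OF max.cobounded2[of C' C] prod_norm_nonneg[of hs]] by linarith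
    next
      case False
      with that have "length hs \<le> n" by simp
      then show ?thesis
        using C(2)[of hs] mult_right_mono[OF max.cobounded1[of C C'] prod_norm_nonneg[of hs]] by linarith
    qed
    then show ?case using C(1) by (intro exI[of _ "max C C'"]) auto
  qed
  then show ?thesis using that by blast
qed

text \<open>As for the bounds, one radius has to serve all orders up to n.\<close>

lemma derivative_family_approx:
  assumes "derivative_family f D" "0 < \<epsilon>"
  obtains \<delta> where "0 < \<delta>" "\<And>h hs. norm h < \<delta> \<Longrightarrow> length hs \<le> n \<Longrightarrow>
      norm (D (x + h) hs - D x hs - D x (h # hs)) \<le> \<epsilon> * norm h * prod_norm hs"
proof -
  have ex: "\<exists>\<delta>>0. \<forall>h. norm h < \<delta> \<longrightarrow> (\<forall>hs. length hs = n \<longrightarrow>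
      norm (D (x + h) hs - D x hs - D x (h # hs)) \<le> \<epsilon> * norm h * prod_norm hs)" for n
    using assms unfolding derivative_family_def by blast
  have "\<exists>\<delta>>0. \<forall>h. norm h < \<delta> \<longrightarrow> (\<forall>hs. length hs \<le> n \<longrightarrow>
      norm (D (x + h) hs - D x hs - D x (h # hs)) \<le> \<epsilon> * norm h * prod_norm hs)"
  proof (induction n)
    case 0
    show ?case using ex[of 0] by auto
  next
    case (Suc n)
    then obtain \<delta> where \<delta>: "0 < \<delta>" "\<And>h hs. norm h < \<delta> \<Longrightarrow> length hs \<le> n \<Longrightarrow>
      norm (D (x + h) hs - D x hs - D x (h # hs)) \<le> \<epsilon> * norm h * prod_norm hs" by blast
    obtain \<delta>' where \<delta>': "0 < \<delta>'" "\<And>h hs. norm h < \<delta>' \<Longrightarrow> length hs = Suc n \<Longrightarrow>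
      norm (D (x + h) hs - D x hs - D x (h # hs)) \<le> \<epsilon> * norm h * prod_norm hs" using ex[of "Suc n"] by blast
    show ?case using \<delta> \<delta>' by (intro exI[of _ "min \<delta> \<delta>'"]) (auto simp: le_Suc_eq)
  qed
  then show ?thesis using that by blast
qed

lemma derivative_family_has_derivative:
  assumes D: "derivative_family f D"
  shows "(f has_derivative (\<lambda>h. D x [h])) (at x)"
  unfolding has_derivative_at_alt
proof (intro conjI allI impI)
  obtain C where C: "\<And>hs. length hs \<le> 1 \<Longrightarrow> norm (D x hs) \<le> C * prod_norm hs"
    using derivative_family_bound[OF D] by blast
  have "linear (\<lambda>h. D x ([] @ h # []))" by (rule derivative_family_linear[OF D])
  then show "bounded_linear (\<lambda>h. D x [h])"
    using C[of "[_]"]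
    by (intro bounded_linear.intro bounded_linear_axioms.intro exI[of _ C]) (auto simp: mult.commute)
  fix e :: real assume e: "0 < e"
  obtain \<delta> where \<delta>: "0 < \<delta>" "\<And>h hs. norm h < \<delta> \<Longrightarrow> length hs \<le> 0 \<Longrightarrow>
      norm (D (x + h) hs - D x hs - D x (h # hs)) \<le> e * norm h * prod_norm hs"
    using derivative_family_approx[OF D e] by blast
  have "D y [] = f y" for y using D by (simp add: derivative_family_def)
  then show "\<exists>d>0. \<forall>y. norm (y - x) < d \<longrightarrow> norm (f y - f x - D x [y - x]) \<le> e * norm (y - x)"
    using \<delta>(1) \<delta>(2)[of "_ - x" "[]"] by (intro exI[of _ \<delta>]) auto
qed

subsection \<open>The product rule of all orders\<close>

text \<open>The head of the list is the newest direction, so it falls on either of the two factors.\<close>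

fun leibniz :: "('c \<Rightarrow> 'd \<Rightarrow> 'e::plus) \<Rightarrow> ('b list \<Rightarrow> 'c) \<Rightarrow> ('b list \<Rightarrow> 'd) \<Rightarrow> 'b list \<Rightarrow> 'e" where
  "leibniz B F G [] = B (F []) (G [])"
| "leibniz B F G (h # hs) = leibniz B (\<lambda>l. F (h # l)) G hs + leibniz B F (\<lambda>l. G (h # l)) hs"

context bounded_bilinear
begin

lemma leibniz_add_left: "leibniz prod (\<lambda>l. F l + F' l) G hs = leibniz prod F G hs + leibniz prod F' G hs"
  by (induction hs arbitrary: F F' G) (simp_all add: add_left)

lemma leibniz_add_right: "leibniz prod F (\<lambda>l. G l + G' l) hs = leibniz prod F G hs + leibniz prod F G' hs"
  by (induction hs arbitrary: F G G') (simp_all add: add_right)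

lemma leibniz_diff_left: "leibniz prod (\<lambda>l. F l - F' l) G hs = leibniz prod F G hs - leibniz prod F' G hs"
  by (induction hs arbitrary: F F' G) (simp_all add: diff_left)

lemma leibniz_diff_right: "leibniz prod F (\<lambda>l. G l - G' l) hs = leibniz prod F G hs - leibniz prod F G' hs"
  by (induction hs arbitrary: F G G') (simp_all add: diff_right)

lemma leibniz_scaleR_left: "leibniz prod (\<lambda>l. r *\<^sub>R F l) G hs = r *\<^sub>R leibniz prod F G hs"
  by (induction hs arbitrary: F G) (simp_all add: scaleR_left scaleR_add_right)

lemma leibniz_scaleR_right: "leibniz prod F (\<lambda>l. r *\<^sub>R G l) hs = r *\<^sub>R leibniz prod F G hs"
  by (induction hs arbitrary: F G) (simp_all add: scaleR_right scaleR_add_right)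

lemma list_multilinear_leibniz:
  assumes "list_multilinear F" "list_multilinear G"
  shows "list_multilinear (leibniz prod F G)"
  unfolding list_multilinear_def
proof (intro allI)
  fix us vs
  \<comment> \<open>Fixing the first direction preserves multilinearity; the induction step uses
    this in either factor.\<close>
  have tail: "list_multilinear (\<lambda>l. F (h # l))" if "list_multilinear F" for F :: "'x::real_vector list \<Rightarrow> 'y::real_vector" and h
    unfolding list_multilinear_def
  proof (intro allI)
    show "linear (\<lambda>k. F (h # us @ k # vs))" for us vs
      using that[unfolded list_multilinear_def, rule_format, of "h # us" vs] by simp
  qed
  show "linear (\<lambda>h. leibniz prod F G (us @ h # vs))"
    using assms
  proof (induction us arbitrary: F G)
    case Nil
    have F: "F ((h + k) # l) = F (h # l) + F (k # l)" "F ((r *\<^sub>R h) # l) = r *\<^sub>R F (h # l)" for h k l r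
      using linear_add[OF Nil(1)[unfolded list_multilinear_def, rule_format, of "[]" l], of h k]
        linear_scale[OF Nil(1)[unfolded list_multilinear_def, rule_format, of "[]" l], of r h] by simp_all
    have G: "G ((h + k) # l) = G (h # l) + G (k # l)" "G ((r *\<^sub>R h) # l) = r *\<^sub>R G (h # l)" for h k l r
      using linear_add[OF Nil(2)[unfolded list_multilinear_def, rule_format, of "[]" l], of h k]
        linear_scale[OF Nil(2)[unfolded list_multilinear_def, rule_format, of "[]" l], of r h] by simp_all
    show ?case
      by (rule linearI)
        (simp_all add: F G leibniz_add_left leibniz_add_right leibniz_scaleR_left leibniz_scaleR_right scaleR_add_right)
  next
    case (Cons u us)
    show ?case
      using linear_compose_add[OF Cons.IH[OF tail[OF Cons.prems(1), of u] Cons.prems(2)]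
          Cons.IH[OF Cons.prems(1) tail[OF Cons.prems(2), of u]]] by simp
  qed
qed

text \<open>The power of 2 counts the ways to distribute the directions. The constants a and b vary
  in the induction, because fixing a direction h in a factor multiplies its constant by the norm of
  h.\<close>

lemma norm_leibniz_le:
  assumes K: "0 \<le> K" "\<And>a b. norm (prod a b) \<le> norm a * norm b * K"
    and "0 \<le> a" "0 \<le> b"
    and "\<And>l. length l \<le> length hs \<Longrightarrow> norm (F l) \<le> a * prod_norm l"
    and "\<And>l. length l \<le> length hs \<Longrightarrow> norm (G l) \<le> b * prod_norm l"
  shows "norm (leibniz prod F G hs) \<le> 2 ^ length hs * (a * b * K) * prod_norm hs"
  using assms(3-)
proof (induction hs arbitrary: F G a b)
  case Nil
  have "norm (F []) * norm (G []) * K \<le> a * b * K"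
    using Nil(3)[of "[]"] Nil(4)[of "[]"] K(1) Nil(1) by (intro mult_right_mono mult_mono) auto
  then show ?case using K(2)[of "F []" "G []"] by simp
next
  case (Cons h hs)
  have F: "norm (F (h # l)) \<le> (a * norm h) * prod_norm l" if "length l \<le> length hs" for l
    using Cons.prems(3)[of "h # l"] that by (simp add: mult_ac)
  have G: "norm (G (h # l)) \<le> (b * norm h) * prod_norm l" if "length l \<le> length hs" for l
    using Cons.prems(4)[of "h # l"] that by (simp add: mult_ac)
  have "norm (leibniz prod (\<lambda>l. F (h # l)) G hs) \<le> 2 ^ length hs * ((a * norm h) * b * K) * prod_norm hs"
    by (rule Cons.IH[OF _ _ F]) (use Cons.prems in auto)
  moreover have "norm (leibniz prod F (\<lambda>l. G (h # l)) hs) \<le> 2 ^ length hs * (a * (b * norm h) * K) * prod_norm hs"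
    by (rule Cons.IH[OF _ _ _ G]) (use Cons.prems in auto)
  ultimately have "norm (leibniz prod F G (h # hs)) \<le> 2 ^ length hs * ((a * norm h) * b * K) * prod_norm hs
      + 2 ^ length hs * (a * (b * norm h) * K) * prod_norm hs"
    unfolding leibniz.simps by (rule order_trans[OF norm_triangle_ineq add_mono])
  also have "\<dots> = 2 ^ length (h # hs) * (a * b * K) * prod_norm (h # hs)" by (simp add: algebra_simps)
  finally show ?case .
qed

text \<open>The remainder of a product is split as for the first derivative: remainder of F against
  the shifted G, F against the remainder of G, and derivative of F against the increment of G. Since
  \<open>leibniz\<close> is bilinear in its families, this works for all orders at once.\<close>

lemma derivative_family_leibniz:
  fixes f :: "'x::real_normed_vector \<Rightarrow> 'a" and g :: "'x \<Rightarrow> 'b"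
  assumes F: "derivative_family f F" and G: "derivative_family g G"
  shows "derivative_family (\<lambda>x. prod (f x) (g x)) (\<lambda>x. leibniz prod (F x) (G x))"
  unfolding derivative_family_def
proof (intro conjI allI impI)
  obtain K where K: "0 \<le> K" "\<And>a b. norm (prod a b) \<le> norm a * norm b * K"
    using nonneg_bounded by blast
  show "leibniz prod (F x) (G x) [] = prod (f x) (g x)" for x
    using F G by (simp add: derivative_family_def)
  show "list_multilinear (leibniz prod (F x) (G x))" for x
    using F G by (intro list_multilinear_leibniz) (auto simp: derivative_family_def)
  fix n x
  \<comment> \<open>Order n + 1 is included because \<open>h # l\<close> has one direction more than
    l.\<close>
  obtain a where a: "0 \<le> a" "\<And>l. length l \<le> Suc n \<Longrightarrow> norm (F x l) \<le> a * prod_norm l"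
    using derivative_family_bound[OF F] by blast
  obtain b where b: "0 \<le> b" "\<And>l. length l \<le> Suc n \<Longrightarrow> norm (G x l) \<le> b * prod_norm l"
    using derivative_family_bound[OF G] by blast
  show "\<exists>C. \<forall>hs. length hs = n \<longrightarrow> norm (leibniz prod (F x) (G x) hs) \<le> C * prod_norm hs"
    by (rule exI[of _ "2 ^ n * (a * b * K)"], intro allI impI)
      (use norm_leibniz_le[OF K a(1) b(1) a(2) b(2)] in auto)
  fix \<epsilon> :: real assume \<epsilon>: "0 < \<epsilon>"
  \<comment> \<open>The three error terms carry the factors b + 1, a and a, each with
    \<eta>.\<close>
  define M where "M = 2 ^ n * K * (1 + b + 2 * a)"
  have M: "0 \<le> M" using K(1) a(1) b(1) by (simp add: M_def)
  define \<eta> where "\<eta> = min 1 (\<epsilon> / (M + 1))"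
  have \<eta>: "0 < \<eta>" "\<eta> \<le> 1" "M * \<eta> \<le> \<epsilon>"
  proof -
    show "0 < \<eta>" "\<eta> \<le> 1" using \<epsilon> M by (auto simp: \<eta>_def)
    have "M * \<eta> \<le> M * (\<epsilon> / (M + 1))" using M by (intro mult_left_mono) (auto simp: \<eta>_def)
    also have "\<dots> \<le> \<epsilon>" using M \<epsilon> by (simp add: field_simps)
    finally show "M * \<eta> \<le> \<epsilon>" .
  qed
  obtain \<delta>1 where \<delta>1: "0 < \<delta>1" "\<And>h l. norm h < \<delta>1 \<Longrightarrow> length l \<le> n \<Longrightarrow>
      norm (F (x + h) l - F x l - F x (h # l)) \<le> \<eta> * norm h * prod_norm l"
    using derivative_family_approx[OF F \<eta>(1)] by blast
  obtain \<delta>2 where \<delta>2: "0 < \<delta>2" "\<And>h l. norm h < \<delta>2 \<Longrightarrow> length l \<le> n \<Longrightarrow>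
      norm (G (x + h) l - G x l - G x (h # l)) \<le> \<eta> * norm h * prod_norm l"
    using derivative_family_approx[OF G \<eta>(1)] by blast
  \<comment> \<open>The last bound makes (b + 1) times the norm of h at most \<eta>, which controls
    the increment of G.\<close>
  define \<delta> where "\<delta> = min (min \<delta>1 \<delta>2) (\<eta> / (b + 2))"
  have \<delta>: "0 < \<delta>" "\<delta> \<le> \<delta>1" "\<delta> \<le> \<delta>2" "\<delta> \<le> \<eta> / (b + 2)"
    using \<delta>1(1) \<delta>2(1) \<eta>(1) b(1) by (auto simp: \<delta>_def)
  show "\<exists>\<delta>>0. \<forall>h. norm h < \<delta> \<longrightarrow> (\<forall>hs. length hs = n \<longrightarrow>
      norm (leibniz prod (F (x + h)) (G (x + h)) hs - leibniz prod (F x) (G x) hs - leibniz prod (F x) (G x) (h # hs))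
        \<le> \<epsilon> * norm h * prod_norm hs)"
  proof (intro exI[of _ \<delta>] conjI allI impI \<delta>(1))
    fix h :: 'x and hs :: "'x list" assume h: "norm h < \<delta>" and hs: "length hs = n"
    have nn: "0 \<le> \<eta> * norm h" "0 \<le> b + 1" "0 \<le> a * norm h" "0 \<le> \<eta>"
      using a(1) b(1) \<eta>(1) by simp_all
    have bh: "(b + 1) * norm h \<le> \<eta>"
    proof -
      have "(b + 1) * norm h \<le> (b + 2) * (\<eta> / (b + 2))"
        using h \<delta>(4) b(1) by (intro mult_mono) auto
      then show ?thesis using b(1) by simp
    qed
    let ?dF = "\<lambda>l. F (x + h) l - F x l - F x (h # l)" and ?dG = "\<lambda>l. G (x + h) l - G x l - G x (h # l)"
    have dF: "norm (?dF l) \<le> (\<eta> * norm h) * prod_norm l" if "length l \<le> length hs" for l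
      using \<delta>1(2)[of h l] that h hs \<delta> by auto
    have dG: "norm (?dG l) \<le> (\<eta> * norm h) * prod_norm l" if "length l \<le> length hs" for l
      using \<delta>2(2)[of h l] that h hs \<delta> by auto
    have Fh: "norm (F x (h # l)) \<le> (a * norm h) * prod_norm l" if "length l \<le> length hs" for l
      using a(2)[of "h # l"] that hs by (simp add: mult_ac)
    have FG: "norm (F x l) \<le> a * prod_norm l" "norm (G x l) \<le> b * prod_norm l" if "length l \<le> length hs" for l
      using a(2)[of l] b(2)[of l] that hs by simp_all
    have G': "norm (G (x + h) l - G x l) \<le> \<eta> * prod_norm l" if "length l \<le> length hs" for l
    proof -
      have "norm (G (x + h) l - G x l) \<le> norm (?dG l) + norm (G x (h # l))"
        using norm_triangle_ineq[of "?dG l" "G x (h # l)"] by simp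
      also have "\<dots> \<le> (1 * norm h) * prod_norm l + (b * norm h) * prod_norm l"
        using dG[OF that] b(2)[of "h # l"] that hs
          mult_right_mono[OF mult_right_mono[OF \<eta>(2) norm_ge_zero[of h]] prod_norm_nonneg[of l]]
        by (intro add_mono) (auto simp: mult_ac)
      also have "\<dots> = ((b + 1) * norm h) * prod_norm l" by (simp add: algebra_simps)
      also have "\<dots> \<le> \<eta> * prod_norm l" by (rule mult_right_mono[OF bh prod_norm_nonneg])
      finally show ?thesis .
    qed
    have Gx: "norm (G (x + h) l) \<le> (b + 1) * prod_norm l" if "length l \<le> length hs" for l
      using norm_triangle_ineq[of "G (x + h) l - G x l" "G x l"] G'[OF that] FG(2)[OF that]
        mult_right_mono[OF \<eta>(2) prod_norm_nonneg[of l]] by (simp add: distrib_right)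
    have t1: "norm (leibniz prod ?dF (G (x + h)) hs) \<le> 2 ^ length hs * (\<eta> * norm h * (b + 1) * K) * prod_norm hs"
      by (rule norm_leibniz_le[OF K nn(1,2)]) (erule dF, erule Gx)
    have t2: "norm (leibniz prod (F x) ?dG hs) \<le> 2 ^ length hs * (a * (\<eta> * norm h) * K) * prod_norm hs"
      by (rule norm_leibniz_le[OF K a(1) nn(1)]) (erule FG, erule dG)
    have t3: "norm (leibniz prod (\<lambda>l. F x (h # l)) (\<lambda>l. G (x + h) l - G x l) hs)
        \<le> 2 ^ length hs * (a * norm h * \<eta> * K) * prod_norm hs"
      by (rule norm_leibniz_le[OF K nn(3,4)]) (erule Fh, erule G')
    have eq: "leibniz prod (F (x + h)) (G (x + h)) hs - leibniz prod (F x) (G x) hs - leibniz prod (F x) (G x) (h # hs)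
      = leibniz prod ?dF (G (x + h)) hs + leibniz prod (F x) ?dG hs
        + leibniz prod (\<lambda>l. F x (h # l)) (\<lambda>l. G (x + h) l - G x l) hs"
      unfolding leibniz.simps leibniz_diff_left leibniz_diff_right by (simp add: algebra_simps)
    have "norm (leibniz prod (F (x + h)) (G (x + h)) hs - leibniz prod (F x) (G x) hs
        - leibniz prod (F x) (G x) (h # hs)) \<le> norm (leibniz prod ?dF (G (x + h)) hs) + norm (leibniz prod (F x) ?dG hs)
        + norm (leibniz prod (\<lambda>l. F x (h # l)) (\<lambda>l. G (x + h) l - G x l) hs)"
      unfolding eq by (rule order_trans[OF norm_triangle_ineq add_right_mono[OF norm_triangle_ineq]])
    also have "\<dots> \<le> 2 ^ length hs * (\<eta> * norm h * (b + 1) * K) * prod_norm hs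
        + 2 ^ length hs * (a * (\<eta> * norm h) * K) * prod_norm hs
        + 2 ^ length hs * (a * norm h * \<eta> * K) * prod_norm hs"
      by (rule add_mono[OF add_mono[OF t1 t2] t3])
    also have "\<dots> = M * \<eta> * (norm h * prod_norm hs)"
      by (simp add: hs M_def algebra_simps)
    also have "\<dots> \<le> \<epsilon> * (norm h * prod_norm hs)"
      by (intro mult_right_mono \<eta>(3) mult_nonneg_nonneg prod_norm_nonneg norm_ge_zero)
    finally show "norm (leibniz prod (F (x + h)) (G (x + h)) hs - leibniz prod (F x) (G x) hs
        - leibniz prod (F x) (G x) (h # hs)) \<le> \<epsilon> * norm h * prod_norm hs"
      by (simp only: mult.assoc)
  qed
qed

lemma smooth_prod:
  assumes "smooth f" "smooth g"
  shows "smooth (\<lambda>x. prod (f x) (g x))"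
  using assms derivative_family_leibniz unfolding smooth_iff_derivative_family by blast

end

subsection \<open>Stability of smoothness\<close>

lemma smooth_bounded_linear_compose:
  assumes T: "bounded_linear T" and f: "smooth f"
  shows "smooth (\<lambda>x. T (f x))"
proof -
  interpret T: bounded_linear T by fact
  obtain D where D: "derivative_family f D" using f unfolding smooth_iff_derivative_family by blast
  obtain K where K: "0 < K" "\<And>x. norm (T x) \<le> norm x * K" using T.pos_bounded by blast
  have "derivative_family (\<lambda>x. T (f x)) (\<lambda>x hs. T (D x hs))"
    unfolding derivative_family_def
  proof (intro conjI allI impI)
    show "T (D x []) = T (f x)" for x using D by (simp add: derivative_family_def)
    show "list_multilinear (\<lambda>hs. T (D x hs))" for x
      using linear_compose[OF derivative_family_linear[OF D] T.linear]
      unfolding list_multilinear_def comp_def by (intro allI)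
    fix n x
    obtain C where C: "\<And>hs. length hs \<le> n \<Longrightarrow> norm (D x hs) \<le> C * prod_norm hs"
      using derivative_family_bound[OF D] by blast
    have "norm (T (D x hs)) \<le> (C * K) * prod_norm hs" if "length hs = n" for hs
    proof -
      have "norm (D x hs) * K \<le> (C * prod_norm hs) * K"
        by (intro mult_right_mono C) (use that K in auto)
      then show ?thesis using K(2)[of "D x hs"] by (simp only: mult_ac)
    qed
    then show "\<exists>C. \<forall>hs. length hs = n \<longrightarrow> norm (T (D x hs)) \<le> C * prod_norm hs" by blast
    fix \<epsilon> :: real assume \<epsilon>: "0 < \<epsilon>"
    then have "0 < \<epsilon> / K" using K(1) by simp
    then obtain \<delta> where \<delta>: "0 < \<delta>" "\<And>h hs. norm h < \<delta> \<Longrightarrow> length hs \<le> n \<Longrightarrow>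
        norm (D (x + h) hs - D x hs - D x (h # hs)) \<le> \<epsilon> / K * norm h * prod_norm hs"
      using derivative_family_approx[OF D] by blast
    have "norm (T (D (x + h) hs) - T (D x hs) - T (D x (h # hs))) \<le> \<epsilon> * norm h * prod_norm hs"
      if "norm h < \<delta>" "length hs = n" for h hs
      using K(2)[of "D (x + h) hs - D x hs - D x (h # hs)"] mult_right_mono[OF \<delta>(2)[OF that(1), of hs], of K] K(1) that
      by (simp add: T.diff)
    then show "\<exists>\<delta>>0. \<forall>h. norm h < \<delta> \<longrightarrow> (\<forall>hs. length hs = n \<longrightarrow>
        norm (T (D (x + h) hs) - T (D x hs) - T (D x (h # hs))) \<le> \<epsilon> * norm h * prod_norm hs)"
      using \<delta>(1) by blast
  qed
  then show ?thesis unfolding smooth_iff_derivative_family by blast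
qed

lemma smooth_bounded_linear:
  assumes T: "bounded_linear T"
  shows "smooth T"
proof -
  interpret T: bounded_linear T by fact
  obtain K where K: "0 < K" "\<And>x. norm (T x) \<le> norm x * K" using T.pos_bounded by blast
  define D where "D x hs = (case hs of [] \<Rightarrow> T x | [h] \<Rightarrow> T h | _ \<Rightarrow> 0)" for x hs
  have "derivative_family T D"
    unfolding derivative_family_def
  proof (intro conjI allI impI)
    show "D x [] = T x" for x by (simp add: D_def)
    show "list_multilinear (D x)" for x
      unfolding list_multilinear_def
    proof (intro allI)
      fix us vs
      show "linear (\<lambda>h. D x (us @ h # vs))"
      proof (cases "us = [] \<and> vs = []")
        case True
        then show ?thesis using T.linear by (simp add: D_def)
      next
        case False
        then have "D x (us @ h # vs) = 0" for h
          by (cases us; cases vs) (auto simp: D_def split: list.split)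
        then show ?thesis by (simp add: linear_zero)
      qed
    qed
    show "\<exists>C. \<forall>hs. length hs = n \<longrightarrow> norm (D x hs) \<le> C * prod_norm hs" for n x
    \<comment> \<open>The summand \<open>norm (T x)\<close> serves the empty list, K the lists of
      length one.\<close>
    proof (intro exI[of _ "norm (T x) + K"] allI)
      fix hs
      show "length hs = n \<longrightarrow> norm (D x hs) \<le> (norm (T x) + K) * prod_norm hs"
      proof (cases "\<exists>h. hs = [h]")
        case True
        then obtain h where h: "hs = [h]" by blast
        have "norm (T h) \<le> norm (T x) * norm h + K * norm h"
          using K(2)[of h] mult_nonneg_nonneg[OF norm_ge_zero[of "T x"] norm_ge_zero[of h]]
          unfolding mult.commute[of K] by linarith
        then show ?thesis by (simp add: h D_def distrib_right)
      next
        case False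
        then show ?thesis using K(1) prod_norm_nonneg[of hs]
          by (auto simp: D_def split: list.split)
      qed
    qed
    show "\<exists>\<delta>>0. \<forall>h. norm h < \<delta> \<longrightarrow> (\<forall>hs. length hs = n \<longrightarrow>
        norm (D (x + h) hs - D x hs - D x (h # hs)) \<le> \<epsilon> * norm h * prod_norm hs)" if "0 < \<epsilon>" for n x \<epsilon>
    proof (intro exI[of _ 1] conjI allI impI)
      fix h hs
      have "D (x + h) hs - D x hs - D x (h # hs) = 0"
        by (auto simp: D_def T.add split: list.split)
      then show "norm (D (x + h) hs - D x hs - D x (h # hs)) \<le> \<epsilon> * norm h * prod_norm hs"
        using that prod_norm_nonneg[of hs] by simp
    qed simp
  qed
  then show ?thesis unfolding smooth_iff_derivative_family by blast
qed

lemma smooth_add: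
  assumes f: "smooth f" and g: "smooth g"
  shows "smooth (\<lambda>x. f x + g x)"
proof -
  obtain F where F: "derivative_family f F" using f unfolding smooth_iff_derivative_family by blast
  obtain G where G: "derivative_family g G" using g unfolding smooth_iff_derivative_family by blast
  have "derivative_family (\<lambda>x. f x + g x) (\<lambda>x hs. F x hs + G x hs)"
    unfolding derivative_family_def
  proof (intro conjI allI impI)
    show "F x [] + G x [] = f x + g x" for x using F G by (simp add: derivative_family_def)
    show "list_multilinear (\<lambda>hs. F x hs + G x hs)" for x
      using linear_compose_add[OF derivative_family_linear[OF F] derivative_family_linear[OF G]]
      unfolding list_multilinear_def by (intro allI)
    fix n x
    obtain a where a: "\<And>hs. length hs \<le> n \<Longrightarrow> norm (F x hs) \<le> a * prod_norm hs"
      using derivative_family_bound[OF F] by blast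
    obtain b where b: "\<And>hs. length hs \<le> n \<Longrightarrow> norm (G x hs) \<le> b * prod_norm hs"
      using derivative_family_bound[OF G] by blast
    have "norm (F x hs + G x hs) \<le> (a + b) * prod_norm hs" if "length hs = n" for hs
      using a[of hs] b[of hs] norm_triangle_ineq[of "F x hs" "G x hs"] that by (simp add: distrib_right)
    then show "\<exists>C. \<forall>hs. length hs = n \<longrightarrow> norm (F x hs + G x hs) \<le> C * prod_norm hs" by blast
    fix \<epsilon> :: real assume "0 < \<epsilon>"
    then have \<epsilon>: "0 < \<epsilon> / 2" by simp
    obtain \<delta>1 where \<delta>1: "0 < \<delta>1" "\<And>h l. norm h < \<delta>1 \<Longrightarrow> length l \<le> n \<Longrightarrow>
        norm (F (x + h) l - F x l - F x (h # l)) \<le> \<epsilon> / 2 * norm h * prod_norm l"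
      using derivative_family_approx[OF F \<epsilon>] by blast
    obtain \<delta>2 where \<delta>2: "0 < \<delta>2" "\<And>h l. norm h < \<delta>2 \<Longrightarrow> length l \<le> n \<Longrightarrow>
        norm (G (x + h) l - G x l - G x (h # l)) \<le> \<epsilon> / 2 * norm h * prod_norm l"
      using derivative_family_approx[OF G \<epsilon>] by blast
    show "\<exists>\<delta>>0. \<forall>h. norm h < \<delta> \<longrightarrow> (\<forall>hs. length hs = n \<longrightarrow>
        norm (F (x + h) hs + G (x + h) hs - (F x hs + G x hs) - (F x (h # hs) + G x (h # hs)))
          \<le> \<epsilon> * norm h * prod_norm hs)"
    proof (intro exI[of _ "min \<delta>1 \<delta>2"] conjI allI impI)
      fix h :: 'a and hs :: "'a list" assume h: "norm h < min \<delta>1 \<delta>2" and hs: "length hs = n"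
      have "F (x + h) hs + G (x + h) hs - (F x hs + G x hs) - (F x (h # hs) + G x (h # hs))
        = (F (x + h) hs - F x hs - F x (h # hs)) + (G (x + h) hs - G x hs - G x (h # hs))" by simp
      also have "norm \<dots> \<le> \<epsilon> / 2 * norm h * prod_norm hs + \<epsilon> / 2 * norm h * prod_norm hs"
        using h hs by (intro order_trans[OF norm_triangle_ineq] add_mono \<delta>1(2) \<delta>2(2)) auto
      finally show "norm (F (x + h) hs + G (x + h) hs - (F x hs + G x hs) - (F x (h # hs) + G x (h # hs)))
          \<le> \<epsilon> * norm h * prod_norm hs" by simp
    qed (use \<delta>1 \<delta>2 in simp)
  qed
  then show ?thesis unfolding smooth_iff_derivative_family by blast
qed

section \<open>The Frechet derivative as a smooth operator-valued map\<close>

definition frechet_blinfun :: "('b::real_normed_vector \<Rightarrow> 'c::real_normed_vector) \<Rightarrow> 'b \<Rightarrow> ('b \<Rightarrow>\<^sub>L 'c)" where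
  "frechet_blinfun f x = Blinfun (frechet_derivative f (at x))"

lemma has_derivative_frechet_blinfun:
  assumes "(f has_derivative f') (at x)"
  shows "blinfun_apply (frechet_blinfun f x) = f'"
  using frechet_derivative_at[OF assms] has_derivative_bounded_linear[OF assms]
  by (simp add: frechet_blinfun_def bounded_linear_Blinfun_apply)

lemma smooth_has_derivative:
  assumes "smooth f"
  shows "(f has_derivative blinfun_apply (frechet_blinfun f x)) (at x)"
proof -
  obtain D where "derivative_family f D" using assms unfolding smooth_iff_derivative_family by blast
  from derivative_family_has_derivative[OF this] show ?thesis
    using has_derivative_frechet_blinfun by metis
qed

text \<open>The newest direction stands at the head, so the argument of the derivative taken first
  stands at the end: appending it makes D a family for the derivative. Estimates of order n + 1 for
  D are estimates of order n in operator norm.\<close>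

lemma derivative_family_frechet_blinfun:
  assumes D: "derivative_family f D"
  shows "derivative_family (frechet_blinfun f) (\<lambda>x hs. Blinfun (\<lambda>h. D x (hs @ [h])))"
    "blinfun_apply (Blinfun (\<lambda>h. D x (hs @ [h]))) h = D x (hs @ [h])"
proof -
  have ap: "blinfun_apply (Blinfun (\<lambda>h. D x (hs @ [h]))) = (\<lambda>h. D x (hs @ [h]))" for x hs
  proof (rule bounded_linear_Blinfun_apply)
    obtain C where C: "\<And>l. length l \<le> length hs + 1 \<Longrightarrow> norm (D x l) \<le> C * prod_norm l"
      using derivative_family_bound[OF D] by blast
    have "linear (\<lambda>h. D x (hs @ h # []))" by (rule derivative_family_linear[OF D])
    then show "bounded_linear (\<lambda>h. D x (hs @ [h]))"
      using C[of "hs @ [_]"]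
      by (intro bounded_linear.intro bounded_linear_axioms.intro exI[of _ "C * prod_norm hs"]) (auto simp: mult_ac)
  qed
  then show "blinfun_apply (Blinfun (\<lambda>h. D x (hs @ [h]))) h = D x (hs @ [h])" by simp
  show "derivative_family (frechet_blinfun f) (\<lambda>x hs. Blinfun (\<lambda>h. D x (hs @ [h])))"
    unfolding derivative_family_def
  proof (intro conjI allI impI)
    show "Blinfun (\<lambda>h. D x ([] @ [h])) = frechet_blinfun f x" for x
      using has_derivative_frechet_blinfun[OF derivative_family_has_derivative[OF D]] ap[of x "[]"]
      by (intro blinfun_eqI) simp
    note lin = derivative_family_linear[OF D]
    show "list_multilinear (\<lambda>hs. Blinfun (\<lambda>h. D x (hs @ [h])))" for x
      unfolding list_multilinear_def
    proof (intro allI)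
      fix us vs
      have e: "blinfun_apply (Blinfun (\<lambda>h. D x ((us @ k # vs) @ [h]))) i = D x (us @ k # (vs @ [i]))" for k i
        using fun_cong[OF ap[of x "us @ k # vs"], of i] by simp
      show "linear (\<lambda>k. Blinfun (\<lambda>h. D x ((us @ k # vs) @ [h])))"
        by (intro linearI blinfun_eqI)
          (simp_all only: e blinfun.add_left blinfun.scaleR_left linear_add[OF lin] linear_scale[OF lin])
    qed
    fix n x
    obtain C where C: "0 \<le> C" "\<And>l. length l \<le> Suc n \<Longrightarrow> norm (D x l) \<le> C * prod_norm l"
      using derivative_family_bound[OF D] by blast
    have "norm (Blinfun (\<lambda>h. D x (hs @ [h]))) \<le> C * prod_norm hs" if "length hs = n" for hs
    proof (rule norm_blinfun_bound)
      show "0 \<le> C * prod_norm hs" by (intro mult_nonneg_nonneg C(1) prod_norm_nonneg)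
      show "norm (blinfun_apply (Blinfun (\<lambda>h. D x (hs @ [h]))) k) \<le> C * prod_norm hs * norm k" for k
        using C(2)[of "hs @ [k]"] that by (simp add: ap mult.assoc)
    qed
    then show "\<exists>C. \<forall>hs. length hs = n \<longrightarrow> norm (Blinfun (\<lambda>h. D x (hs @ [h]))) \<le> C * prod_norm hs" by blast
    fix \<epsilon> :: real assume \<epsilon>: "0 < \<epsilon>"
    obtain \<delta> where \<delta>: "0 < \<delta>" "\<And>h l. norm h < \<delta> \<Longrightarrow> length l \<le> Suc n \<Longrightarrow>
        norm (D (x + h) l - D x l - D x (h # l)) \<le> \<epsilon> * norm h * prod_norm l"
      using derivative_family_approx[OF D \<epsilon>] by blast
    have "norm (Blinfun (\<lambda>k. D (x + h) (hs @ [k])) - Blinfun (\<lambda>k. D x (hs @ [k])) - Blinfun (\<lambda>k. D x ((h # hs) @ [k])))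
        \<le> \<epsilon> * norm h * prod_norm hs" if h: "norm h < \<delta>" and hs: "length hs = n" for h hs
    proof (rule norm_blinfun_bound)
      show "0 \<le> \<epsilon> * norm h * prod_norm hs" using \<epsilon> prod_norm_nonneg[of hs] by simp
      show "norm (blinfun_apply (Blinfun (\<lambda>k. D (x + h) (hs @ [k])) - Blinfun (\<lambda>k. D x (hs @ [k]))
          - Blinfun (\<lambda>k. D x ((h # hs) @ [k]))) k) \<le> \<epsilon> * norm h * prod_norm hs * norm k" for k
        using \<delta>(2)[OF h, of "hs @ [k]"] hs by (simp add: blinfun.diff_left ap[of _ "h # hs", simplified] ap mult.assoc)
    qed
    then show "\<exists>\<delta>>0. \<forall>h. norm h < \<delta> \<longrightarrow> (\<forall>hs. length hs = n \<longrightarrow>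
        norm (Blinfun (\<lambda>k. D (x + h) (hs @ [k])) - Blinfun (\<lambda>k. D x (hs @ [k])) - Blinfun (\<lambda>k. D x ((h # hs) @ [k])))
          \<le> \<epsilon> * norm h * prod_norm hs)"
      using \<delta>(1) by blast
  qed
qed

lemma smooth_frechet_blinfun: "smooth f \<Longrightarrow> smooth (frechet_blinfun f)"
  using derivative_family_frechet_blinfun(1) unfolding smooth_iff_derivative_family by blast

subsection \<open>Symmetry of the second derivative\<close>

text \<open>Mean value theorem in direction v for the difference of f along two parallel segments,
  then first-order expansion of the v-derivative at x. The remainders at su + zv and at zv account
  for the factor \<open>norm u + 2 * norm v\<close>.\<close>

lemma second_difference_estimate:
  fixes f :: "'b::real_normed_vector \<Rightarrow> real" and x u v :: 'b
  assumes D: "derivative_family f D" and \<epsilon>: "0 < \<epsilon>"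
  obtains s0 where "0 < s0" "\<And>s. 0 < s \<Longrightarrow> s < s0 \<Longrightarrow>
    \<bar>(f (x + s *\<^sub>R u + s *\<^sub>R v) - f (x + s *\<^sub>R u) - f (x + s *\<^sub>R v) + f x) - s\<^sup>2 * D x [u, v]\<bar>
      \<le> s\<^sup>2 * (\<epsilon> * (norm u + 2 * norm v) * norm v)"
proof -
  obtain \<delta> where \<delta>: "0 < \<delta>" "\<And>h l. norm h < \<delta> \<Longrightarrow> length l \<le> 1 \<Longrightarrow>
      norm (D (x + h) l - D x l - D x (h # l)) \<le> \<epsilon> * norm h * prod_norm l"
    using derivative_family_approx[OF D \<epsilon>] by blast
  note lin = derivative_family_linear[OF D]
  define s0 where "s0 = \<delta> / (norm u + norm v + 1)"
  have N: "0 < norm u + norm v + 1" by (simp add: add_nonneg_pos)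
  show ?thesis
  proof (rule that[of s0])
    show "0 < s0" using \<delta>(1) N by (simp add: s0_def)
    fix s :: real assume s: "0 < s" "s < s0"
    have small: "norm (a *\<^sub>R u + b *\<^sub>R v) < \<delta>" if "0 \<le> a" "a \<le> s" "0 \<le> b" "b \<le> s" for a b
    proof -
      have "norm (a *\<^sub>R u + b *\<^sub>R v) \<le> a * norm u + b * norm v"
        using norm_triangle_ineq[of "a *\<^sub>R u" "b *\<^sub>R v"] that by simp
      also have "\<dots> \<le> s * norm u + s * norm v" using that by (intro add_mono mult_right_mono) auto
      also have "\<dots> \<le> s * (norm u + norm v + 1)" using s by (simp add: algebra_simps)
      also have "\<dots> < \<delta>" using s N by (simp add: s0_def pos_less_divide_eq)
      finally show ?thesis .
    qed
    define g where "g t = f (x + s *\<^sub>R u + t *\<^sub>R v) - f (x + t *\<^sub>R v)" for t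
    have fd: "((\<lambda>t. f (y + t *\<^sub>R v)) has_real_derivative D (y + t *\<^sub>R v) [v]) (at t)" for y t
    proof -
      have "((\<lambda>t. f (y + t *\<^sub>R v)) has_derivative (\<lambda>h. D (y + t *\<^sub>R v) [h *\<^sub>R v])) (at t)"
        by (rule has_derivative_compose[OF _ derivative_family_has_derivative[OF D]])
          (auto intro!: derivative_eq_intros)
      moreover have "D (y + t *\<^sub>R v) [h *\<^sub>R v] = D (y + t *\<^sub>R v) [v] * h" for h
        using linear_scale[OF lin[of "y + t *\<^sub>R v" "[]" "[]"], of h v] by simp
      ultimately show ?thesis unfolding has_field_derivative_def by simp
    qed
    \<comment> \<open>Applying the theorem to the difference g yields one z for both
      segments.\<close>
    have "\<exists>z. 0 < z \<and> z < s \<and> g s - g 0 = (s - 0) * (D (x + s *\<^sub>R u + z *\<^sub>R v) [v] - D (x + z *\<^sub>R v) [v])"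
      using s(1) unfolding g_def by (intro MVT2) (auto intro!: derivative_intros fd)
    then obtain z where z: "0 < z" "z < s"
      "g s - g 0 = s * (D (x + s *\<^sub>R u + z *\<^sub>R v) [v] - D (x + z *\<^sub>R v) [v])" by auto
    define r where "r h = D (x + h) [v] - D x [v] - D x [h, v]" for h
    have r: "\<bar>r (a *\<^sub>R u + b *\<^sub>R v)\<bar> \<le> \<epsilon> * (a * norm u + b * norm v) * norm v"
      if "0 \<le> a" "a \<le> s" "0 \<le> b" "b \<le> s" for a b
    proof -
      have "\<bar>r (a *\<^sub>R u + b *\<^sub>R v)\<bar> \<le> \<epsilon> * norm (a *\<^sub>R u + b *\<^sub>R v) * norm v"
        using \<delta>(2)[OF small[OF that], of "[v]"] by (simp add: r_def)
      also have "\<dots> \<le> \<epsilon> * (a * norm u + b * norm v) * norm v"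
        using \<epsilon> norm_triangle_ineq[of "a *\<^sub>R u" "b *\<^sub>R v"] that by (intro mult_right_mono mult_left_mono) auto
      finally show ?thesis .
    qed
    have "D x [s *\<^sub>R u + z *\<^sub>R v, v] - D x [z *\<^sub>R v, v] = s * D x [u, v]"
      using linear_add[OF lin[of x "[]" "[v]"], of "s *\<^sub>R u" "z *\<^sub>R v"] linear_scale[OF lin[of x "[]" "[v]"], of s u]
      by simp
    then have "g s - g 0 = s * (s * D x [u, v] + r (s *\<^sub>R u + z *\<^sub>R v) - r (0 *\<^sub>R u + z *\<^sub>R v))"
      unfolding z(3) by (simp add: r_def algebra_simps)
    then have "g s - g 0 - s\<^sup>2 * D x [u, v] = s * (r (s *\<^sub>R u + z *\<^sub>R v) - r (0 *\<^sub>R u + z *\<^sub>R v))"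
      by (simp add: power2_eq_square algebra_simps)
    then have "\<bar>g s - g 0 - s\<^sup>2 * D x [u, v]\<bar> = s * \<bar>r (s *\<^sub>R u + z *\<^sub>R v) - r (0 *\<^sub>R u + z *\<^sub>R v)\<bar>"
      using s(1) by (simp add: abs_mult)
    also have "\<dots> \<le> s * (\<epsilon> * (s * norm u + s * norm v) * norm v + \<epsilon> * (s * norm v) * norm v)"
    proof (rule mult_left_mono)
      have "\<epsilon> * (s * norm u + z * norm v) * norm v \<le> \<epsilon> * (s * norm u + s * norm v) * norm v"
        "\<epsilon> * (0 * norm u + z * norm v) * norm v \<le> \<epsilon> * (s * norm v) * norm v"
        using z \<epsilon> by (auto intro!: mult_right_mono mult_left_mono)
      then show "\<bar>r (s *\<^sub>R u + z *\<^sub>R v) - r (0 *\<^sub>R u + z *\<^sub>R v)\<bar>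
          \<le> \<epsilon> * (s * norm u + s * norm v) * norm v + \<epsilon> * (s * norm v) * norm v"
        using r[of s z] r[of 0 z] z s by linarith
    qed (use s in simp)
    also have "\<dots> = s\<^sup>2 * (\<epsilon> * (norm u + 2 * norm v) * norm v)"
      by (simp add: power2_eq_square algebra_simps)
    finally show "\<bar>(f (x + s *\<^sub>R u + s *\<^sub>R v) - f (x + s *\<^sub>R u) - f (x + s *\<^sub>R v) + f x) - s\<^sup>2 * D x [u, v]\<bar>
      \<le> s\<^sup>2 * (\<epsilon> * (norm u + 2 * norm v) * norm v)" by (simp add: g_def algebra_simps)
  qed
qed

text \<open>The second difference is symmetric in u and v, and divided by the square of s it
  approximates both values within a multiple of \<epsilon>.\<close>

lemma second_derivative_symmetric:
  fixes f :: "'b::real_normed_vector \<Rightarrow> real"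
  assumes D: "derivative_family f D"
  shows "D x [u, v] = D x [v, u]"
proof -
  define M where "M = (norm u + 2 * norm v) * norm v + (norm v + 2 * norm u) * norm u"
  have M: "0 \<le> M" by (simp add: M_def)
  have "\<bar>D x [u, v] - D x [v, u]\<bar> \<le> 0 + e" if e: "0 < e" for e
  proof -
    define \<epsilon> where "\<epsilon> = e / (M + 1)"
    have \<epsilon>: "0 < \<epsilon>" "\<epsilon> * M \<le> e" using e M by (auto simp: \<epsilon>_def field_simps add_pos_nonneg)
    obtain s1 where s1: "0 < s1" "\<And>s. 0 < s \<Longrightarrow> s < s1 \<Longrightarrow>
      \<bar>(f (x + s *\<^sub>R u + s *\<^sub>R v) - f (x + s *\<^sub>R u) - f (x + s *\<^sub>R v) + f x) - s\<^sup>2 * D x [u, v]\<bar>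
        \<le> s\<^sup>2 * (\<epsilon> * (norm u + 2 * norm v) * norm v)"
      using second_difference_estimate[OF D \<epsilon>(1)] by blast
    obtain s2 where s2: "0 < s2" "\<And>s. 0 < s \<Longrightarrow> s < s2 \<Longrightarrow>
      \<bar>(f (x + s *\<^sub>R v + s *\<^sub>R u) - f (x + s *\<^sub>R v) - f (x + s *\<^sub>R u) + f x) - s\<^sup>2 * D x [v, u]\<bar>
        \<le> s\<^sup>2 * (\<epsilon> * (norm v + 2 * norm u) * norm u)"
      using second_difference_estimate[OF D \<epsilon>(1)] by blast
    define s where "s = min s1 s2 / 2"
    have s: "0 < s" "s < s1" "s < s2" using s1(1) s2(1) by (auto simp: s_def min_def)
    have tri: "\<bar>p - q\<bar> \<le> A + B" if "\<bar>d - p\<bar> \<le> A" "\<bar>d' - q\<bar> \<le> B" "d = d'" for p q d d' A B :: real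
      using that by linarith
    have "\<bar>s\<^sup>2 * D x [u, v] - s\<^sup>2 * D x [v, u]\<bar>
        \<le> s\<^sup>2 * (\<epsilon> * (norm u + 2 * norm v) * norm v) + s\<^sup>2 * (\<epsilon> * (norm v + 2 * norm u) * norm u)"
      by (intro tri[OF s1(2)[OF s(1,2)] s2(2)[OF s(1,3)]]) (simp add: add_ac)
    also have "\<bar>s\<^sup>2 * D x [u, v] - s\<^sup>2 * D x [v, u]\<bar> = s\<^sup>2 * \<bar>D x [u, v] - D x [v, u]\<bar>"
      by (simp add: abs_mult flip: right_diff_distrib)
    also have "s\<^sup>2 * (\<epsilon> * (norm u + 2 * norm v) * norm v) + s\<^sup>2 * (\<epsilon> * (norm v + 2 * norm u) * norm u) = s\<^sup>2 * (\<epsilon> * M)"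
      by (simp add: M_def algebra_simps)
    finally have "s\<^sup>2 * \<bar>D x [u, v] - D x [v, u]\<bar> \<le> s\<^sup>2 * (\<epsilon> * M)" .
    then have "\<bar>D x [u, v] - D x [v, u]\<bar> \<le> \<epsilon> * M" using s(1) by simp
    then show ?thesis using \<epsilon>(2) by linarith
  qed
  then have "\<bar>D x [u, v] - D x [v, u]\<bar> \<le> 0" by (rule field_le_epsilon)
  then show ?thesis by simp
qed

lemma frechet_blinfun_twice_symmetric:
  fixes f :: "'b::real_normed_vector \<Rightarrow> real"
  assumes "smooth f"
  shows "frechet_blinfun (frechet_blinfun f) x u v = frechet_blinfun (frechet_blinfun f) x v u"
proof -
  obtain D where D: "derivative_family f D" using assms unfolding smooth_iff_derivative_family by blast
  note D' = derivative_family_frechet_blinfun[OF D]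
  have "frechet_blinfun (frechet_blinfun f) x u v = D x [u, v]" for u v
    using has_derivative_frechet_blinfun[OF derivative_family_has_derivative[OF D'(1), of x]] D'(2)[of x "[u]" v]
    by simp
  then show ?thesis using second_derivative_symmetric[OF D, of x u v] by simp
qed

section \<open>Lie--Poisson brackets\<close>

lemma frechet_blinfun_eqI:
  assumes "(f has_derivative blinfun_apply \<phi>) (at x)"
  shows "frechet_blinfun f x = \<phi>"
  using has_derivative_frechet_blinfun[OF assms] by (simp add: blinfun_apply_inject)

lemma frechet_blinfun_add:
  "smooth f \<Longrightarrow> smooth g \<Longrightarrow> frechet_blinfun (\<lambda>x. f x + g x) x = frechet_blinfun f x + frechet_blinfun g x"
  by (rule frechet_blinfun_eqI)
    (auto simp: blinfun.add_left[abs_def] intro!: has_derivative_add smooth_has_derivative)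

lemma frechet_blinfun_cmult:
  fixes f :: "'b::real_normed_vector \<Rightarrow> real"
  shows "smooth f \<Longrightarrow> frechet_blinfun (\<lambda>x. c * f x) x = c *\<^sub>R frechet_blinfun f x"
  by (rule frechet_blinfun_eqI)
    (auto simp: blinfun.scaleR_left[abs_def] intro!: has_derivative_mult_right smooth_has_derivative)

lemma frechet_blinfun_mult:
  fixes f g :: "'b::real_normed_vector \<Rightarrow> real"
  shows "smooth f \<Longrightarrow> smooth g \<Longrightarrow>
    frechet_blinfun (\<lambda>x. f x * g x) x = f x *\<^sub>R frechet_blinfun g x + g x *\<^sub>R frechet_blinfun f x"
  by (rule frechet_blinfun_eqI)
    (auto simp: blinfun.add_left[abs_def] blinfun.scaleR_left[abs_def] mult.commute[of "g x"]
      intro!: has_derivative_mult smooth_has_derivative)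

lemma frechet_blinfun_blinfun: "frechet_blinfun (blinfun_apply \<phi>) x = \<phi>"
  by (rule frechet_blinfun_eqI) (auto intro!: bounded_linear_imp_has_derivative blinfun.bounded_linear_right)

lemma smooth_blinfun: "smooth (blinfun_apply \<phi>)"
  by (rule smooth_bounded_linear) (rule blinfun.bounded_linear_right)

text \<open>\<open>\<Gamma> \<phi> x\<close> plays the role of \<open>ad*\<close>: it is the Hamiltonian vector of the linear function \<open>\<phi>\<close> at \<open>x\<close>.\<close>

theorem banach_lie_poisson_spaceI:
  fixes \<Gamma> :: "('b::banach \<Rightarrow>\<^sub>L real) \<Rightarrow> 'b \<Rightarrow> 'b"
  assumes bil: "bounded_bilinear \<Gamma>"
    and anti: "\<And>\<phi> \<psi> x. blinfun_apply \<phi> (\<Gamma> \<psi> x) = - blinfun_apply \<psi> (\<Gamma> \<phi> x)"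
    and jac: "\<And>\<phi> \<psi> \<xi> x. blinfun_apply \<phi> (\<Gamma> \<psi> (\<Gamma> \<xi> x)) + blinfun_apply \<psi> (\<Gamma> \<xi> (\<Gamma> \<phi> x))
      + blinfun_apply \<xi> (\<Gamma> \<phi> (\<Gamma> \<psi> x)) = 0"
    and P: "\<And>f g x. smooth f \<Longrightarrow> smooth g \<Longrightarrow> P f g x = frechet_blinfun f x (\<Gamma> (frechet_blinfun g x) x)"
  shows "banach_lie_poisson_space P"
proof -
  interpret \<Gamma>: bounded_bilinear \<Gamma> by fact
  let ?D = "frechet_blinfun :: ('b \<Rightarrow> real) \<Rightarrow> 'b \<Rightarrow> ('b \<Rightarrow>\<^sub>L real)"
  have smX: "smooth (\<lambda>x. \<Gamma> (?D h x) x)" if "smooth h" for h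
    by (rule \<Gamma>.smooth_prod[OF smooth_frechet_blinfun[OF that] smooth_bounded_linear[OF bounded_linear_ident]])
  have smP: "smooth (P f g)" if "smooth f" "smooth g" for f g
  proof -
    have "P f g = (\<lambda>x. ?D f x (\<Gamma> (?D g x) x))" using P[OF that] by blast
    then show ?thesis
      using bounded_bilinear.smooth_prod[OF bounded_bilinear_blinfun_apply smooth_frechet_blinfun[OF that(1)] smX[OF that(2)]]
      by simp
  qed
  have antiP: "P f g x = - P g f x" if "smooth f" "smooth g" for f g x
    using that by (simp add: P anti[of "?D f x"])
  \<comment> \<open>The product rule gives two second derivative terms; \<open>anti\<close> takes
    that of h out of \<Gamma>, which gives it the minus sign.\<close>
  have DP: "?D (P g h) x v = frechet_blinfun (?D g) x v (\<Gamma> (?D h x) x)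
      - frechet_blinfun (?D h) x v (\<Gamma> (?D g x) x) + ?D g x (\<Gamma> (?D h x) v)"
    if g: "smooth g" and h: "smooth h" for g h x v
  proof -
    note dg = smooth_has_derivative[OF smooth_frechet_blinfun[OF g], of x]
      and dh = smooth_has_derivative[OF smooth_frechet_blinfun[OF h], of x]
    have "P g h = (\<lambda>x. ?D g x (\<Gamma> (?D h x) x))" using P[OF g h] by blast
    then have d: "(P g h has_derivative
        (\<lambda>v. ?D g x (\<Gamma> (?D h x) v + \<Gamma> (frechet_blinfun (?D h) x v) x) + frechet_blinfun (?D g) x v (\<Gamma> (?D h x) x))) (at x)"
      using bounded_bilinear.FDERIV[OF bounded_bilinear_blinfun_apply dg \<Gamma>.FDERIV[OF dh has_derivative_ident]]
      by (simp only:)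
    show ?thesis
      using fun_cong[OF has_derivative_frechet_blinfun[OF d], of v] anti[of "?D g x" "frechet_blinfun (?D h) x v" x] by (simp add: blinfun.add_right)
  qed
  have jacP: "P f (P g h) x + P g (P h f) x + P h (P f g) x = 0"
    if f: "smooth f" and g: "smooth g" and h: "smooth h" for f g h x
  proof -
    let ?X = "\<lambda>f. \<Gamma> (?D f x) x"
    \<comment> \<open>The outer bracket is minus the derivative of the inner one along the
      Hamiltonian vector of f.\<close>
    have PP: "P f (P g h) x = - ?D (P g h) x (?X f)" if "smooth f" "smooth g" "smooth h" for f g h
      using antiP[OF that(1) smP[OF that(2,3)]] P[OF smP[OF that(2,3)] that(1)] by simp
    have sym: "frechet_blinfun (?D f) x u v = frechet_blinfun (?D f) x v u" if "smooth f" for f u v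
      by (rule frechet_blinfun_twice_symmetric[OF that])
    \<comment> \<open>Each second derivative occurs twice, with opposite signs and exchanged
      arguments, so symmetry cancels all six terms; the rest is an instance of
      \<open>jac\<close>.\<close>
    have "P f (P g h) x + P g (P h f) x + P h (P f g) x
      = - (?D f x (\<Gamma> (?D g x) (?X h)) + ?D g x (\<Gamma> (?D h x) (?X f)) + ?D h x (\<Gamma> (?D f x) (?X g)))"
      unfolding PP[OF f g h] PP[OF g h f] PP[OF h f g] DP[OF g h] DP[OF h f] DP[OF f g]
      using sym[OF f, of "?X g" "?X h"] sym[OF g, of "?X f" "?X h"] sym[OF h, of "?X f" "?X g"] by simp
    then show ?thesis using jac[of "?D f x" "?D g x" "?D h x" x] by simp
  qed
  have pois: "poisson_bracket P"
    unfolding poisson_bracket_def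
  proof (intro conjI allI impI ext)
    fix f g h :: "'b \<Rightarrow> real" and c x assume f: "smooth f" and g: "smooth g"
    show "smooth (P f g)" by (rule smP[OF f g])
    have "smooth (\<lambda>x. c * f x)"
      by (rule smooth_bounded_linear_compose[OF bounded_linear_mult_right f])
    then show "P (\<lambda>x. c * f x) g x = c * P f g x"
      using f g by (simp add: P frechet_blinfun_cmult blinfun.scaleR_left)
    show "P f g x = - P g f x" by (rule antiP[OF f g])
    assume h: "smooth h"
    show "P f (P g h) x + P g (P h f) x + P h (P f g) x = 0" by (rule jacP[OF f g h])
    show "P (\<lambda>x. f x + g x) h x = P f h x + P g h x"
      using f g h smooth_add[OF f g] by (simp add: P frechet_blinfun_add blinfun.add_left)
    have "smooth (\<lambda>x. f x * g x)"
      by (rule bounded_bilinear.smooth_prod[OF bounded_bilinear_mult f g])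
    then show "P (\<lambda>x. f x * g x) h x = f x * P g h x + P f h x * g x"
      using f g h by (simp add: P frechet_blinfun_mult blinfun.add_left blinfun.scaleR_left)
  qed
  have ham: "hamiltonian_vector_field P h (\<lambda>x. \<Gamma> (?D h x) x)" if h: "smooth h" for h
    unfolding hamiltonian_vector_field_def
  proof (intro conjI allI impI smX[OF h])
    fix f :: "'b \<Rightarrow> real" and x assume f: "smooth f"
    show "frechet_derivative f (at x) (\<Gamma> (?D h x) x) = P f h x"
      using frechet_derivative_at[OF smooth_has_derivative[OF f, of x]] by (simp add: P[OF f h])
  qed
  have Plin: "P (blinfun_apply \<phi>) (blinfun_apply \<psi>) = (\<lambda>x. \<phi> (\<Gamma> \<psi> x))"
    for \<phi> \<psi> :: "'b \<Rightarrow>\<^sub>L real"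
    by (rule ext) (simp add: P smooth_blinfun frechet_blinfun_blinfun)
  have bl: "bounded_linear (\<lambda>x. blinfun_apply \<phi> (\<Gamma> \<psi> x))" for \<phi> \<psi> :: "'b \<Rightarrow>\<^sub>L real"
    by (rule bounded_linear_compose[OF blinfun.bounded_linear_right \<Gamma>.bounded_linear_right])
  define br where "br \<phi> \<psi> = Blinfun (P (blinfun_apply \<phi>) (blinfun_apply \<psi>))" for \<phi> \<psi> :: "'b \<Rightarrow>\<^sub>L real"
  have br: "br \<phi> \<psi> x = \<phi> (\<Gamma> \<psi> x)" for \<phi> \<psi> :: "'b \<Rightarrow>\<^sub>L real" and x
    unfolding br_def Plin by (simp add: bounded_linear_Blinfun_apply[OF bl])
  obtain K where K: "0 \<le> K" "\<And>\<phi> x. norm (\<Gamma> \<phi> x) \<le> norm \<phi> * norm x * K" using \<Gamma>.nonneg_bounded by blast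
  have "banach_lie_algebra br"
    unfolding banach_lie_algebra_def
  proof (intro conjI allI)
    show "bounded_bilinear br"
    proof
      show "\<exists>K. \<forall>\<phi> \<psi>. norm (br \<phi> \<psi>) \<le> norm \<phi> * norm \<psi> * K"
      proof (intro exI allI norm_blinfun_bound)
        show "0 \<le> norm \<phi> * norm \<psi> * K" for \<phi> \<psi> :: "'b \<Rightarrow>\<^sub>L real" using K(1) by simp
        show "norm (br \<phi> \<psi> x) \<le> norm \<phi> * norm \<psi> * K * norm x" for \<phi> \<psi> x
          using norm_blinfun[of \<phi> "\<Gamma> \<psi> x"] mult_left_mono[OF K(2)[of \<psi> x] norm_ge_zero[of \<phi>]]
          by (simp add: br mult_ac)
      qed
    qed (auto intro!: blinfun_eqI simp: br blinfun.bilinear_simps \<Gamma>.add_left \<Gamma>.scaleR_left)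
    show "br \<phi> \<phi> = 0" for \<phi>
      using anti[of \<phi> \<phi>] by (intro blinfun_eqI) (simp add: br)
    show "br \<phi> (br \<psi> \<xi>) + br \<psi> (br \<xi> \<phi>) + br \<xi> (br \<phi> \<psi>) = 0" for \<phi> \<psi> \<xi>
    proof (rule blinfun_eqI)
      fix x
      \<comment> \<open>\<open>anti\<close> turns \<phi> into the inner Hamiltonian vector, so
        \<Gamma> never has to be computed on a bracket.\<close>
      have "br \<phi> (br \<psi> \<xi>) x = - \<psi> (\<Gamma> \<xi> (\<Gamma> \<phi> x))"
        for \<phi> \<psi> \<xi> :: "'b \<Rightarrow>\<^sub>L real"
        using anti[of \<phi> "br \<psi> \<xi>" x] by (simp add: br)
      then show "(br \<phi> (br \<psi> \<xi>) + br \<psi> (br \<xi> \<phi>) + br \<xi> (br \<phi> \<psi>)) x = blinfun_apply 0 x"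
        using jac[of \<phi> \<psi> \<xi> x] by (simp add: blinfun.add_left)
    qed
  qed
  then show ?thesis
    unfolding banach_lie_poisson_space_def br_def[abs_def] using pois ham bl by (auto simp: Plin)
qed

section \<open>The bracket on the predual of the central extension\<close>

text \<open>A functional on the sum is a pair (A, a) with a real; the line of a is central in the
  extension, so the Hamiltonian vector is determined by A.\<close>

definition ures_part :: "(('h::polarized_hilbert_space ures_predual \<times> real) \<Rightarrow>\<^sub>L real) \<Rightarrow> ('h \<Rightarrow>\<^sub>L 'h)" where
  "ures_part \<phi> = ures_rep (Blinfun (\<lambda>\<nu>. \<phi> (\<nu>, 0)))"

text \<open>The coadjoint representation of the extension. The second component is zero because
  \<gamma> is paired with the center: it is constant along every Hamiltonian vector field.\<close>

definition ures_hamiltonian ::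
  "(('h::polarized_hilbert_space ures_predual \<times> real) \<Rightarrow>\<^sub>L real) \<Rightarrow> 'h ures_predual \<times> real \<Rightarrow> 'h ures_predual \<times> real" where
  "ures_hamiltonian \<phi> x = (ures_coad (ures_part \<phi>) (fst x) - snd x *\<^sub>R ures_dcomm (ures_part \<phi>), 0)"

lemma ures_part_Blinfun: "blinfun_apply (Blinfun (\<lambda>\<nu>. \<phi> (\<nu>, 0))) = (\<lambda>\<nu>. \<phi> (\<nu>, 0))"
  for \<phi> :: "('h::polarized_hilbert_space ures_predual \<times> real) \<Rightarrow>\<^sub>L real"
proof (rule bounded_linear_Blinfun_apply)
  have "bounded_linear (\<lambda>\<nu> :: 'h ures_predual. (\<nu>, 0 :: real))"
    by (rule bounded_linear_Pair[OF bounded_linear_ident bounded_linear_zero])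
  then show "bounded_linear (\<lambda>\<nu>. \<phi> (\<nu>, 0))"
    by (rule bounded_linear_compose[OF blinfun.bounded_linear_right])
qed

lemma ures_part:
  fixes \<phi> :: "('h::polarized_hilbert_space ures_predual \<times> real) \<Rightarrow>\<^sub>L real"
  shows "ures_part \<phi> \<in> ures" "\<phi> (\<nu>, 0) = ures_pairing \<nu> (ures_part \<phi>)" "restricted_norm (ures_part \<phi>) \<le> 6 * norm \<phi>"
proof -
  show "ures_part \<phi> \<in> ures" unfolding ures_part_def by (rule ures_rep(1))
  show "\<phi> (\<nu>, 0) = ures_pairing \<nu> (ures_part \<phi>)"
    using ures_rep(2)[of "Blinfun (\<lambda>\<nu>. \<phi> (\<nu>, 0))" \<nu>] by (simp add: ures_part_def ures_part_Blinfun)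
  have "norm (Blinfun (\<lambda>\<nu>. \<phi> (\<nu>, 0))) \<le> norm \<phi>"
    by (rule norm_blinfun_bound) (use norm_blinfun[of \<phi> "(_, 0)"] in \<open>auto simp: ures_part_Blinfun norm_Pair\<close>)
  then show "restricted_norm (ures_part \<phi>) \<le> 6 * norm \<phi>"
    using ures_rep(3)[of "Blinfun (\<lambda>\<nu>. \<phi> (\<nu>, 0))"] unfolding ures_part_def by linarith
qed

lemma ures_part_eqI:
  fixes \<phi> :: "('h::polarized_hilbert_space ures_predual \<times> real) \<Rightarrow>\<^sub>L real"
  assumes "A \<in> ures" "\<And>\<nu>. \<phi> (\<nu>, 0) = ures_pairing \<nu> A"
  shows "ures_part \<phi> = A"
  unfolding ures_part_def 
proof (rule ures_rep_eqI[OF assms(1)])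
  show "blinfun_apply (Blinfun (\<lambda>\<nu>. \<phi> (\<nu>, 0))) \<nu> = ures_pairing \<nu> A" for \<nu>
    unfolding ures_part_Blinfun by (rule assms(2))
qed

lemma ures_part_add: "ures_part (\<phi> + \<psi>) = ures_part \<phi> + ures_part \<psi>"
  by (rule ures_part_eqI) (simp_all add: ures_add ures_part(1) ures_pairing_add blinfun.add_left flip: ures_part(2))

lemma ures_part_scaleR: "ures_part (r *\<^sub>R \<phi>) = r *\<^sub>R ures_part \<phi>"
  by (rule ures_part_eqI) (simp_all add: ures_scaleR ures_part(1) ures_pairing_scaleR blinfun.scaleR_left flip: ures_part(2))

lemma commutator_linear:
  "commutator (A + B) C = commutator A C + commutator B C" "commutator C (A + B) = commutator C A + commutator C B"
  "commutator (r *\<^sub>R A) C = r *\<^sub>R commutator A C" "commutator C (r *\<^sub>R A) = r *\<^sub>R commutator C A"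
  by (simp_all add: commutator_def blinfun_compose_simps scaleR_diff_right)

lemma ures_coad_linear:
  "A \<in> ures \<Longrightarrow> ures_coad A (\<mu> + \<nu>) = ures_coad A \<mu> + ures_coad A \<nu>"
  "A \<in> ures \<Longrightarrow> ures_coad A (r *\<^sub>R \<mu>) = r *\<^sub>R ures_coad A \<mu>"
  "A \<in> ures \<Longrightarrow> B \<in> ures \<Longrightarrow> ures_coad (A + B) \<mu> = ures_coad A \<mu> + ures_coad B \<mu>"
  "A \<in> ures \<Longrightarrow> ures_coad (r *\<^sub>R A) \<mu> = r *\<^sub>R ures_coad A \<mu>"
  by (simp_all add: op_of_inject[symmetric] op_of_ures_coad op_of_add op_of_scaleR commutator_linear ures_add ures_scaleR)

lemma ures_dcomm_linear:
  "A \<in> ures \<Longrightarrow> B \<in> ures \<Longrightarrow> ures_dcomm (A + B) = ures_dcomm A + ures_dcomm B"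
  "A \<in> ures \<Longrightarrow> ures_dcomm (r *\<^sub>R A) = r *\<^sub>R ures_dcomm A"
  by (simp_all add: op_of_inject[symmetric] op_of_ures_dcomm op_of_add op_of_scaleR commutator_linear ures_add ures_scaleR)

text \<open>The constant 24 is 4 times 6: each of the two summands costs a factor 2, and
  representing the functional by an operator costs a factor 6.\<close>

lemma bounded_bilinear_ures_hamiltonian:
  "bounded_bilinear (ures_hamiltonian :: (('h::polarized_hilbert_space ures_predual \<times> real) \<Rightarrow>\<^sub>L real) \<Rightarrow> _ \<Rightarrow> _)"
proof
  fix \<phi> \<psi> :: "('h ures_predual \<times> real) \<Rightarrow>\<^sub>L real" and x y and r :: real
  note u = ures_part(1)
  show "ures_hamiltonian (\<phi> + \<psi>) x = ures_hamiltonian \<phi> x + ures_hamiltonian \<psi> x"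
    by (simp add: ures_hamiltonian_def ures_part_add ures_coad_linear ures_dcomm_linear u algebra_simps)
  show "ures_hamiltonian \<phi> (x + y) = ures_hamiltonian \<phi> x + ures_hamiltonian \<phi> y"
    by (simp add: ures_hamiltonian_def ures_coad_linear u algebra_simps)
  show "ures_hamiltonian (r *\<^sub>R \<phi>) x = r *\<^sub>R ures_hamiltonian \<phi> x"
    by (simp add: ures_hamiltonian_def ures_part_scaleR ures_coad_linear ures_dcomm_linear u algebra_simps)
  show "ures_hamiltonian \<phi> (r *\<^sub>R x) = r *\<^sub>R ures_hamiltonian \<phi> x"
    by (simp add: ures_hamiltonian_def ures_coad_linear u algebra_simps)
next
  show "\<exists>K. \<forall>(\<phi> :: ('h ures_predual \<times> real) \<Rightarrow>\<^sub>L real) x. norm (ures_hamiltonian \<phi> x) \<le> norm \<phi> * norm x * K"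
  proof (intro exI allI)
    fix \<phi> :: "('h ures_predual \<times> real) \<Rightarrow>\<^sub>L real" and x :: "'h ures_predual \<times> real"
    let ?A = "ures_part \<phi>"
    have n: "norm (fst x) \<le> norm x" "\<bar>snd x\<bar> \<le> norm x"
      using norm_fst_le[of "fst x" "snd x"] norm_snd_le[of "snd x" "fst x"] by simp_all
    have "norm (ures_hamiltonian \<phi> x) \<le> norm (ures_coad ?A (fst x)) + \<bar>snd x\<bar> * norm (ures_dcomm ?A)"
      using norm_triangle_ineq4[of "ures_coad ?A (fst x)" "snd x *\<^sub>R ures_dcomm ?A"]
      by (simp add: ures_hamiltonian_def norm_Pair)
    also have "\<dots> \<le> 2 * restricted_norm ?A * norm x + norm x * (2 * restricted_norm ?A)"
    proof (rule add_mono)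
      show "norm (ures_coad ?A (fst x)) \<le> 2 * restricted_norm ?A * norm x"
        by (rule order_trans[OF op_of_ures_coad(2)[OF ures_part(1)] mult_left_mono[OF n(1)]])
          (simp add: restricted_norm_nonneg)
      show "\<bar>snd x\<bar> * norm (ures_dcomm ?A) \<le> norm x * (2 * restricted_norm ?A)"
        by (rule mult_mono[OF n(2) op_of_ures_dcomm(2)[OF ures_part(1)]]) simp_all
    qed
    also have "\<dots> = 4 * norm x * restricted_norm ?A" by simp
    also have "\<dots> \<le> 4 * norm x * (6 * norm \<phi>)" by (intro mult_left_mono ures_part(3)) simp
    finally show "norm (ures_hamiltonian \<phi> x) \<le> norm \<phi> * norm x * 24" by (simp add: mult_ac)
  qed
qed

section \<open>Antisymmetry and Jacobi identity on linear functionals\<close>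

lemma ures_pairing_minus: "ures_pairing \<mu> (- A) = - ures_pairing \<mu> A"
  using ures_pairing_scaleR[of \<mu> "-1" A] by simp

lemma apply_ures_hamiltonian:
  "\<phi> (ures_hamiltonian \<psi> (\<mu>, \<gamma>))
    = ures_pairing \<mu> (commutator (ures_part \<phi>) (ures_part \<psi>)) - \<gamma> * ures_pairing (ures_dcomm (ures_part \<psi>)) (ures_part \<phi>)"
  for \<phi> \<psi> :: "('h::polarized_hilbert_space ures_predual \<times> real) \<Rightarrow>\<^sub>L real"
proof -
  interpret bounded_linear "\<lambda>\<nu>. ures_pairing \<nu> (ures_part \<phi>)" by (rule bounded_linear_ures_pairing[OF ures_part(1)])
  show ?thesis
    by (simp add: ures_hamiltonian_def ures_part(2) diff scaleR ures_pairing_coad ures_part(1))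
qed

lemma ures_hamiltonian_antisym: "\<phi> (ures_hamiltonian \<psi> x) = - \<psi> (ures_hamiltonian \<phi> x)"
  for \<phi> \<psi> :: "('h::polarized_hilbert_space ures_predual \<times> real) \<Rightarrow>\<^sub>L real"
proof (cases x)
  case (Pair \<mu> \<gamma>)
  have "commutator (ures_part \<phi>) (ures_part \<psi>) = - commutator (ures_part \<psi>) (ures_part \<phi>)"
    by (simp add: commutator_def)
  then show ?thesis
    using ures_pairing_dcomm_antisym[OF ures_part(1) ures_part(1), of \<phi> \<psi>]
    unfolding Pair apply_ures_hamiltonian by (simp add: ures_pairing_minus)
qed

text \<open>The cocycle identity for s: the commutator with d is a derivation, so pairing [d,
  [B, C]] with A gives two of the cyclic terms, and antisymmetry turns it into minus the
  third.\<close>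

lemma ures_dcomm_jacobi:
  assumes A: "A \<in> ures" and B: "B \<in> ures" and C: "C \<in> ures"
  shows "ures_pairing (ures_dcomm C) (commutator A B) + ures_pairing (ures_dcomm A) (commutator B C)
    + ures_pairing (ures_dcomm B) (commutator C A) = 0"
proof -
  interpret bounded_linear "\<lambda>\<nu>. ures_pairing \<nu> A" by (rule bounded_linear_ures_pairing[OF A])
  have CA: "commutator C A = - commutator A C" by (simp add: commutator_def)
  have "ures_pairing (ures_dcomm (commutator B C)) A
      = ures_pairing (ures_dcomm C) (commutator A B) - ures_pairing (ures_dcomm B) (commutator A C)"
    by (simp add: ures_dcomm_commutator[OF B C] diff ures_pairing_coad A B C)
  moreover have "ures_pairing (ures_dcomm (commutator B C)) A = - ures_pairing (ures_dcomm A) (commutator B C)"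
    by (rule ures_pairing_dcomm_antisym[OF A ures_commutator[OF B C]])
  ultimately show ?thesis unfolding CA ures_pairing_minus by simp
qed

text \<open>The operator Jacobi identity settles the \<mu> part and the cocycle identity the
  \<gamma> part: together the Jacobi identity of the central extension.\<close>

lemma ures_hamiltonian_jacobi:
  "\<phi> (ures_hamiltonian \<psi> (ures_hamiltonian \<xi> x)) + \<psi> (ures_hamiltonian \<xi> (ures_hamiltonian \<phi> x))
    + \<xi> (ures_hamiltonian \<phi> (ures_hamiltonian \<psi> x)) = 0"
  for \<phi> \<psi> \<xi> :: "('h::polarized_hilbert_space ures_predual \<times> real) \<Rightarrow>\<^sub>L real"
proof (cases x)
  case (Pair \<mu> \<gamma>)
  note u = ures_part(1)
  have eq: "\<phi> (ures_hamiltonian \<psi> (ures_hamiltonian \<xi> (\<mu>, \<gamma>)))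
      = ures_pairing \<mu> (commutator (commutator (ures_part \<phi>) (ures_part \<psi>)) (ures_part \<xi>))
        - \<gamma> * ures_pairing (ures_dcomm (ures_part \<xi>)) (commutator (ures_part \<phi>) (ures_part \<psi>))"
    for \<phi> \<psi> \<xi> :: "('h ures_predual \<times> real) \<Rightarrow>\<^sub>L real"
  proof -
    interpret bounded_linear "\<lambda>\<nu>. ures_pairing \<nu> (commutator (ures_part \<phi>) (ures_part \<psi>))"
      by (rule bounded_linear_ures_pairing[OF ures_commutator[OF u u]])
    \<comment> \<open>The inner vector has second component zero, so the outer \<psi> contributes no
      cocycle term.\<close>
    show ?thesis
      by (subst (2) ures_hamiltonian_def)
        (simp add: apply_ures_hamiltonian diff scaleR ures_pairing_coad ures_commutator u)
  qed
  let ?A = "ures_part \<phi>" and ?B = "ures_part \<psi>" and ?C = "ures_part \<xi>"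
  have "commutator (commutator ?A ?B) ?C + commutator (commutator ?B ?C) ?A + commutator (commutator ?C ?A) ?B = 0"
    by (simp add: commutator_def blinfun_compose_simps blinfun_compose_assoc)
  then have "ures_pairing \<mu> (commutator (commutator ?A ?B) ?C) + ures_pairing \<mu> (commutator (commutator ?B ?C) ?A)
      + ures_pairing \<mu> (commutator (commutator ?C ?A) ?B) = ures_pairing \<mu> 0"
    by (simp add: ures_add ures_commutator u flip: ures_pairing_add)
  also have "ures_pairing \<mu> 0 = 0" using ures_pairing_scaleR[of \<mu> 0 0] by simp
  finally have "ures_pairing \<mu> (commutator (commutator ?A ?B) ?C) + ures_pairing \<mu> (commutator (commutator ?B ?C) ?A)
      + ures_pairing \<mu> (commutator (commutator ?C ?A) ?B) = 0" .
  moreover have "\<gamma> * ures_pairing (ures_dcomm ?C) (commutator ?A ?B) + \<gamma> * ures_pairing (ures_dcomm ?A) (commutator ?B ?C)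
      + \<gamma> * ures_pairing (ures_dcomm ?B) (commutator ?C ?A) = 0"
    using ures_dcomm_jacobi[OF u u u, of \<xi> \<phi> \<psi>] by (simp flip: distrib_left)
  ultimately show ?thesis unfolding Pair eq by linarith
qed

text \<open>The partial derivative is the total one on vectors (\<nu>, 0). Uniqueness of derivatives
  and \<open>ures_eqI\<close> make the description in \<open>D_mu\<close> well defined.\<close>

lemma D_mu_eq:
  assumes "smooth f"
  shows "D_mu f x = ures_part (frechet_blinfun f x)"
proof (cases x)
  case (Pair \<mu> \<gamma>)
  let ?A = "ures_part (frechet_blinfun f (\<mu>, \<gamma>))"
  have "((\<lambda>\<nu>. (\<nu>, \<gamma>)) has_derivative (\<lambda>\<nu>. (\<nu>, 0))) (at \<mu>)"
    by (intro has_derivative_Pair has_derivative_ident has_derivative_const)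
  from has_derivative_compose[OF this smooth_has_derivative[OF assms]]
  have d: "((\<lambda>\<nu>. f (\<nu>, \<gamma>)) has_derivative (\<lambda>\<nu>. ures_pairing \<nu> ?A)) (at \<mu>)"
    by (simp add: ures_part(2))
  show ?thesis
    unfolding D_mu_def Pair prod.case
  proof (rule the_equality)
    show "?A \<in> ures \<and> ((\<lambda>\<nu>. f (\<nu>, \<gamma>)) has_derivative (\<lambda>\<nu>. ures_pairing \<nu> ?A)) (at \<mu>)"
      using ures_part(1) d by blast
    fix B assume B: "B \<in> ures \<and> ((\<lambda>\<nu>. f (\<nu>, \<gamma>)) has_derivative (\<lambda>\<nu>. ures_pairing \<nu> B)) (at \<mu>)"
    then have "(\<lambda>\<nu>. ures_pairing \<nu> B) = (\<lambda>\<nu>. ures_pairing \<nu> ?A)"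
      using has_derivative_unique d by blast
    then show "B = ?A" using B ures_part(1) by (intro ures_eqI) (auto dest: fun_cong)
  qed
qed

theorem proposition2p5:
  shows "banach_lie_poisson_space
    (ures_bracket :: ('h::polarized_hilbert_space ures_predual \<times> real \<Rightarrow> real)
      \<Rightarrow> ('h ures_predual \<times> real \<Rightarrow> real) \<Rightarrow> ('h ures_predual \<times> real \<Rightarrow> real))"
proof (rule banach_lie_poisson_spaceI[OF bounded_bilinear_ures_hamiltonian ures_hamiltonian_antisym
      ures_hamiltonian_jacobi])
  fix f g :: "'h ures_predual \<times> real \<Rightarrow> real" and x
  assume "smooth f" "smooth g"
  \<comment> \<open>By \<open>D_mu_eq\<close> the right side is the bracket formula, with s in the
    form of \<open>ures_cocycle_eq_pairing\<close>.\<close>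
  then show "ures_bracket f g x = frechet_blinfun f x (ures_hamiltonian (frechet_blinfun g x) x)"
    by (cases x)
      (simp add: ures_bracket_def D_mu_eq apply_ures_hamiltonian ures_cocycle_eq_pairing ures_part(1))
qed

end
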